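(* Let $(T(t))_{t\ge 0}$ be a bounded $C_0$-semigroup on a Banach space $X$, with generator $-A$ such that $$0\in\sigma(A)\subset\mathbb{C}_+\cup\{0\}\quad\text{and}\quad\|(is+A)^{-1}\|=O(1),\quad |s|\to\infty.$$ Let $\ell$ be a slowly varying function on $\mathbb{R}_+$ such that $g:s\mapsto s^{1-\beta}\ell(s)$ is increasing for some $\beta\in(0,1]$. If there exists $\alpha>1$ such that $$\|(is+A)^{-1}\|=O\left(\frac{1}{|s|^{\alpha}\ell(1/|s|)}\right),\qquad s\to 0,$$ then $$\sup_{\lambda\in\mathbb{C}_+}\|(\lambda+A)^{-1}V_{\alpha,\beta,\ell}(A)\|<\infty.$$
   Context: $\mathbb{R}_+=[0,\infty)$, $\mathbb{C}_+=\{\lambda:\operatorname{Re}\lambda>0\}$. A strictly positive measurable function $\ell$ is slowly varying if $\lim_{s\to\infty}\ell(\lambda s)/\ell(s)=1$ for every $\lambda>0$. "Increasing" means non-decreasing. Definition of $V_{\alpha,\beta,\ell}(A)$. For $g(s)=s^{1-\beta}\ell(s)$ let $$S_g(\lambda)=\int_{0+}^\infty\frac{d(s^{1-\beta}\ell(s))}{s+\lambda}\quad(\lambda>0),$$ where the integral over $(0,\infty)$ is with respect to the Lebesgue-Stieltjes measure of $g$. Put $f_g(\lambda)=S_g(1/\lambda)$ and $f_m(\lambda)=\dfrac{f_g(\lambda)}{1+f_g(\lambda)}$ for $\lambda>0$. Then $f_g$ and $f_m$ are complete Bernstein functions, $f_m$ is bounded, and $$V_{\alpha,\beta,\ell}(A):=B(A)^{\alpha-\beta}f_m(A)=B(A)^{\alpha-\beta}f_g(A)(I+f_g(A))^{-1},\qquad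 B(A):=A(I+A)^{-1},$$ which is a bounded operator; $B(A)^{\alpha-\beta}$ is the usual fractional power of the bounded sectorial operator $B(A)$. Here a complete Bernstein function is a function $f:(0,\infty)\to[0,\infty)$ of the form $f(\lambda)=a+b\lambda+\int_{0+}^\infty\frac{\lambda}{s+\lambda}\,d\mu(s)$ with $a,b\ge 0$ and $\mu$ a positive Radon measure on $(0,\infty)$ with $\int_{0+}^\infty\frac{d\mu(s)}{s+1}<\infty$; and for a sectorial operator $A$ (densely defined, $(-\infty,0)\subset\rho(A)$, $\sup_{\lambda>0}\|\lambda(\lambda+A)^{-1}\|<\infty$), $f(A)$ is the closure of the operator $x\mapsto ax+bAx+\int_{0+}^\infty A(\lambda+A)^{-1}x\,d\mu(\lambda)$ on $\operatorname{dom}(A)$. It is bounded when $f$ is bounded. *)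

theory Defs
  imports "HOL-Analysis.Analysis" "HOL-Library.Landau_Symbols"
begin

section \<open>Complex Banach spaces\<close>

class complex_banach = banach +
  fixes scaleC :: "complex \<Rightarrow> 'a \<Rightarrow> 'a"  (infixr "*\<^sub>C" 75)
  assumes scaleC_add_right: "c *\<^sub>C (x + y) = c *\<^sub>C x + c *\<^sub>C y"
    and scaleC_add_left: "(c + d) *\<^sub>C x = c *\<^sub>C x + d *\<^sub>C x"
    and scaleC_scaleC: "c *\<^sub>C d *\<^sub>C x = (c * d) *\<^sub>C x"
    and scaleC_of_real: "complex_of_real r *\<^sub>C x = r *\<^sub>R x"
    and norm_scaleC: "norm (c *\<^sub>C x) = cmod c * norm x"

instantiation complex :: complex_banach
begin

definition scaleC_complex :: "complex \<Rightarrow> complex \<Rightarrow> complex"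
  where "scaleC_complex c x = c * x"

instance
  by standard (simp_all add: scaleC_complex_def algebra_simps norm_mult scaleR_conv_of_real)

end


section \<open>Unbounded operators\<close>

text \<open>
  A possibly unbounded operator is represented by its graph, a set of pairs
  \<open>(x, A x)\<close> with \<open>x\<close> in the domain. The domain is then \<^const>\<open>Domain\<close>, the closure
  of an operator is the \<^const>\<open>closure\<close> of its graph in the product topology, and the
  inverse is the converse relation.
\<close>

type_synonym 'a oper = "('a \<times> 'a) set"

definition op_app :: "'a oper \<Rightarrow> 'a \<Rightarrow> 'a"
  where "op_app G x = (THE y. (x, y) \<in> G)"

definition op_comp :: "'a oper \<Rightarrow> 'a oper \<Rightarrow> 'a oper"
  where "op_comp G H = H O G"

definition op_inv :: "'a oper \<Rightarrow> 'a oper"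
  where "op_inv G = converse G"

definition op_neg :: "'a::uminus oper \<Rightarrow> 'a oper"
  where "op_neg A = {(x, - y) | x y. (x, y) \<in> A}"

text \<open>The operator \<open>z I + A\<close>, with domain that of \<open>A\<close>.\<close>

definition op_shift :: "complex \<Rightarrow> 'a::complex_banach oper \<Rightarrow> 'a oper"
  where "op_shift z A = {(x, z *\<^sub>C x + y) | x y. (x, y) \<in> A}"

definition bounded_op :: "'a::real_normed_vector oper \<Rightarrow> bool"
  where "bounded_op G \<longleftrightarrow> (\<exists>f. bounded_linear f \<and> G = {(x, f x) | x. True})"

text \<open>The norm is infinite unless the operator is bounded and defined everywhere.\<close>

definition op_norm :: "'a::real_normed_vector oper \<Rightarrow> ennreal"
  where "op_norm G = (if bounded_op G then ennreal (onorm (op_app G)) else \<infinity>)"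

definition op_resolvent_set :: "'a::complex_banach oper \<Rightarrow> complex set"
  where "op_resolvent_set A = {z. bounded_op (op_inv (op_shift z (op_neg A)))}"

definition op_spectrum :: "'a::complex_banach oper \<Rightarrow> complex set"
  where "op_spectrum A = - op_resolvent_set A"

text \<open>The operator \<open>A (t I + A)\<^sup>-\<^sup>1\<close>; the case \<open>t = 1\<close> is \<open>B(A)\<close>.\<close>

definition op_quot :: "'a::complex_banach oper \<Rightarrow> real \<Rightarrow> 'a oper"
  where "op_quot A t = op_comp A (op_inv (op_shift (complex_of_real t) A))"


section \<open>Semigroups\<close>

definition c0_semigroup :: "(real \<Rightarrow> 'a \<Rightarrow>\<^sub>L 'a::complex_banach) \<Rightarrow> bool"
  where "c0_semigroup T \<longleftrightarrow>
    (\<forall>t\<ge>0. \<forall>c x. T t (c *\<^sub>C x) = c *\<^sub>C T t x) \<and>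
    T 0 = id_blinfun \<and>
    (\<forall>s\<ge>0. \<forall>t\<ge>0. T (s + t) = T s o\<^sub>L T t) \<and>
    (\<forall>x. ((\<lambda>t. T t x) \<longlongrightarrow> x) (at_right 0))"

definition bounded_semigroup :: "(real \<Rightarrow> 'a \<Rightarrow>\<^sub>L 'a::complex_banach) \<Rightarrow> bool"
  where "bounded_semigroup T \<longleftrightarrow> (\<exists>M. \<forall>t\<ge>0. norm (T t) \<le> M)"

definition generator :: "(real \<Rightarrow> 'a \<Rightarrow>\<^sub>L 'a::complex_banach) \<Rightarrow> 'a oper"
  where "generator T = {(x, y). ((\<lambda>t. (T t x - x) /\<^sub>R t) \<longlongrightarrow> y) (at_right 0)}"


section \<open>Bochner integrals without separability\<close>

text \<open>
  The library's \<^const>\<open>has_bochner_integral\<close> needs a second countable target space. Here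
  the target is an arbitrary Banach space, and strong measurability of \<open>f\<close> is expressed by
  almost everywhere convergence of the approximating simple functions.
\<close>

definition has_bochner :: "'m measure \<Rightarrow> ('m \<Rightarrow> 'a::banach) \<Rightarrow> 'a \<Rightarrow> bool"
  where "has_bochner M f y \<longleftrightarrow>
    (\<exists>s. (\<forall>i. Bochner_Integration.simple_bochner_integrable M (s i)) \<and>
         (AE x in M. (\<lambda>i. s i x) \<longlonglongrightarrow> f x) \<and>
         (\<lambda>i. \<integral>\<^sup>+x. ennreal (norm (f x - s i x)) \<partial>M) \<longlonglongrightarrow> 0 \<and>
         (\<lambda>i. Bochner_Integration.simple_bochner_integral M (s i)) \<longlonglongrightarrow> y)"


section \<open>Complete Bernstein functions and fractional powers of operators\<close>

text \<open>
  The measure lives on the Borel sets of \<open>(0,\<infinity>)\<close>; integrability of \<open>1 / (s + 1)\<close> makes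
  it finite on compact sets, hence Radon.
\<close>

definition cbf_rep :: "(real \<Rightarrow> real) \<Rightarrow> real \<Rightarrow> real \<Rightarrow> real measure \<Rightarrow> bool"
  where "cbf_rep f a b \<mu> \<longleftrightarrow>
    0 \<le> a \<and> 0 \<le> b \<and>
    sets \<mu> = sets (restrict_space borel {0<..}) \<and>
    integrable \<mu> (\<lambda>s. 1 / (s + 1)) \<and>
    (\<forall>t>0. f t = a + b * t + (\<integral>s. t / (s + t) \<partial>\<mu>))"

definition cbf_op_of :: "real \<Rightarrow> real \<Rightarrow> real measure \<Rightarrow> 'a::complex_banach oper \<Rightarrow> 'a oper"
  where "cbf_op_of a b \<mu> A =
    closure {(x, a *\<^sub>R x + b *\<^sub>R y + w) | x y w.
      (x, y) \<in> A \<and> has_bochner \<mu> (\<lambda>t. op_app (op_quot A t) x) w}"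

text \<open>The triple chosen here is unique whenever \<open>f\<close> is a complete Bernstein function.\<close>

definition cbf_op :: "(real \<Rightarrow> real) \<Rightarrow> 'a::complex_banach oper \<Rightarrow> 'a oper"
  where "cbf_op f A = (let (a, b, \<mu>) = (SOME (a, b, \<mu>). cbf_rep f a b \<mu>) in cbf_op_of a b \<mu> A)"

text \<open>
  Balakrishnan's formula for the power of a bounded sectorial operator with exponent in
  \<open>(0,1)\<close>, extended to exponents \<open>\<gamma> \<ge> 0\<close> by \<open>B\<^sup>n B\<^sup>\<theta>\<close> with \<open>n = \<lfloor>\<gamma>\<rfloor>\<close> and \<open>\<theta> = \<gamma> - n\<close>.
\<close>

definition balakrishnan :: "'a::complex_banach oper \<Rightarrow> real \<Rightarrow> 'a oper"
  where "balakrishnan B \<theta> =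
    {(x, (sin (pi * \<theta>) / pi) *\<^sub>R w) | x w.
      has_bochner (restrict_space lborel {0<..})
        (\<lambda>t. (t powr (\<theta> - 1)) *\<^sub>R op_app (op_quot B t) x) w}"

definition frac_power :: "'a::complex_banach oper \<Rightarrow> real \<Rightarrow> 'a oper"
  where "frac_power B \<gamma> =
    op_comp (B ^^ nat \<lfloor>\<gamma>\<rfloor>) (if frac \<gamma> = 0 then Id else balakrishnan B (frac \<gamma>))"


section \<open>Regularly varying functions and the operator V\<close>

definition slowly_varying :: "(real \<Rightarrow> real) \<Rightarrow> bool"
  where "slowly_varying l \<longleftrightarrow>
    l \<in> borel_measurable (lebesgue_on {0..}) \<and>
    (\<forall>s\<ge>0. 0 < l s) \<and>
    (\<forall>c>0. ((\<lambda>s. l (c * s) / l s) \<longlongrightarrow> 1) at_top)"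

text \<open>
  The function \<open>s\<^bsup>1-\<beta>\<^esup> l(s)\<close> on \<open>[0,\<infinity>)\<close>. The case distinction is needed because the
  library has \<open>0 powr 0 = 0\<close>, whereas for \<open>\<beta> = 1\<close> the function is \<open>l\<close>, also at \<open>0\<close>.
\<close>

definition reg_fun :: "real \<Rightarrow> (real \<Rightarrow> real) \<Rightarrow> real \<Rightarrow> real"
  where "reg_fun \<beta> l s = (if \<beta> = 1 then l s else s powr (1 - \<beta>) * l s)"

text \<open>
  The Lebesgue-Stieltjes measure of \<open>g\<close> on \<open>(0,\<infinity>)\<close>, where \<open>(u,v]\<close> has mass
  \<open>g(v+) - g(u+)\<close>: \<^const>\<open>interval_measure\<close> needs a right-continuous function on the whole
  line, so \<open>g\<close> is replaced by its right limits on \<open>[0,\<infinity>)\<close> and by \<open>g(0+)\<close> to the left of \<open>0\<close>.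
\<close>

definition stieltjes_measure :: "(real \<Rightarrow> real) \<Rightarrow> real measure"
  where "stieltjes_measure g =
    restrict_space (interval_measure (\<lambda>s. Lim (at_right (max s 0)) g)) {0<..}"

definition S_fun :: "(real \<Rightarrow> real) \<Rightarrow> real \<Rightarrow> real"
  where "S_fun g t = (\<integral>s. 1 / (s + t) \<partial>stieltjes_measure g)"

definition f_g :: "(real \<Rightarrow> real) \<Rightarrow> real \<Rightarrow> real"
  where "f_g g t = S_fun g (1 / t)"

definition f_m :: "(real \<Rightarrow> real) \<Rightarrow> real \<Rightarrow> real"
  where "f_m g t = f_g g t / (1 + f_g g t)"

definition V_op :: "real \<Rightarrow> real \<Rightarrow> (real \<Rightarrow> real) \<Rightarrow> 'a::complex_banach oper \<Rightarrow> 'a oper"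
  where "V_op \<alpha> \<beta> l A =
    op_comp (frac_power (op_quot A 1) (\<alpha> - \<beta>)) (cbf_op (f_m (reg_fun \<beta> l)) A)"

end

theory Submission
  imports Defs "HOL-Probability.Probability"
begin

text \<open>
  Write \<open>R(z) = (z + A)\<^sup>-\<^sup>1\<close>, \<open>Q(s) = A (s + A)\<^sup>-\<^sup>1 = I - s R(s)\<close>, \<open>B = Q(1)\<close>, \<open>\<gamma> = \<alpha> - \<beta>\<close> and let \<open>f\<close>
  be the bounded complete Bernstein function \<open>f\<^sub>m\<close>, so that the operator in question is
  \<open>R(z) B\<^sup>\<gamma> f(A)\<close>. At a point \<open>z = i\<tau>\<close> close to \<open>0\<close> the large part of \<open>R(z)\<close> lives where \<open>A\<close> has
  size \<open>\<bar>\<tau>\<bar>\<close>, so that \<open>B\<^sup>\<gamma>\<close> should gain a factor \<open>\<bar>\<tau>\<bar>\<^sup>\<gamma>\<close> and \<open>f(A)\<close> a factor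
  \<open>f(\<bar>\<tau>\<bar>) \<le> C \<bar>\<tau>\<bar>\<^sup>\<beta> \<ell>(1/\<bar>\<tau>\<bar>)\<close>. Together they compensate \<open>\<parallel>R(i\<tau>)\<parallel> = O(\<bar>\<tau>\<bar>\<^sup>-\<^sup>\<alpha> / \<ell>(1/\<bar>\<tau>\<bar>))\<close> exactly.

  Both gains come from the identity \<open>(s - z) R(z) Q(s) = s R(s) - z R(z)\<close>, integrated over \<open>s\<close>.
  In Balakrishnan's formula, where \<open>B (t + B)\<^sup>-\<^sup>1 = Q(t/(1+t)) / (1+t)\<close>, it gives
  \<open>\<parallel>R(i\<tau>) B\<^sup>\<gamma>\<parallel> \<le> C (\<bar>\<tau>\<bar>\<^sup>\<gamma> \<parallel>R(i\<tau>)\<parallel> + \<bar>\<tau>\<bar>\<^sup>e)\<close> with \<open>e = min (\<gamma> - 1) 0\<close>. In \<open>f(A) = \<integral> Q(s) d\<mu>(s)\<close> it gives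
  \<open>\<parallel>R(i\<tau>) f(A) y\<parallel> \<le> 2 f(\<bar>\<tau>\<bar>) \<parallel>R(i\<tau>) y\<parallel> + 2 \<integral> \<parallel>R(s) y\<parallel> d\<mu>(s)\<close>. For \<open>y = B\<^sup>\<gamma> x\<close> the last integral is at
  most \<open>C \<integral> s\<^sup>e d\<mu>(s) \<parallel>x\<parallel>\<close>, and this is finite: by regular variation \<open>f(t) = O(t\<^bsup>\<beta>-\<epsilon>\<^esup>)\<close> at \<open>0\<close>,
  which bounds \<open>\<mu>\<close> near \<open>0\<close>, and \<open>\<beta> + e > 0\<close> because \<open>\<alpha> > 1\<close>. Away from \<open>0\<close> the resolvent is
  bounded on the imaginary axis by continuity and by the hypothesis at infinity. Since
  \<open>Re z \<parallel>R(z)\<parallel> \<le> M\<close> for a bounded semigroup, the resolvent identity carries bounds from \<open>i\<tau>\<close> to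
  the horizontal line through it, at the cost of a factor \<open>1 + M\<close>; hence the imaginary axis
  suffices. This is the content of \<open>fractional_power_estimates\<close>, \<open>half_plane_bound_of_average\<close>
  and \<open>half_plane_bound\<close>.

  The operator \<open>f(A)\<close> is defined through a representing measure of \<open>f = f\<^sub>g / (1 + f\<^sub>g)\<close>, so such a
  measure must be shown to exist (\<open>Stieltjes_quotient_cbf\<close>). In terms of the Stieltjes function
  \<open>S(x) = \<integral> d\<nu>(s) / (s + x)\<close> this says that \<open>S / (1 + S)\<close> is again a Stieltjes function. For a finite
  sum it is a partial fraction decomposition, whose poles interlace with those of \<open>S\<close> and whose
  residues are positive; the general case follows by approximating \<open>\<nu>\<close> with finite sums and
  extracting a limit of the representing measures with Helly's theorem. Any representation then
  serves: since \<open>f \<le> 1\<close> and \<open>f(0+) = 0\<close>, the constants \<open>a\<close> and \<open>b\<close> vanish and \<open>\<mu>\<close> has mass at most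
  \<open>1\<close> (\<open>cbf_rep_bounded_vanishing\<close>), and the estimates above depend only on the values of \<open>f\<close>.
\<close>

section \<open>Bochner integrals\<close>

abbreviation "sb_integrable \<equiv> Bochner_Integration.simple_bochner_integrable"

abbreviation "sb_integral \<equiv> Bochner_Integration.simple_bochner_integral"

lemma simple_bochner_norm_diff:
  assumes "sb_integrable M s"
    and "sb_integrable M t"
  shows "(\<lambda>x. ennreal (norm (s x - t x))) \<in> borel_measurable M"
    and "ennreal (norm (sb_integral M s - sb_integral M t)) \<le> (\<integral>\<^sup>+x. ennreal (norm (s x - t x)) \<partial>M)"
proof -
  let ?d = "\<lambda>x. norm (s x - t x)"
  have d: "sb_integrable M ?d"
    by (rule simple_bochner_integrable_compose2[where p = "\<lambda>x y. norm (x - y)"]) (use assms in auto)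
  have d': "sb_integrable M (\<lambda>x. s x - t x)"
    by (rule simple_bochner_integrable_compose2) (use assms in auto)
  show "(\<lambda>x. ennreal (?d x)) \<in> borel_measurable M"
    using d by (auto elim!: simple_bochner_integrable.cases intro: borel_measurable_simple_function
        intro!: measurable_compose[OF _ measurable_ennreal])
  have "norm (sb_integral M s - sb_integral M t)
      \<le> sb_integral M ?d"
    using simple_bochner_integral_norm_bound[OF d'] simple_bochner_integral_diff[OF assms] by simp
  then show "ennreal (norm (sb_integral M s
        - sb_integral M t)) \<le> (\<integral>\<^sup>+x. ennreal (?d x) \<partial>M)"
    using simple_bochner_integral_eq_nn_integral[OF d] by (metis ennreal_leI norm_ge_zero)
qed

text \<open>
  A function with a Bochner integral need not be measurable itself. Being an almost everywhere
  limit of simple functions, its distance to a simple function still agrees almost everywhere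
  with a measurable function. This rescues the triangle inequality under the nonnegative
  integral, which is subadditive on measurable functions only.
\<close>

lemma norm_diff_AE_measurable:
  assumes "\<And>i. sb_integrable M (s i)"
    and "AE x in M. (\<lambda>i. s i x) \<longlonglongrightarrow> f x"
    and "sb_integrable M t"
  obtains u where "u \<in> borel_measurable M" "AE x in M. ennreal (norm (f x - t x)) = u x"
proof
  let ?u = "\<lambda>x. liminf (\<lambda>j. ennreal (norm (s j x - t x)))"
  show "?u \<in> borel_measurable M"
    using simple_bochner_norm_diff(1)[OF assms(1) assms(3)] by measurable
  show "AE x in M. ennreal (norm (f x - t x)) = ?u x"
    using assms(2)
  proof eventually_elim
    case (elim x)
    then have "(\<lambda>j. ennreal (norm (s j x - t x))) \<longlonglongrightarrow> ennreal (norm (f x - t x))"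
      by (intro tendsto_intros)
    from lim_imp_Liminf[OF _ this] show ?case by simp
  qed
qed

lemma has_bochner_diff:
  assumes "has_bochner M f y" and "has_bochner M g z"
  shows "has_bochner M (\<lambda>x. f x - g x) (y - z)"
proof -
  obtain s where s: "\<And>i. sb_integrable M (s i)"
    "AE x in M. (\<lambda>i. s i x) \<longlonglongrightarrow> f x"
    "(\<lambda>i. \<integral>\<^sup>+x. ennreal (norm (f x - s i x)) \<partial>M) \<longlonglongrightarrow> 0"
    "(\<lambda>i. sb_integral M (s i)) \<longlonglongrightarrow> y"
    using assms(1) unfolding has_bochner_def by blast
  obtain t where t: "\<And>i. sb_integrable M (t i)"
    "AE x in M. (\<lambda>i. t i x) \<longlonglongrightarrow> g x"
    "(\<lambda>i. \<integral>\<^sup>+x. ennreal (norm (g x - t i x)) \<partial>M) \<longlonglongrightarrow> 0"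
    "(\<lambda>i. sb_integral M (t i)) \<longlonglongrightarrow> z"
    using assms(2) unfolding has_bochner_def by blast
  have le: "(\<integral>\<^sup>+x. ennreal (norm ((f x - g x) - (s i x - t i x))) \<partial>M) \<le>
      (\<integral>\<^sup>+x. ennreal (norm (f x - s i x)) \<partial>M) + (\<integral>\<^sup>+x. ennreal (norm (g x - t i x)) \<partial>M)" for i
  proof -
    obtain u where u: "u \<in> borel_measurable M" "AE x in M. ennreal (norm (f x - s i x)) = u x"
      using norm_diff_AE_measurable[OF s(1,2) s(1)] by blast
    obtain v where v: "v \<in> borel_measurable M" "AE x in M. ennreal (norm (g x - t i x)) = v x"
      using norm_diff_AE_measurable[OF t(1,2) t(1)] by blast
    have "(\<integral>\<^sup>+x. ennreal (norm ((f x - g x) - (s i x - t i x))) \<partial>M) \<le> (\<integral>\<^sup>+x. u x + v x \<partial>M)"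
    proof (rule nn_integral_mono_AE)
      show "AE x in M. ennreal (norm ((f x - g x) - (s i x - t i x))) \<le> u x + v x"
        using u(2) v(2)
      proof eventually_elim
        case (elim x)
        have "norm ((f x - g x) - (s i x - t i x)) \<le> norm (f x - s i x) + norm (g x - t i x)"
          using norm_triangle_ineq4[of "f x - s i x" "g x - t i x"] by (simp add: algebra_simps)
        then show ?case unfolding elim[symmetric]
          by (metis ennreal_leI ennreal_plus norm_ge_zero)
      qed
    qed
    also have "\<dots> = (\<integral>\<^sup>+x. u x \<partial>M) + (\<integral>\<^sup>+x. v x \<partial>M)" by (rule nn_integral_add) fact+
    finally show ?thesis using nn_integral_cong_AE[OF u(2)] nn_integral_cong_AE[OF v(2)] by simp
  qed
  show ?thesis unfolding has_bochner_def
  proof (intro exI[of _ "\<lambda>i x. s i x - t i x"] conjI allI)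
    show "sb_integrable M (\<lambda>x. s i x - t i x)" for i
      by (rule simple_bochner_integrable_compose2) (use s(1) t(1) in auto)
    show "AE x in M. (\<lambda>i. s i x - t i x) \<longlonglongrightarrow> f x - g x"
      using s(2) t(2) by eventually_elim (rule tendsto_diff)
    show "(\<lambda>i. \<integral>\<^sup>+x. ennreal (norm (f x - g x - (s i x - t i x))) \<partial>M) \<longlonglongrightarrow> 0"
      by (rule tendsto_sandwich[OF _ _ tendsto_const tendsto_add[OF s(3) t(3), simplified]])
        (use le in auto)
    show "(\<lambda>i. sb_integral M (\<lambda>x. s i x - t i x)) \<longlonglongrightarrow> y - z"
      using tendsto_diff[OF s(4) t(4)] simple_bochner_integral_diff[OF s(1) t(1)] by simp
  qed
qed

text \<open>
  All uses of vector-valued integrals rest on this bound: uniqueness of the integral is the case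
  \<open>h = 0\<close> applied to a difference, and the operator estimates below take for \<open>h\<close> a scalar majorant.
\<close>

lemma has_bochner_norm_le:
  assumes "has_bochner M f y"
    and h: "h \<in> borel_measurable M" "AE x in M. ennreal (norm (f x)) \<le> h x"
  shows "ennreal (norm y) \<le> (\<integral>\<^sup>+x. h x \<partial>M)"
proof -
  obtain s where s: "\<And>i. sb_integrable M (s i)"
    "AE x in M. (\<lambda>i. s i x) \<longlonglongrightarrow> f x"
    "(\<lambda>i. \<integral>\<^sup>+x. ennreal (norm (f x - s i x)) \<partial>M) \<longlonglongrightarrow> 0"
    "(\<lambda>i. sb_integral M (s i)) \<longlonglongrightarrow> y"
    using assms(1) unfolding has_bochner_def by blast
  have z: "sb_integrable M (\<lambda>x. 0::'b)"
    by (auto intro!: simple_bochner_integrable.intros)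
  have z0: "sb_integral M (\<lambda>x. 0::'b) = 0"
    by (auto simp: simple_bochner_integral_def intro!: sum.neutral)
  have le: "ennreal (norm (sb_integral M (s i)))
      \<le> (\<integral>\<^sup>+x. h x \<partial>M) + (\<integral>\<^sup>+x. ennreal (norm (f x - s i x)) \<partial>M)" for i
  proof -
    obtain u where u: "u \<in> borel_measurable M" "AE x in M. ennreal (norm (f x - s i x)) = u x"
      using norm_diff_AE_measurable[OF s(1,2) s(1)] by blast
    have "ennreal (norm (sb_integral M (s i)))
        \<le> (\<integral>\<^sup>+x. ennreal (norm (s i x)) \<partial>M)"
      using simple_bochner_norm_diff(2)[OF s(1) z, of i] z0 by simp
    also have "\<dots> \<le> (\<integral>\<^sup>+x. h x + u x \<partial>M)"
    proof (rule nn_integral_mono_AE)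
      show "AE x in M. ennreal (norm (s i x)) \<le> h x + u x"
        using u(2) h(2)
      proof eventually_elim
        case (elim x)
        have "norm (s i x) \<le> norm (f x) + norm (f x - s i x)"
          using norm_triangle_ineq4[of "f x" "f x - s i x"] by simp
        then have "ennreal (norm (s i x)) \<le> ennreal (norm (f x)) + ennreal (norm (f x - s i x))"
          by (metis ennreal_leI ennreal_plus norm_ge_zero)
        then show ?case using elim by (metis add_right_mono order_trans)
      qed
    qed
    also have "\<dots> = (\<integral>\<^sup>+x. h x \<partial>M) + (\<integral>\<^sup>+x. u x \<partial>M)" by (rule nn_integral_add) fact+
    finally show ?thesis using nn_integral_cong_AE[OF u(2)] by simp
  qed
  have l: "(\<lambda>i. ennreal (norm (sb_integral M (s i)))) \<longlonglongrightarrow> ennreal (norm y)"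
    using s(4) by (intro tendsto_intros)
  have r: "(\<lambda>i. (\<integral>\<^sup>+x. h x \<partial>M) + (\<integral>\<^sup>+x. ennreal (norm (f x - s i x)) \<partial>M)) \<longlonglongrightarrow> (\<integral>\<^sup>+x. h x \<partial>M) + 0"
    by (intro tendsto_add tendsto_const s(3))
  show ?thesis using LIMSEQ_le[OF l r] le by simp
qed

lemma has_bochner_unique:
  assumes "has_bochner M f y" and "has_bochner M f z"
  shows "y = z"
  using has_bochner_norm_le[OF has_bochner_diff[OF assms], of "\<lambda>_. 0"] by simp

lemma has_bochner_bounded_linear:
  assumes "bounded_linear L" and "has_bochner M f y"
  shows "has_bochner M (\<lambda>x. L (f x)) (L y)"
proof -
  interpret L: bounded_linear L by fact
  obtain s where s: "\<And>i. sb_integrable M (s i)"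
    "AE x in M. (\<lambda>i. s i x) \<longlonglongrightarrow> f x"
    "(\<lambda>i. \<integral>\<^sup>+x. ennreal (norm (f x - s i x)) \<partial>M) \<longlonglongrightarrow> 0"
    "(\<lambda>i. sb_integral M (s i)) \<longlonglongrightarrow> y"
    using assms(2) unfolding has_bochner_def by blast
  obtain K where K: "K \<ge> 0" "\<And>x. norm (L x) \<le> norm x * K"
    using L.nonneg_bounded by blast
  have le: "(\<integral>\<^sup>+x. ennreal (norm (L (f x) - L (s i x))) \<partial>M)
      \<le> ennreal K * (\<integral>\<^sup>+x. ennreal (norm (f x - s i x)) \<partial>M)" for i
  proof -
    obtain u where u: "u \<in> borel_measurable M" "AE x in M. ennreal (norm (f x - s i x)) = u x"
      using norm_diff_AE_measurable[OF s(1,2) s(1)] by blast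
    have "(\<integral>\<^sup>+x. ennreal (norm (L (f x) - L (s i x))) \<partial>M) \<le> (\<integral>\<^sup>+x. ennreal K * u x \<partial>M)"
    proof (rule nn_integral_mono_AE)
      show "AE x in M. ennreal (norm (L (f x) - L (s i x))) \<le> ennreal K * u x"
        using u(2)
      proof eventually_elim
        case (elim x)
        have "norm (L (f x) - L (s i x)) \<le> K * norm (f x - s i x)"
          using K(2)[of "f x - s i x"] by (simp add: L.diff mult.commute)
        then show ?case unfolding elim[symmetric] using K(1)
          by (metis ennreal_leI ennreal_mult norm_ge_zero)
      qed
    qed
    also have "\<dots> = ennreal K * (\<integral>\<^sup>+x. u x \<partial>M)" by (rule nn_integral_cmult) fact
    finally show ?thesis using nn_integral_cong_AE[OF u(2)] by simp
  qed
  have z: "(\<lambda>i. ennreal K * (\<integral>\<^sup>+x. ennreal (norm (f x - s i x)) \<partial>M)) \<longlonglongrightarrow> 0"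
    using ennreal_tendsto_cmult[OF _ s(3), of "ennreal K"] by simp
  show ?thesis unfolding has_bochner_def
  proof (intro exI[of _ "\<lambda>i x. L (s i x)"] conjI allI)
    show "sb_integrable M (\<lambda>x. L (s i x))" for i
      by (rule simple_bochner_integrable_compose2[where p = "\<lambda>x y. L x"]) (use s(1) L.zero in auto)
    show "AE x in M. (\<lambda>i. L (s i x)) \<longlonglongrightarrow> L (f x)"
      using s(2) by eventually_elim (rule L.tendsto)
    show "(\<lambda>i. \<integral>\<^sup>+x. ennreal (norm (L (f x) - L (s i x))) \<partial>M) \<longlonglongrightarrow> 0"
      by (rule tendsto_sandwich[OF _ _ tendsto_const z]) (use le in auto)
    show "(\<lambda>i. sb_integral M (\<lambda>x. L (s i x))) \<longlonglongrightarrow> L y"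
      using L.tendsto[OF s(4)] simple_bochner_integral_linear[OF L.linear s(1)] by simp
  qed
qed

lemma has_bochner_cong:
  assumes "\<And>x. x \<in> space M \<Longrightarrow> f x = g x"
  shows "has_bochner M f y \<longleftrightarrow> has_bochner M g y"
proof -
  have "has_bochner M g y" if "has_bochner M f y" "\<And>x. x \<in> space M \<Longrightarrow> f x = g x" for f g
  proof -
    from that(1) obtain s where s: "\<And>i. sb_integrable M (s i)"
      "AE x in M. (\<lambda>i. s i x) \<longlonglongrightarrow> f x"
      "(\<lambda>i. \<integral>\<^sup>+x. ennreal (norm (f x - s i x)) \<partial>M) \<longlonglongrightarrow> 0"
      "(\<lambda>i. sb_integral M (s i)) \<longlonglongrightarrow> y"
      unfolding has_bochner_def by blast
    have "AE x in M. (\<lambda>i. s i x) \<longlonglongrightarrow> g x"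
      using s(2) AE_space by eventually_elim (use that(2) in simp)
    moreover have "(\<integral>\<^sup>+x. ennreal (norm (f x - s i x)) \<partial>M) = (\<integral>\<^sup>+x. ennreal (norm (g x - s i x)) \<partial>M)" for i
      by (rule nn_integral_cong) (use that(2) in simp)
    ultimately show ?thesis using s unfolding has_bochner_def by (intro exI[of _ s]) simp
  qed
  then show ?thesis using assms by metis
qed

lemma
  assumes "sets M = sets (restrict_space borel {0<..} :: real measure)"
  shows space_pos: "space M = {0<..}"
    and sets_pos: "A \<in> sets borel \<Longrightarrow> A \<subseteq> {0<..} \<Longrightarrow> A \<in> sets M"
proof -
  show "space M = {0<..}" using sets_eq_imp_space_eq[OF assms] by (simp add: space_restrict_space)
  show "A \<in> sets M" if "A \<in> sets borel" "A \<subseteq> {0<..}"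
    unfolding assms sets_restrict_space by (rule image_eqI[of _ _ A]) (use that in auto)
qed

lemma borel_measurable_pos:
  fixes f :: "real \<Rightarrow> 'b::topological_space"
  assumes M: "sets M = sets (restrict_space borel {0<..})" and "f \<in> borel_measurable borel"
  shows "f \<in> borel_measurable M"
  using measurable_restrict_space1[OF assms(2), of "{0<..}"] by (simp only: measurable_cong_sets[OF M refl])

text \<open>
  Rounding the argument down to a grid of mesh \<open>\<delta>\<close> on \<open>[a, b]\<close> takes finitely many values. The
  clamping to \<open>[a, b]\<close> inside the floor matters only off \<open>[a, b]\<close>, where it keeps the range finite.
\<close>

lemma simple_function_grid:
  fixes f :: "real \<Rightarrow> 'a" and a b \<delta> :: real
  assumes M: "sets M = sets (restrict_space borel {0<..})" and "\<delta> > 0"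
  shows "simple_function M (\<lambda>x. if x \<in> {a..b} then f (max a (\<delta> * \<lfloor>max a (min b x) / \<delta>\<rfloor>)) else c)"
proof -
  let ?m = "\<lambda>x::real. \<lfloor>max a (min b x) / \<delta>\<rfloor>"
  have m: "?m \<in> measurable M (count_space UNIV)"
  proof -
    have "?m \<in> measurable borel (count_space UNIV)" by measurable
    then have "?m \<in> measurable (restrict_space borel {0<..}) (count_space UNIV)"
      by (rule measurable_restrict_space1)
    then show ?thesis by (simp only: measurable_cong_sets[OF M refl])
  qed
  have fin: "finite (?m ` space M)"
  proof (rule finite_subset)
    show "?m ` space M \<subseteq> {\<lfloor>min a b / \<delta>\<rfloor> .. \<lfloor>max a b / \<delta>\<rfloor>}"
      using \<open>\<delta> > 0\<close> by (auto intro!: floor_mono divide_right_mono)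
  qed simp
  have sm: "simple_function M ?m"
    unfolding simple_function_def using fin m by (auto intro: measurable_sets)
  show ?thesis
  proof (rule simple_function_If)
    show "simple_function M (\<lambda>x. f (max a (\<delta> * \<lfloor>max a (min b x) / \<delta>\<rfloor>)))"
      using simple_function_compose1[OF sm, of "\<lambda>k. f (max a (\<delta> * k))"] .
    show "{x \<in> space M. x \<in> {a..b}} \<in> sets M"
      by (rule sets_pos[OF M]) (auto simp: space_pos[OF M] Int_def[symmetric] Collect_conj_eq)
  qed simp
qed

text \<open>
  On \<open>[1/n, n]\<close> the function is uniformly continuous, so rounding the argument to a fine enough
  grid approximates it uniformly there by a simple function; outside, the integrable majorant \<open>h\<close>
  controls the error. The target space may be any Banach space, as the values on the grid are
  finitely many.
\<close>

lemma has_bochner_exists_continuous: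
  fixes f :: "real \<Rightarrow> 'a::banach"
  assumes M: "sets M = sets (restrict_space borel {0<..})"
    and fin: "\<And>a b. 0 < a \<Longrightarrow> emeasure M {a..b} < \<infinity>"
    and f: "continuous_on {0<..} f"
    and h: "h \<in> borel_measurable M" "\<And>x. 0 < x \<Longrightarrow> ennreal (norm (f x)) \<le> h x" "(\<integral>\<^sup>+x. h x \<partial>M) < \<infinity>"
  shows "\<exists>y. has_bochner M f y"
proof -
  have sp: "space M = {0<..}" by (rule space_pos[OF M])
  define K where "K n = {1 / real (Suc n) .. real (Suc n)}" for n
  have K_pos: "K n \<subseteq> {0<..}" for n by (auto simp: K_def intro: less_le_trans[rotated])
  have K_sets: "K n \<in> sets M" for n
    by (rule sets_pos[OF M _ K_pos]) (simp add: K_def)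
  have K_fin: "emeasure M (K n) < \<infinity>" for n unfolding K_def by (rule fin) simp
  \<comment> \<open>The tolerance is divided by the measure of \<open>K n\<close>, so that the \<open>L\<^sup>1\<close> error tends to \<open>0\<close> as well.\<close>
  define e where "e n = 1 / (real (Suc n) * (1 + measure M (K n)))" for n
  have pos: "0 < 1 + measure M (K n)" for n
    using measure_nonneg[of M "K n"] by linarith
  have e_pos: "e n > 0" for n using pos[of n] unfolding e_def by (intro divide_pos_pos mult_pos_pos) auto
  have e_le: "e n \<le> inverse (real (Suc n))" for n
    unfolding e_def inverse_eq_divide by (rule frac_le) (use measure_nonneg[of M "K n"] in auto)
  have "\<exists>\<delta>>0. \<forall>x\<in>K n. \<forall>y\<in>K n. dist x y < \<delta> \<longrightarrow> dist (f x) (f y) < e n" for n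
  proof -
    have "uniformly_continuous_on (K n) f"
      by (rule compact_uniformly_continuous)
        (use continuous_on_subset[OF f K_pos] in \<open>auto simp: K_def\<close>)
    then show ?thesis unfolding uniformly_continuous_on_def using e_pos[of n] by (metis dist_commute)
  qed
  then obtain \<delta> where \<delta>: "\<And>n. \<delta> n > 0"
    "\<And>n x y. x \<in> K n \<Longrightarrow> y \<in> K n \<Longrightarrow> dist x y < \<delta> n \<Longrightarrow> dist (f x) (f y) < e n" by metis
  define s where "s n = (\<lambda>x. if x \<in> K n then f (max (1 / real (Suc n))
      (\<delta> n * \<lfloor>max (1 / real (Suc n)) (min (real (Suc n)) x) / \<delta> n\<rfloor>)) else 0)" for n
  have s_close: "norm (f x - s n x) \<le> e n" if "x \<in> K n" for n x
  proof -
    let ?p = "max (1 / real (Suc n)) (\<delta> n * \<lfloor>max (1 / real (Suc n)) (min (real (Suc n)) x) / \<delta> n\<rfloor>)"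
    have xx: "max (1 / real (Suc n)) (min (real (Suc n)) x) = x" using that by (auto simp: K_def)
    have "\<delta> n * \<lfloor>x / \<delta> n\<rfloor> \<le> x" "x < \<delta> n * \<lfloor>x / \<delta> n\<rfloor> + \<delta> n"
      using \<delta>(1)[of n] floor_divide_lower[OF \<delta>(1), of x n] floor_divide_upper[OF \<delta>(1), of x n]
      by (auto simp: algebra_simps)
    then have "?p \<le> x" "x - ?p < \<delta> n" "?p \<in> K n"
      using that \<delta>(1)[of n] unfolding xx by (auto simp: K_def)
    then have "dist (f x) (f ?p) < e n" using that by (intro \<delta>(2)) (auto simp: dist_real_def)
    then show ?thesis using that by (simp add: s_def dist_norm)
  qed
  have s_out: "s n x = 0" if "x \<notin> K n" for n x using that by (simp add: s_def)
  have sbi: "sb_integrable M (s n)" for n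
  proof
    show "simple_function M (s n)" unfolding s_def K_def by (rule simple_function_grid[OF M \<delta>(1)])
    have "emeasure M {y \<in> space M. s n y \<noteq> 0} \<le> emeasure M (K n)"
      using s_out K_sets by (intro emeasure_mono) auto
    then show "emeasure M {y \<in> space M. s n y \<noteq> 0} \<noteq> \<infinity>" using K_fin[of n] by (simp add: top_unique less_top)
  qed
  have inK: "eventually (\<lambda>n. x \<in> K n) sequentially" if "x > 0" for x
  proof -
    obtain N where N: "max x (1 / x) \<le> real N" using real_arch_simple by blast
    show ?thesis
    proof (rule eventually_sequentiallyI[of N])
      fix n assume "N \<le> n"
      then have "x \<le> real (Suc n)" "1 / x \<le> real (Suc n)" using N by linarith+
      then have "1 \<le> real (Suc n) * x" using that by (simp add: pos_divide_le_eq del: of_nat_Suc)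
      then show "x \<in> K n" using \<open>x \<le> real (Suc n)\<close> by (simp add: K_def pos_divide_le_eq mult.commute del: of_nat_Suc)
    qed
  qed
  have conv: "(\<lambda>n. s n x) \<longlonglongrightarrow> f x" if "x > 0" for x
  proof -
    have "(\<lambda>n. f x - s n x) \<longlonglongrightarrow> 0"
    proof (rule Lim_null_comparison[OF _ LIMSEQ_inverse_real_of_nat])
      show "eventually (\<lambda>n. norm (f x - s n x) \<le> inverse (real (Suc n))) sequentially"
        using inK[OF that] by eventually_elim (rule order_trans[OF s_close e_le])
    qed
    from tendsto_diff[OF tendsto_const[of "f x"] this] show "(\<lambda>n. s n x) \<longlonglongrightarrow> f x" by simp
  qed
  have AEc: "AE x in M. (\<lambda>n. s n x) \<longlonglongrightarrow> f x" using AE_space by eventually_elim (use conv sp in auto)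
  have L1: "(\<lambda>n. \<integral>\<^sup>+x. ennreal (norm (f x - s n x)) \<partial>M) \<longlonglongrightarrow> 0"
  proof -
    have h_out: "(\<lambda>x. h x * indicator (- K n) x) \<in> borel_measurable M" for n
    proof -
      have "(\<lambda>x. h x * indicator (space M - K n) x) \<in> borel_measurable M" using h(1) K_sets by measurable
      also have "?this \<longleftrightarrow> (\<lambda>x. h x * indicator (- K n) x) \<in> borel_measurable M"
        by (rule measurable_cong) (auto split: split_indicator)
      finally show ?thesis .
    qed
    have le: "(\<integral>\<^sup>+x. ennreal (norm (f x - s n x)) \<partial>M)
        \<le> (\<integral>\<^sup>+x. h x * indicator (- K n) x \<partial>M) + ennreal (inverse (real (Suc n)))" for n
    proof -
      have "(\<integral>\<^sup>+x. ennreal (norm (f x - s n x)) \<partial>M) \<le> (\<integral>\<^sup>+x. h x * indicator (- K n) x + ennreal (e n) * indicator (K n) x \<partial>M)"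
        by (rule nn_integral_mono) (use s_close s_out h(2) sp in \<open>auto split: split_indicator intro: ennreal_leI\<close>)
      also have "\<dots> = (\<integral>\<^sup>+x. h x * indicator (- K n) x \<partial>M) + (\<integral>\<^sup>+x. ennreal (e n) * indicator (K n) x \<partial>M)"
        by (rule nn_integral_add[OF h_out]) (use K_sets in measurable)
      also have "(\<integral>\<^sup>+x. ennreal (e n) * indicator (K n) x \<partial>M) = ennreal (e n) * emeasure M (K n)"
        using K_sets by (rule nn_integral_cmult_indicator)
      also have "\<dots> = ennreal (e n * measure M (K n))"
        using K_fin[of n] e_pos[of n] by (simp add: emeasure_eq_ennreal_measure ennreal_mult less_top)
      also have "e n * measure M (K n) \<le> inverse (real (Suc n))"
      proof -
        have "e n * measure M (K n) \<le> e n * (1 + measure M (K n))"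
          using e_pos[of n] by (intro mult_left_mono) auto
        also have "\<dots> = inverse (real (Suc n))" using pos[of n] by (simp add: e_def inverse_eq_divide del: of_nat_Suc)
        finally show ?thesis .
      qed
      finally show ?thesis by (simp add: add_left_mono ennreal_leI)
    qed
    have "(\<lambda>n. \<integral>\<^sup>+x. h x * indicator (- K n) x \<partial>M) \<longlonglongrightarrow> (\<integral>\<^sup>+x. 0 \<partial>M)"
    proof (rule nn_integral_dominated_convergence[where w = h])
      show "(\<lambda>x. h x * indicator (- K n) x) \<in> borel_measurable M" for n by (rule h_out)
      show "AE x in M. (\<lambda>n. h x * indicator (- K n) x) \<longlonglongrightarrow> 0"
        using AE_space
      proof eventually_elim
        case (elim x)
        then have "x > 0" by (simp add: sp)
        from inK[OF this] have "eventually (\<lambda>n. h x * indicator (- K n) x = 0) sequentially"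
          by eventually_elim simp
        then show ?case by (rule tendsto_eventually)
      qed
    qed (use h in \<open>auto split: split_indicator\<close>)
    moreover have "(\<lambda>n. ennreal (inverse (real (Suc n)))) \<longlonglongrightarrow> ennreal 0"
      by (intro tendsto_ennrealI LIMSEQ_inverse_real_of_nat)
    ultimately have "(\<lambda>n. (\<integral>\<^sup>+x. h x * indicator (- K n) x \<partial>M) + ennreal (inverse (real (Suc n)))) \<longlonglongrightarrow> (\<integral>\<^sup>+x. 0 \<partial>M) + ennreal 0"
      by (rule tendsto_add)
    then have z: "(\<lambda>n. (\<integral>\<^sup>+x. h x * indicator (- K n) x \<partial>M) + ennreal (inverse (real (Suc n)))) \<longlonglongrightarrow> 0"
      by simp
    show ?thesis by (rule tendsto_sandwich[OF _ _ tendsto_const z]) (use le in auto)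
  qed
  let ?I = "\<lambda>n. sb_integral M (s n)"
  have dist_le: "ennreal (norm (?I m - ?I n))
      \<le> (\<integral>\<^sup>+x. ennreal (norm (f x - s m x)) \<partial>M) + (\<integral>\<^sup>+x. ennreal (norm (f x - s n x)) \<partial>M)" for m n
  proof -
    obtain u where u: "u \<in> borel_measurable M" "AE x in M. ennreal (norm (f x - s m x)) = u x"
      using norm_diff_AE_measurable[OF sbi AEc sbi] by blast
    obtain v where v: "v \<in> borel_measurable M" "AE x in M. ennreal (norm (f x - s n x)) = v x"
      using norm_diff_AE_measurable[OF sbi AEc sbi] by blast
    have "ennreal (norm (?I m - ?I n)) \<le> (\<integral>\<^sup>+x. ennreal (norm (s m x - s n x)) \<partial>M)"
      by (rule simple_bochner_norm_diff(2)[OF sbi sbi])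
    also have "\<dots> \<le> (\<integral>\<^sup>+x. u x + v x \<partial>M)"
    proof (rule nn_integral_mono_AE)
      show "AE x in M. ennreal (norm (s m x - s n x)) \<le> u x + v x"
        using u(2) v(2)
      proof eventually_elim
        case (elim x)
        have "norm (s m x - s n x) \<le> norm (f x - s m x) + norm (f x - s n x)"
          using norm_triangle_ineq4[of "f x - s n x" "f x - s m x"] by (simp add: algebra_simps)
        then show ?case unfolding elim[symmetric]
          by (metis ennreal_leI ennreal_plus norm_ge_zero)
      qed
    qed
    also have "\<dots> = (\<integral>\<^sup>+x. u x \<partial>M) + (\<integral>\<^sup>+x. v x \<partial>M)" by (rule nn_integral_add) fact+
    finally show ?thesis using nn_integral_cong_AE[OF u(2)] nn_integral_cong_AE[OF v(2)] by simp
  qed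
  have "Cauchy ?I"
  proof (rule CauchyI)
    fix \<epsilon> :: real assume "\<epsilon> > 0"
    then have "eventually (\<lambda>n. (\<integral>\<^sup>+x. ennreal (norm (f x - s n x)) \<partial>M) < ennreal (\<epsilon> / 2)) sequentially"
      by (intro order_tendstoD[OF L1]) simp
    then obtain N where N: "\<And>n. n \<ge> N \<Longrightarrow> (\<integral>\<^sup>+x. ennreal (norm (f x - s n x)) \<partial>M) < ennreal (\<epsilon> / 2)"
      unfolding eventually_sequentially by blast
    have "norm (?I m - ?I n) < \<epsilon>" if "m \<ge> N" "n \<ge> N" for m n
    proof -
      have "ennreal (norm (?I m - ?I n)) < ennreal (\<epsilon> / 2) + ennreal (\<epsilon> / 2)"
        by (rule le_less_trans[OF dist_le add_strict_mono[OF N N]]) fact+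
      also have "\<dots> = ennreal \<epsilon>" using \<open>\<epsilon> > 0\<close> by (subst ennreal_plus[symmetric]) auto
      finally show ?thesis by (simp add: ennreal_less_iff)
    qed
    then show "\<exists>N. \<forall>m\<ge>N. \<forall>n\<ge>N. norm (?I m - ?I n) < \<epsilon>" by blast
  qed
  then obtain y where "?I \<longlonglongrightarrow> y" using convergent_eq_Cauchy by blast
  then have "has_bochner M f y"
    unfolding has_bochner_def using sbi AEc L1 by blast
  then show ?thesis ..
qed

section \<open>Stieltjes functions and complete Bernstein functions\<close>

text \<open>
  The function \<open>1 + \<Sum>\<^sub>j c\<^sub>j / (j - x)\<close> runs from \<open>-\<infinity>\<close> to \<open>+\<infinity>\<close> between two consecutive poles and from
  \<open>-\<infinity>\<close> to \<open>1\<close> to the right of the last one, hence vanishes there. Choosing one root to the right of each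
  pole gives as many distinct roots as there are poles.
\<close>

lemma interlacing_root:
  fixes c :: "real \<Rightarrow> real"
  assumes K: "finite K" and c: "\<And>j. j \<in> K \<Longrightarrow> 0 < c j" and k: "k \<in> K"
  shows "\<exists>r>k. (\<forall>j\<in>K. k < j \<longrightarrow> r < j) \<and> 1 + (\<Sum>j\<in>K. c j / (j - r)) = 0"
proof (cases "\<exists>j\<in>K. k < j")
  case False
  \<comment> \<open>At distance \<open>C\<close> to the right of the last pole the sum exceeds \<open>-1\<close>.\<close>
  define C where "C = (\<Sum>j\<in>K. c j) + 1"
  have sum_nn: "0 \<le> (\<Sum>j\<in>K. c j)" using c by (intro sum_nonneg) (auto intro: less_imp_le)
  then have C: "C > 0" by (simp add: C_def)
  \<comment> \<open>Multiplication by \<open>k - x\<close> removes the pole at \<open>k\<close>.\<close>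
  let ?p = "\<lambda>x. (k - x) * (1 + (\<Sum>j\<in>K - {k}. c j / (j - x))) + c k"
  have p_eq: "?p x = (k - x) * (1 + (\<Sum>j\<in>K. c j / (j - x)))" if "x > k" for x
    using K k that by (subst sum.remove[of K k]) (auto simp: field_simps)
  have ne: "j < x" if "j \<in> K - {k}" "k \<le> x" for j x using that False by force
  have cont: "continuous_on {k..k + C} ?p"
  proof (intro continuous_intros ballI)
    fix j x assume "j \<in> K - {k}" "x \<in> {k..k + C}"
    then show "j - x \<noteq> 0" using ne[of j x] by simp
  qed
  have "- 1 < (\<Sum>j\<in>K. c j / (j - (k + C)))"
  proof -
    have "- 1 < (\<Sum>j\<in>K. - c j / C)"
      using C by (simp add: sum_negf sum_divide_distrib[symmetric] field_simps) (simp add: C_def)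
    also have "\<dots> \<le> (\<Sum>j\<in>K. c j / (j - (k + C)))"
    proof (rule sum_mono)
      fix j assume j: "j \<in> K"
      then have "C \<le> k + C - j" using False by force
      then have "c j / (k + C - j) \<le> c j / C" using C c[OF j] by (intro divide_left_mono) auto
      moreover have "c j / (j - (k + C)) = - (c j / (k + C - j))"
        by (metis minus_diff_eq minus_divide_right)
      ultimately show "- c j / C \<le> c j / (j - (k + C))" by simp
    qed
    finally show ?thesis .
  qed
  then have "?p (k + C) < 0" using C p_eq[of "k + C"] by (simp add: mult_less_0_iff)
  then obtain x where x: "k \<le> x" "x \<le> k + C" "?p x = 0"
    using IVT2'[of ?p "k + C" 0 k] C c[OF k] cont by auto
  have "x \<noteq> k" using x(3) c[OF k] by auto
  with x have "k < x" by simp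
  with x p_eq[of x] show ?thesis using False by (intro exI[of _ x]) auto
next
  case True
  define m where "m = Min {j \<in> K. k < j}"
  have "m \<in> {j \<in> K. k < j}" unfolding m_def by (rule Min_in) (use K True in auto)
  then have m: "m \<in> K" "k < m" by auto
  have m_le: "m \<le> j" if "j \<in> K" "k < j" for j unfolding m_def using that K by (intro Min_le) auto
  \<comment> \<open>The next pole is \<open>m\<close>; the factor \<open>(k - x) (m - x)\<close> removes both poles.\<close>
  let ?p = "\<lambda>x. (k - x) * (m - x) * (1 + (\<Sum>j\<in>K - {k} - {m}. c j / (j - x))) + c k * (m - x) + c m * (k - x)"
  have p_eq: "?p x = (k - x) * (m - x) * (1 + (\<Sum>j\<in>K. c j / (j - x)))" if "x > k" "x < m" for x
  proof -
    have "(\<Sum>j\<in>K. c j / (j - x)) = c k / (k - x) + (c m / (m - x) + (\<Sum>j\<in>K - {k} - {m}. c j / (j - x)))"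
      using K k m by (subst sum.remove[of K k], simp, simp, subst sum.remove[of _ m]) auto
    moreover have "u * v * (1 + q) + a * v + b * u = u * v * (1 + (a / u + (b / v + q)))"
      if "u \<noteq> 0" "v \<noteq> 0" for u v a b q :: real using that by (simp add: field_simps)
    ultimately show ?thesis using that by simp
  qed
  have ne: "j \<noteq> x" if "j \<in> K - {k} - {m}" "k \<le> x" "x \<le> m" for j x
    using that m_le[of j] by force
  have cont: "continuous_on {k..m} ?p"
  proof (intro continuous_intros ballI)
    fix j x assume "j \<in> K - {k} - {m}" "x \<in> {k..m}"
    then show "j - x \<noteq> 0" using ne[of j x] by simp
  qed
  have "?p k > 0" "?p m < 0" using c[OF k] c[OF m(1)] m by (auto simp: mult_less_0_iff)
  then obtain x where x: "k \<le> x" "x \<le> m" "?p x = 0"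
    using IVT2'[of ?p m 0 k] m cont by (auto simp del: mult_eq_0_iff)
  have "x \<noteq> k" "x \<noteq> m" using x(3) \<open>?p k > 0\<close> \<open>?p m < 0\<close> by (metis less_irrefl)+
  with x have "k < x" "x < m" by auto
  with x p_eq[of x] m_le show ?thesis by (intro exI[of _ x]) force
qed

text \<open>
  Let \<open>S = P/Q\<close> with the product \<open>Q\<close> of the factors \<open>k + x\<close>. Then \<open>S / (1 + S) = P / (P + Q)\<close>, and the
  roots of the monic polynomial \<open>P + Q\<close> are the numbers \<open>- r\<^sub>k\<close> with \<open>r\<^sub>k\<close> from the preceding lemma.
  At such a root \<open>S = -1\<close>, so the residue is \<open>-1 / S'(-r\<^sub>k) = 1 / \<Sum>\<^sub>j c\<^sub>j / (j - r\<^sub>k)\<^sup>2\<close>, which is positive.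
  All polynomial identities are checked by comparing values at sufficiently many points.
\<close>

lemma Stieltjes_sum_partial_fractions:
  fixes c :: "real \<Rightarrow> real"
  assumes K: "finite K" "K \<subseteq> {0<..}" and c: "\<And>k. k \<in> K \<Longrightarrow> 0 < c k"
  obtains r d where "\<And>k. k \<in> K \<Longrightarrow> 0 < r k" "\<And>k. k \<in> K \<Longrightarrow> 0 \<le> d k"
    "\<And>x. 0 < x \<Longrightarrow> (\<Sum>k\<in>K. c k / (k + x)) / (1 + (\<Sum>k\<in>K. c k / (k + x))) = (\<Sum>k\<in>K. d k / (r k + x))"
proof -
  have "\<forall>k\<in>K. \<exists>r>k. (\<forall>j\<in>K. k < j \<longrightarrow> r < j) \<and> 1 + (\<Sum>j\<in>K. c j / (j - r)) = 0"
    using interlacing_root[of K c] K(1) c by blast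
  then obtain r where r: "\<And>k. k \<in> K \<Longrightarrow> k < r k" "\<And>k j. k \<in> K \<Longrightarrow> j \<in> K \<Longrightarrow> k < j \<Longrightarrow> r k < j"
    "\<And>k. k \<in> K \<Longrightarrow> 1 + (\<Sum>j\<in>K. c j / (j - r k)) = 0" by metis
  have r_pos: "0 < r k" if "k \<in> K" for k using r(1)[OF that] K(2) that by force
  have r_less: "r k < r j" if "k \<in> K" "j \<in> K" "k < j" for k j
    using r(2)[OF that] r(1)[OF that(2)] by simp
  have inj: "inj_on r K" by (rule inj_onI) (metis r_less linorder_neq_iff)
  have r_notin: "j \<noteq> r k" if "k \<in> K" "j \<in> K" for k j
    using r(1)[of k] r(2)[of k j] that by force
  define S where "S x = (\<Sum>k\<in>K. c k / (k + x))" for x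
  define Q where "Q = (\<Prod>k\<in>K. [:k, 1:])"
  define P where "P = (\<Sum>k\<in>K. smult (c k) (\<Prod>j\<in>K - {k}. [:j, 1:]))"
  define D where "D = (\<Prod>k\<in>K. [:r k, 1:])"
  define d where "d k = 1 / (\<Sum>j\<in>K. c j / (j - r k)\<^sup>2)" for k
  define N where "N = (\<Sum>k\<in>K. smult (d k) (\<Prod>l\<in>K - {k}. [:r l, 1:]))"
  have rem: "(\<Prod>k\<in>K - {j}. g k) = (\<Prod>k\<in>K. g k) / g j" if "j \<in> K" "g j \<noteq> (0::real)" for g and j :: real
    using that K(1) by (subst prod.remove[OF K(1) that(1)]) simp
  have QS: "poly P x = poly Q x * S x" if "\<And>k. k \<in> K \<Longrightarrow> k + x \<noteq> 0" for x
    unfolding P_def Q_def S_def poly_sum poly_smult poly_prod sum_distrib_left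
    by (rule sum.cong) (use that rem[of _ "\<lambda>k. k + x"] in auto)
  have S_root: "1 + S (- r k) = 0" if "k \<in> K" for k using r(3)[OF that] by (simp add: S_def)
  have deg_rem: "degree (\<Prod>k\<in>K - {j}. [:g k, 1:]) < card K" if "j \<in> K" for g :: "real \<Rightarrow> real" and j
  proof -
    have "degree (\<Prod>k\<in>K - {j}. [:g k, 1:]) \<le> card (K - {j})"
      using degree_prod_sum_le[of "K - {j}" "\<lambda>k. [:g k, 1:]"] K(1) by simp
    also have "\<dots> < card K" using that K(1) by (meson card_Diff1_less)
    finally show ?thesis .
  qed
  have deg_full: "degree (\<Prod>k\<in>K. [:g k, 1:]) = card K" "coeff (\<Prod>k\<in>K. [:g k, 1:]) (card K) = 1"
    for g :: "real \<Rightarrow> real"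
  proof -
    show d: "degree (\<Prod>k\<in>K. [:g k, 1:]) = card K"
      using degree_prod_sum_eq[of K "\<lambda>k. [:g k, 1:]"] by simp
    show "coeff (\<Prod>k\<in>K. [:g k, 1:]) (card K) = 1"
      using lead_coeff_prod[of "\<lambda>k. [:g k, 1:]" K] d by simp
  qed
  have degsum: "degree (\<Sum>k\<in>K. smult (e k) (\<Prod>j\<in>K - {k}. [:g j, 1:])) < card K" if "K \<noteq> {}" for e g :: "real \<Rightarrow> real"
    by (rule degree_sum_less) (use deg_rem[of _ g] that K(1) in \<open>auto intro: le_less_trans[OF degree_smult_le]\<close>)
  show ?thesis
  proof (cases "K = {}")
    case True
    then show ?thesis using that[of "\<lambda>_. 1" "\<lambda>_. 1"] by simp
  next
    case False
    have degP: "degree P < card K" unfolding P_def by (rule degsum[OF False])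
    have degN: "degree N < card K" unfolding N_def by (rule degsum[OF False])
    let ?A = "(\<lambda>k. - r k) ` K"
    have cardA: "card ?A = card K" using inj by (intro card_image) (auto simp: inj_on_def)
    have D_root: "poly D (- r k) = 0" if "k \<in> K" for k
      using that K(1) by (auto simp: D_def poly_prod intro: bexI)
    have PQ: "P + Q = D"
    proof (rule poly_eqI_degree_lead_coeff[of _ "card K" _ ?A])
      show "coeff (P + Q) (card K) = coeff D (card K)"
        using degP deg_full(2) by (simp add: Q_def D_def coeff_eq_0)
      show "degree (P + Q) \<le> card K" using degP deg_full(1) by (auto simp: Q_def intro!: degree_add_le)
      show "degree D \<le> card K" using deg_full(1) by (simp add: D_def)
      show "card K \<le> card ?A" using cardA by simp
      fix z assume "z \<in> ?A"
      then obtain k where k: "k \<in> K" "z = - r k" by auto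
      have "poly P z = poly Q z * S z" by (rule QS) (use r_notin k in force)
      then have "poly (P + Q) z = poly Q z * (1 + S (- r k))" by (simp add: k algebra_simps)
      then show "poly (P + Q) z = poly D z" using S_root[OF k(1)] D_root[OF k(1)] k by simp
    qed
    have sq_pos: "0 < (\<Sum>j\<in>K. c j / (j - r k)\<^sup>2)" if "k \<in> K" for k
      by (rule sum_pos) (use c r_notin that False K(1) in auto)
    have tangent: "poly (\<Prod>l\<in>K - {k}. [:r l, 1:]) (- r k) = - poly Q (- r k) * (\<Sum>j\<in>K. c j / (j - r k)\<^sup>2)"
      if k: "k \<in> K" for k
    proof -
      \<comment> \<open>\<open>W\<close> is the difference quotient of \<open>Q (1 + S)\<close> at its root \<open>- r k\<close>.\<close>
      define W where "W = (\<Sum>j\<in>K. smult (- c j / (j - r k)) (\<Prod>i\<in>K - {j}. [:i, 1:]))"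
      have W: "poly W x = - poly Q x * (\<Sum>j\<in>K. c j / ((j - r k) * (j + x)))" if "\<And>j. j \<in> K \<Longrightarrow> j + x \<noteq> 0" for x
        unfolding W_def Q_def poly_sum poly_smult poly_prod sum_distrib_left
        by (rule sum.cong) (use that in \<open>simp_all add: rem[of _ "\<lambda>k. k + x"]\<close>)
      have "[:r k, 1:] * W = D"
      proof (rule poly_eqI_degree[of "real ` {1..degree ([:r k, 1:] * W) + degree D + 1}"])
        show "degree ([:r k, 1:] * W) < card (real ` {1..degree ([:r k, 1:] * W) + degree D + 1})"
          "degree D < card (real ` {1..degree ([:r k, 1:] * W) + degree D + 1})"
          by (simp_all add: card_image)
        fix x assume "x \<in> real ` {1..degree ([:r k, 1:] * W) + degree D + 1}"
        then have x: "x > 0" by auto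
        then have nz: "j + x \<noteq> 0" if "j \<in> K" for j using K(2) that by force
        have "poly ([:r k, 1:] * W) x = poly Q x * (- (\<Sum>j\<in>K. (r k + x) * (c j / ((j - r k) * (j + x)))))"
          unfolding sum_distrib_left[symmetric] by (simp add: W[OF nz] algebra_simps del: times_divide_eq_right)
        also have "(\<Sum>j\<in>K. (r k + x) * (c j / ((j - r k) * (j + x)))) = (\<Sum>j\<in>K. c j / (j - r k) - c j / (j + x))"
        proof (rule sum.cong[OF refl])
          fix j assume j: "j \<in> K"
          have "j - r k \<noteq> 0" "j + x \<noteq> 0" using r_notin[OF k j] nz[OF j] by auto
          then show "(r k + x) * (c j / ((j - r k) * (j + x))) = c j / (j - r k) - c j / (j + x)"
            by (simp add: field_simps)
        qed
        also have "\<dots> = - 1 - S x" using r(3)[OF k] by (simp add: sum_subtractf S_def)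
        also have "poly Q x * - (- 1 - S x) = poly (P + Q) x" by (simp add: QS[OF nz] algebra_simps)
        finally show "poly ([:r k, 1:] * W) x = poly D x" by (simp add: PQ)
      qed
      moreover have "D = [:r k, 1:] * (\<Prod>l\<in>K - {k}. [:r l, 1:])"
        unfolding D_def using K(1) k by (simp add: prod.remove)
      ultimately have "W = (\<Prod>l\<in>K - {k}. [:r l, 1:])" by (metis mult_left_cancel one_neq_zero pCons_eq_0_iff)
      then show ?thesis using W[of "- r k"] r_notin[OF k] by (simp add: power2_eq_square)
    qed
    have PN: "P = N"
    proof (rule poly_eqI_degree[of ?A])
      show "degree P < card ?A" "degree N < card ?A" using degP degN cardA by auto
      fix z assume "z \<in> ?A"
      then obtain k where k: "k \<in> K" "z = - r k" by auto
      have "poly P z = poly Q z * S z" by (rule QS) (use r_notin k in force)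
      also have "S z = - 1" using S_root[OF k(1)] unfolding k(2) by linarith
      also have "poly Q z * - 1 = - poly Q z" by simp
      also have "\<dots> = d k * poly (\<Prod>l\<in>K - {k}. [:r l, 1:]) z"
        using tangent[OF k(1)] sq_pos[OF k(1)] k by (simp add: d_def)
      also have "\<dots> = poly N z"
      proof -
        have "poly N z = (\<Sum>i\<in>K. if i = k then d k * poly (\<Prod>l\<in>K - {k}. [:r l, 1:]) z else 0)"
          unfolding N_def poly_sum poly_smult
          by (rule sum.cong) (use k K(1) in \<open>auto simp: poly_prod intro: bexI\<close>)
        then show ?thesis using k K(1) by simp
      qed
      finally show "poly P z = poly N z" .
    qed
    show ?thesis
    proof (rule that[of r d])
      show "0 < r k" if "k \<in> K" for k by (rule r_pos[OF that])
      show "0 \<le> d k" if "k \<in> K" for k using sq_pos[OF that] by (simp add: d_def)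
      fix x :: real assume x: "0 < x"
      then have nz: "j + x \<noteq> 0" if "j \<in> K" for j using K(2) that by force
      have rz: "r k + x \<noteq> 0" if "k \<in> K" for k using r_pos[OF that] x by simp
      have Qx: "poly Q x \<noteq> 0" unfolding Q_def poly_prod using K(1) nz by simp
      have Dx: "poly D x \<noteq> 0" unfolding D_def poly_prod using K(1) rz by simp
      have "poly D x = poly Q x * (1 + S x)" unfolding PQ[symmetric] by (simp add: QS[OF nz] algebra_simps)
      then have "S x / (1 + S x) = poly P x / poly D x" using Qx by (simp add: QS[OF nz])
      also have "\<dots> = (\<Sum>k\<in>K. d k / (r k + x))"
        unfolding PN N_def D_def poly_sum poly_smult poly_prod sum_divide_distrib
        by (rule sum.cong) (use rem[of _ "\<lambda>k. r k + x"] rz K(1) in auto)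
      finally show "(\<Sum>k\<in>K. c k / (k + x)) / (1 + (\<Sum>k\<in>K. c k / (k + x))) = (\<Sum>k\<in>K. d k / (r k + x))"
        unfolding S_def .
    qed
  qed
qed

text \<open>
  Under \<open>u = 1 / (1 + s)\<close> the normalised Stieltjes kernel \<open>(1 + s) / (s + x)\<close> becomes
  \<open>1 / (1 + (x - 1) u)\<close> with \<open>u\<close> in \<open>[0, 1]\<close>. The end points \<open>0\<close> and \<open>1\<close> stand for \<open>s = \<infinity>\<close> and
  \<open>s = 0\<close>, so that passing to limits loses no mass. Clamping extends the kernel to a bounded
  continuous function on the line, which makes weak convergence applicable as it stands.
\<close>

definition unit_kernel :: "real \<Rightarrow> real \<Rightarrow> real"
  where "unit_kernel x u = 1 / (1 + (x - 1) * max 0 (min 1 u))"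

lemma unit_kernel_bounds:
  assumes "0 < x"
  shows "0 < unit_kernel x u" and "unit_kernel x u \<le> max 1 (1 / x)" and "isCont (unit_kernel x) u"
proof -
  let ?v = "max 0 (min 1 u)"
  have v: "0 \<le> ?v" "?v \<le> 1" by auto
  have eq: "1 + (x - 1) * ?v = (1 - ?v) * 1 + ?v * x" by (simp add: algebra_simps)
  have ge: "min 1 x \<le> 1 + (x - 1) * ?v"
    unfolding eq using v convex_bound_le[of "- 1" "- min 1 x" "- x" "1 - ?v" ?v] by simp
  have mp: "0 < min 1 x" using assms by simp
  then have pos: "0 < 1 + (x - 1) * ?v" using ge by linarith
  then show "0 < unit_kernel x u" by (simp add: unit_kernel_def)
  have "unit_kernel x u \<le> 1 / min 1 x"
    unfolding unit_kernel_def using ge mp by (intro divide_left_mono) (auto intro!: mult_pos_pos pos)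
  also have "\<dots> = max 1 (1 / x)" using assms by (auto simp: min_def max_def field_simps)
  finally show "unit_kernel x u \<le> max 1 (1 / x)" .
  show "isCont (unit_kernel x) u"
    unfolding unit_kernel_def using pos by (intro continuous_intros) auto
qed

lemma unit_kernel_measurable [measurable]:
  assumes "0 < x" shows "unit_kernel x \<in> borel_measurable borel"
  using unit_kernel_bounds(3)[OF assms] by (intro borel_measurable_continuous_onI) (auto simp: continuous_at_imp_continuous_on)

text \<open>
  The measure is the sum of the point masses \<open>d\<^sub>k / (r\<^sub>k + 1)\<close> at \<open>1 / (1 + r\<^sub>k)\<close> from the partial fraction
  decomposition, divided by its total mass, which is the value at \<open>x = 1\<close>. If that value is \<open>0\<close>,
  then both sides vanish and any distribution will do.
\<close>

lemma Stieltjes_sum_distribution: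
  fixes c :: "real \<Rightarrow> real"
  assumes K: "finite K" "K \<subseteq> {0<..}" and c: "\<And>k. k \<in> K \<Longrightarrow> 0 \<le> c k"
  defines "S \<equiv> \<lambda>x. \<Sum>k\<in>K. c k / (k + x)"
  shows "\<exists>N. real_distribution N \<and> measure N {-1<..1} = 1 \<and>
    (\<forall>x>0. S x / (1 + S x) = S 1 / (1 + S 1) * (\<integral>u. unit_kernel x u \<partial>N))"
proof -
  define K' where "K' = {k \<in> K. 0 < c k}"
  have K': "finite K'" "K' \<subseteq> {0<..}" "\<And>k. k \<in> K' \<Longrightarrow> 0 < c k" using K by (auto simp: K'_def)
  have S_K': "S x = (\<Sum>k\<in>K'. c k / (k + x))" for x
    unfolding S_def K'_def by (rule sum.mono_neutral_right) (use K c in \<open>auto simp: not_less intro: antisym\<close>)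
  obtain r d where r: "\<And>k. k \<in> K' \<Longrightarrow> 0 < r k" and d: "\<And>k. k \<in> K' \<Longrightarrow> 0 \<le> d k"
    and eq: "\<And>x. 0 < x \<Longrightarrow> (\<Sum>k\<in>K'. c k / (k + x)) / (1 + (\<Sum>k\<in>K'. c k / (k + x))) = (\<Sum>k\<in>K'. d k / (r k + x))"
    using Stieltjes_sum_partial_fractions[of K' c, OF K'] by blast
  define w where "w = (\<Sum>k\<in>K'. d k / (r k + 1))"
  have w: "w = S 1 / (1 + S 1)" using eq[of 1] by (simp add: w_def S_K')
  have dr_nn: "0 \<le> d k / (r k + 1)" if "k \<in> K'" for k using r[OF that] d[OF that] by simp
  have w_nn: "0 \<le> w" unfolding w_def by (rule sum_nonneg) (rule dr_nn)
  show ?thesis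
  proof (cases "w = 0")
    case True
    have "d k = 0" if "k \<in> K'" for k
    proof -
      have "\<forall>k\<in>K'. d k / (r k + 1) = 0"
        using True unfolding w_def by (subst sum_nonneg_eq_0_iff[symmetric]) (use K' dr_nn in auto)
      then show ?thesis using that r[OF that] by (auto simp: add_pos_pos less_imp_neq)
    qed
    then have "S x / (1 + S x) = 0" if "x > 0" for x using eq[OF that] by (simp add: S_K')
    then have "\<forall>x>0. S x / (1 + S x) = S 1 / (1 + S 1) * (\<integral>u. unit_kernel x u \<partial>return borel 0)"
      using True unfolding w by (metis mult_zero_left)
    moreover have "real_distribution (return borel (0::real))"
      by (auto simp: real_distribution_def real_distribution_axioms_def intro: prob_space_return)
    moreover have "measure (return borel (0::real)) {-1<..1} = 1" by (simp add: measure_return)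
    ultimately show ?thesis by (intro exI[of _ "return borel 0"] conjI)
  next
    case False
    define p where "p k = d k / (r k + 1) / w" for k
    define u where "u k = 1 / (1 + r k)" for k
    define N where "N = distr (point_measure K' p) borel u"
    have p_nn: "0 \<le> p k" if "k \<in> K'" for k unfolding p_def using r[OF that] d[OF that] w_nn by simp
    have p_sum: "(\<Sum>k\<in>K'. p k) = 1" unfolding p_def sum_divide_distrib[symmetric] w_def[symmetric] using False by simp
    have u_meas: "u \<in> measurable (point_measure K' p) borel" by (simp add: point_measure_def)
    have prob: "prob_space (point_measure K' p)"
      by (rule prob_spaceI) (use K' p_nn p_sum in \<open>simp add: space_point_measure emeasure_point_measure_finite\<close>)
    have rd: "real_distribution N"
      unfolding real_distribution_def real_distribution_axioms_def N_def
      using prob_space.prob_space_distr[OF prob u_meas] by simp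
    have "measure N {-1<..1} = measure (point_measure K' p) K'"
    proof -
      have "u -` {-1<..1} \<inter> K' = K'" using r by (auto simp: u_def field_simps add_pos_pos less_imp_le intro: less_le_trans)
      then show ?thesis unfolding N_def by (subst measure_distr[OF u_meas]) (auto simp: space_point_measure)
    qed
    also have "\<dots> = 1" using prob_space.prob_space[OF prob] by (simp add: space_point_measure)
    finally have supp: "measure N {-1<..1} = 1" .
    have "S x / (1 + S x) = S 1 / (1 + S 1) * (\<integral>u. unit_kernel x u \<partial>N)" if x: "x > 0" for x
    proof -
      have "(\<integral>u. unit_kernel x u \<partial>N) = (\<Sum>k\<in>K'. p k * unit_kernel x (u k))"
        unfolding N_def using unit_kernel_measurable[OF x] u_meas K' p_nn
        by (simp add: integral_distr lebesgue_integral_point_measure_finite)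
      also have "\<dots> = (\<Sum>k\<in>K'. d k / (r k + x) / w)"
      proof (rule sum.cong[OF refl])
        fix k assume k: "k \<in> K'"
        have pos: "r k > 0" by (rule r[OF k])
        then have cl: "max 0 (min 1 (u k)) = 1 / (1 + r k)" by (simp add: u_def)
        have "unit_kernel x (u k) = (r k + 1) / (r k + x)"
          unfolding unit_kernel_def cl using pos x by (simp add: divide_simps add_pos_pos)
        then show "p k * unit_kernel x (u k) = d k / (r k + x) / w"
          using pos by (simp add: p_def)
      qed
      also have "\<dots> = (\<Sum>k\<in>K'. d k / (r k + x)) / w" by (rule sum_divide_distrib[symmetric])
      finally have "w * (\<integral>u. unit_kernel x u \<partial>N) = (\<Sum>k\<in>K'. d k / (r k + x))" using False by simp
      then show ?thesis using eq[OF x] by (simp only: S_K'[symmetric] w[symmetric])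
    qed
    then show ?thesis using rd supp by blast
  qed
qed

text \<open>
  All distributions live on one bounded interval, hence form a tight family, and Helly's theorem
  provides a weak limit along a subsequence.
\<close>

lemma unit_kernel_representation_limit:
  fixes h :: "real \<Rightarrow> real" and g :: "nat \<Rightarrow> real \<Rightarrow> real"
  assumes N: "\<And>n. real_distribution (N n)" "\<And>n. measure (N n) {-1<..1} = 1"
    and g: "\<And>n x. 0 < x \<Longrightarrow> g n x = g n 1 * (\<integral>u. unit_kernel x u \<partial>N n)"
    and lim: "\<And>x. 0 < x \<Longrightarrow> (\<lambda>n. g n x) \<longlonglongrightarrow> h x"
  shows "\<exists>M. real_distribution M \<and> (\<forall>x>0. h x = h 1 * (\<integral>u. unit_kernel x u \<partial>M))"
proof -
  have "tight N" unfolding tight_def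
  proof (intro conjI allI impI)
    fix \<epsilon> :: real assume "0 < \<epsilon>"
    then show "\<exists>a b. a < b \<and> (\<forall>n. 1 - \<epsilon> < measure (N n) {a<..b})"
      using N(2) by (intro exI[of _ "- 1"] exI[of _ 1]) simp
  qed (rule N(1))
  then obtain q M where q: "strict_mono (q :: nat \<Rightarrow> nat)" and M: "real_distribution M"
    and wc: "weak_conv_m (N \<circ> id \<circ> q) M"
    using tight_imp_convergent_subsubsequence[of N id] by (auto simp: strict_mono_def)
  have "h x = h 1 * (\<integral>u. unit_kernel x u \<partial>M)" if x: "x > 0" for x
  proof (rule LIMSEQ_unique)
    show "(\<lambda>n. g (q n) x) \<longlonglongrightarrow> h x" using LIMSEQ_subseq_LIMSEQ[OF lim[OF x] q] by (simp add: o_def)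
    have "(\<lambda>n. integral\<^sup>L ((N \<circ> id \<circ> q) n) (unit_kernel x)) \<longlonglongrightarrow> integral\<^sup>L M (unit_kernel x)"
    proof (rule weak_conv_imp_integral_bdd_continuous_conv[OF _ M wc])
      show "real_distribution ((N \<circ> id \<circ> q) n)" for n using N(1) by simp
      show "isCont (unit_kernel x) u" for u by (rule unit_kernel_bounds(3)[OF x])
      show "norm (unit_kernel x u) \<le> max 1 (1 / x)" for u using unit_kernel_bounds(1,2)[OF x, of u] by simp
    qed
    moreover have "(\<lambda>n. g (q n) 1) \<longlonglongrightarrow> h 1"
      using LIMSEQ_subseq_LIMSEQ[OF lim[of 1] q] by (simp add: o_def)
    ultimately have "(\<lambda>n. g (q n) 1 * integral\<^sup>L (N (q n)) (unit_kernel x)) \<longlonglongrightarrow> h 1 * integral\<^sup>L M (unit_kernel x)"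
      by (intro tendsto_mult) auto
    then show "(\<lambda>n. g (q n) x) \<longlonglongrightarrow> h 1 * (\<integral>u. unit_kernel x u \<partial>M)"
      using g[OF x] by simp
  qed
  then show ?thesis using M by blast
qed

text \<open>
  The kernel at \<open>1/t\<close> is \<open>t / (u + t (1 - u))\<close> on \<open>[0, 1]\<close>. With \<open>\<sigma> = u / (1 - u)\<close> this is
  \<open>(1 + \<sigma>) t / (\<sigma> + t)\<close>, so the part of the distribution on \<open>(0, 1)\<close> is transported to \<open>(0, \<infinity>)\<close> with
  density \<open>1 + \<sigma>\<close>. At \<open>u = 0\<close> the kernel is \<open>1\<close> and at \<open>u = 1\<close> it is \<open>t\<close>: these masses become the
  constants \<open>a\<close> and \<open>b\<close>.
\<close>

lemma cbf_rep_unit_kernel: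
  assumes M: "real_distribution M" and w: "0 \<le> w"
  shows "\<exists>a b \<mu>. cbf_rep (\<lambda>t. w * (\<integral>u. unit_kernel (1 / t) u \<partial>M)) a b \<mu>"
proof -
  interpret M: real_distribution M by (rule M)
  let ?R = "restrict_space borel {0<..} :: real measure"
  define P where "P = restrict_space M {0<..<1}"
  define \<sigma> where "\<sigma> u = u / (1 - u)" for u :: real
  have \<sigma>[measurable]: "\<sigma> \<in> measurable P ?R"
  proof (rule measurable_restrict_space2)
    show "\<sigma> \<in> space P \<rightarrow> {0<..}" by (auto simp: P_def space_restrict_space \<sigma>_def)
    show "\<sigma> \<in> measurable P borel"
      unfolding P_def by (rule measurable_restrict_space1) (unfold \<sigma>_def, measurable)
  qed
  define \<mu> where "\<mu> = density (distr P ?R \<sigma>) (\<lambda>s. ennreal (w * (1 + s)))"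
  have fin: "finite_measure P" unfolding P_def by (rule finite_measure_restrict_space) (simp_all add: M.finite_measure_axioms)
  interpret P: finite_measure P by (rule fin)
  have sp: "space P = {0<..<1}" by (simp add: P_def space_restrict_space)
  have mR: "f \<in> borel_measurable ?R" if "f \<in> borel_measurable borel" for f :: "real \<Rightarrow> real"
    using that by (rule measurable_restrict_space1)
  have sR: "space ?R = {0<..}" by (simp add: space_restrict_space)
  have int\<mu>: "integrable \<mu> f" "(\<integral>s. f s \<partial>\<mu>) = (\<integral>u. w * (1 / (1 - u) * f (u / (1 - u))) \<partial>P)"
    if f: "f \<in> borel_measurable borel" and bd: "\<And>u. 0 < u \<Longrightarrow> u < 1 \<Longrightarrow> \<bar>1 / (1 - u) * f (u / (1 - u))\<bar> \<le> B" for f B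
  proof -
    have AE: "AE s in distr P ?R \<sigma>. 0 \<le> w * (1 + s)"
      by (rule AE_I2) (use w sR in auto)
    have fm: "f \<in> borel_measurable (distr P ?R \<sigma>)" using mR[OF f] by simp
    have gm: "(\<lambda>s. w * (1 + s)) \<in> borel_measurable (distr P ?R \<sigma>)" using mR[of "\<lambda>s. w * (1 + s)"] by simp
    have e: "(w * (1 + \<sigma> u)) *\<^sub>R f (\<sigma> u) = w * (1 / (1 - u) * f (u / (1 - u)))" if "u \<in> space P" for u
      using that by (simp add: sp \<sigma>_def field_simps)
    have mm: "(\<lambda>s. (w * (1 + s)) *\<^sub>R f s) \<in> borel_measurable ?R" using f by (intro mR) measurable
    have "integrable P (\<lambda>u. w * (1 / (1 - u) * f (u / (1 - u))))"
    proof (rule P.integrable_const_bound[of _ "w * B"])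
      show "AE u in P. norm (w * (1 / (1 - u) * f (u / (1 - u)))) \<le> w * B"
        unfolding real_norm_def abs_mult[of w] abs_of_nonneg[OF w]
        by (rule AE_I2, rule mult_left_mono[OF bd w]) (auto simp: sp)
      show "(\<lambda>u. w * (1 / (1 - u) * f (u / (1 - u)))) \<in> borel_measurable P"
        unfolding P_def by (rule measurable_restrict_space1) (use f in measurable)
    qed
    then have i: "integrable P (\<lambda>u. (w * (1 + \<sigma> u)) *\<^sub>R f (\<sigma> u))"
      by (subst Bochner_Integration.integrable_cong[OF refl e]) auto
    then show "integrable \<mu> f"
      unfolding \<mu>_def by (subst integrable_density[OF fm gm AE]) (rule integrable_distr_eq[OF \<sigma> mm, THEN iffD2, OF i])
    have "(\<integral>s. f s \<partial>\<mu>) = (\<integral>u. (w * (1 + \<sigma> u)) *\<^sub>R f (\<sigma> u) \<partial>P)"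
      unfolding \<mu>_def by (subst integral_density[OF fm gm AE]) (rule integral_distr[OF \<sigma> mm])
    also have "\<dots> = (\<integral>u. w * (1 / (1 - u) * f (u / (1 - u))) \<partial>P)"
      by (rule Bochner_Integration.integral_cong[OF refl e])
    finally show "(\<integral>s. f s \<partial>\<mu>) = (\<integral>u. w * (1 / (1 - u) * f (u / (1 - u))) \<partial>P)" .
  qed
  have "cbf_rep (\<lambda>t. w * (\<integral>u. unit_kernel (1 / t) u \<partial>M)) (w * measure M {..0}) (w * measure M {1..}) \<mu>"
    unfolding cbf_rep_def
  proof (intro conjI allI impI)
    show "0 \<le> w * measure M {..0}" "0 \<le> w * measure M {1..}" using w by auto
    show "sets \<mu> = sets ?R" by (simp add: \<mu>_def)
    show "integrable \<mu> (\<lambda>s. 1 / (s + 1))"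
      by (rule int\<mu>(1)[of _ 1]) (auto simp: field_simps)
    fix t :: real assume t: "t > 0"
    let ?k = "unit_kernel (1 / t)"
    have it: "0 < 1 / t" using t by simp
    have ki: "integrable M (\<lambda>u. ?k u * indicator A u)" if "A \<in> sets borel" for A
    proof (rule M.integrable_const_bound[of _ "max 1 (1 / (1 / t))"])
      show "AE u in M. norm (?k u * indicator A u) \<le> max 1 (1 / (1 / t))"
        using unit_kernel_bounds(1,2)[OF it] by (auto split: split_indicator simp: less_imp_le max.coboundedI1)
      show "(\<lambda>u. ?k u * indicator A u) \<in> borel_measurable M"
        using unit_kernel_measurable[OF it] that by measurable
    qed
    have split: "?k u = ?k u * indicator {..0} u + ?k u * indicator {1..} u + ?k u * indicator {0<..<1} u" for u
      by (auto split: split_indicator)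
    have "(\<integral>u. ?k u \<partial>M) = (\<integral>u. ?k u * indicator {..0} u + ?k u * indicator {1..} u + ?k u * indicator {0<..<1} u \<partial>M)"
      by (rule Bochner_Integration.integral_cong[OF refl split])
    also have "\<dots> = (\<integral>u. ?k u * indicator {..0} u \<partial>M) + (\<integral>u. ?k u * indicator {1..} u \<partial>M) + (\<integral>u. ?k u * indicator {0<..<1} u \<partial>M)"
      by (simp add: ki)
    also have "(\<integral>u. ?k u * indicator {..0} u \<partial>M) = (\<integral>u. indicator {..0} u \<partial>M)"
      by (rule Bochner_Integration.integral_cong) (auto split: split_indicator simp: unit_kernel_def)
    also have "\<dots> = measure M {..0}" by simp
    also have "(\<integral>u. ?k u * indicator {1..} u \<partial>M) = (\<integral>u. t * indicator {1..} u \<partial>M)"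
      by (rule Bochner_Integration.integral_cong) (auto split: split_indicator simp: unit_kernel_def)
    also have "\<dots> = t * measure M {1..}" by simp
    also have "(\<integral>u. ?k u * indicator {0<..<1} u \<partial>M) = (\<integral>u. ?k u \<partial>P)"
      unfolding P_def by (subst integral_restrict_space) (auto simp: mult.commute)
    finally have *: "w * (\<integral>u. ?k u \<partial>M) = w * measure M {..0} + w * measure M {1..} * t + w * (\<integral>u. ?k u \<partial>P)"
      by (simp add: algebra_simps)
    have ker: "1 / (1 - u) * (t / (u / (1 - u) + t)) = ?k u" if "0 < u" "u < 1" for u
    proof -
      have "max 0 (min 1 u) = u" using that by simp
      moreover have "u + t * (1 - u) > 0" using that t by (intro add_pos_nonneg) auto
      moreover have "u / (1 - u) + t = (u + t * (1 - u)) / (1 - u)"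
        using that by (simp add: field_simps)
      then have "1 / (1 - u) * (t / (u / (1 - u) + t)) = t / (u + t * (1 - u))"
        using that by simp
      moreover have "1 + (1 / t - 1) * u = (u + t * (1 - u)) / t" using t by (simp add: field_simps)
      ultimately show ?thesis by (simp add: unit_kernel_def)
    qed
    have "(\<integral>s. t / (s + t) \<partial>\<mu>) = (\<integral>u. w * (1 / (1 - u) * (t / (u / (1 - u) + t))) \<partial>P)"
    proof (rule int\<mu>(2)[of _ "max 1 (1 / (1 / t))"])
      fix u :: real assume u: "0 < u" "u < 1"
      show "\<bar>1 / (1 - u) * (t / (u / (1 - u) + t))\<bar> \<le> max 1 (1 / (1 / t))"
        unfolding ker[OF u] using unit_kernel_bounds(1,2)[OF it, of u] by linarith
    qed measurable
    also have "\<dots> = (\<integral>u. w * ?k u \<partial>P)"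
      by (rule Bochner_Integration.integral_cong) (use ker sp in auto)
    also have "\<dots> = w * (\<integral>u. ?k u \<partial>P)" by simp
    finally show "w * (\<integral>u. ?k u \<partial>M) = w * measure M {..0} + w * measure M {1..} * t + (\<integral>s. t / (s + t) \<partial>\<mu>)"
      using * by simp
  qed
  then show ?thesis by blast
qed

lemma cbf_rep_cong:
  assumes "\<And>t. 0 < t \<Longrightarrow> f t = g t"
  shows "cbf_rep f a b \<mu> \<longleftrightarrow> cbf_rep g a b \<mu>"
  using assms by (simp add: cbf_rep_def)

lemma integrable_Stieltjes_kernel:
  fixes \<nu> :: "real measure"
  assumes M: "sets \<nu> = sets (restrict_space borel {0<..})" and int: "integrable \<nu> (\<lambda>s. 1 / (s + y))"
    and pos: "0 < x" "0 < y"
  shows "integrable \<nu> (\<lambda>s. 1 / (s + x))"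
proof (rule Bochner_Integration.integrable_bound)
  have sp: "space \<nu> = {0<..}" by (rule space_pos[OF M])
  show "integrable \<nu> (\<lambda>s. max 1 (y / x) * (1 / (s + y)))" by (intro integrable_mult_right int)
  show "(\<lambda>s. 1 / (s + x)) \<in> borel_measurable \<nu>" by (rule borel_measurable_pos[OF M]) measurable
  show "AE s in \<nu>. norm (1 / (s + x)) \<le> norm (max 1 (y / x) * (1 / (s + y)))"
  proof (rule AE_I2)
    fix s assume "s \<in> space \<nu>"
    then have s: "s > 0" by (simp add: sp)
    have "s + y \<le> max 1 (y / x) * (s + x)"
    proof -
      have "s + y = 1 * s + y / x * x" using pos by simp
      also have "\<dots> \<le> max 1 (y / x) * s + max 1 (y / x) * x" using s pos by (intro add_mono mult_right_mono) auto
      finally show ?thesis by (simp add: algebra_simps)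
    qed
    then have "1 / (s + x) \<le> max 1 (y / x) * (1 / (s + y))" using s pos by (simp add: field_simps)
    then show "norm (1 / (s + x)) \<le> norm (max 1 (y / x) * (1 / (s + y)))" using s pos by simp
  qed
qed

text \<open>
  With \<open>S\<close> also \<open>S / (1 + S)\<close> is a Stieltjes function. The measure \<open>\<nu>\<close> restricted to \<open>(0, n]\<close> is replaced by
  point masses on a grid of mesh \<open>1/n\<close>; the resulting sums converge to \<open>S\<close> by dominated
  convergence, and the statement for finite sums passes to the limit.
\<close>

theorem Stieltjes_quotient_cbf:
  fixes \<nu> :: "real measure"
  assumes M: "sets \<nu> = sets (restrict_space borel {0<..})" and int1: "integrable \<nu> (\<lambda>s. 1 / (s + 1))"
  defines "S \<equiv> \<lambda>x. \<integral>s. 1 / (s + x) \<partial>\<nu>"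
  shows "\<exists>a b \<mu>. cbf_rep (\<lambda>t. S (1 / t) / (1 + S (1 / t))) a b \<mu>"
proof -
  have sp: "space \<nu> = {0<..}" by (rule space_pos[OF M])
  have int: "integrable \<nu> (\<lambda>s. 1 / (s + x))" if "0 < x" for x
    by (rule integrable_Stieltjes_kernel[OF M int1 that]) simp
  have S_nn: "0 \<le> S x" if "0 < x" for x
    unfolding S_def by (rule integral_nonneg_AE, rule AE_I2) (use that sp in auto)
  have sets_Ioc: "{a<..b} \<in> sets \<nu>" if "0 \<le> a" for a b
    by (rule sets_pos[OF M]) (use that in auto)
  have fin_Ioc: "emeasure \<nu> {a<..b} < \<infinity>" if "0 \<le> a" for a b
  proof -
    have "emeasure \<nu> {a<..b} = (\<integral>\<^sup>+s. indicator {a<..b} s \<partial>\<nu>)" using sets_Ioc[OF that] by simp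
    also have "\<dots> \<le> (\<integral>\<^sup>+s. ennreal ((\<bar>b\<bar> + 1) * (1 / (s + 1))) \<partial>\<nu>)"
    proof (rule nn_integral_mono)
      fix s assume "s \<in> space \<nu>"
      then have s: "s > 0" by (simp add: sp)
      have "1 \<le> (\<bar>b\<bar> + 1) * (1 / (s + 1))" if "s \<le> b" using s that by simp
      then show "indicator {a<..b} s \<le> ennreal ((\<bar>b\<bar> + 1) * (1 / (s + 1)))"
        by (auto split: split_indicator)
    qed
    also have "\<dots> < \<infinity>"
      using integrableD(2)[OF integrable_mult_right[OF int1, of "\<bar>b\<bar> + 1"]]
      unfolding infinity_ennreal_def less_top .
    finally show ?thesis .
  qed
  define m where "m n = real (Suc n)" for n
  have m_pos: "0 < m n" for n by (simp add: m_def)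
  define K where "K n = (\<lambda>k. real k / m n) ` {1..Suc n * Suc n}" for n
  define c where "c n x = measure \<nu> {x - 1 / m n<..x}" for n x
  define Sn where "Sn n x = (\<Sum>k\<in>K n. c n k / (k + x))" for n x
  have K: "finite (K n)" "K n \<subseteq> {0<..}" for n using m_pos by (auto simp: K_def)
  have K_ge: "0 \<le> k - 1 / m n" if "k \<in> K n" for k n
    using that m_pos[of n] by (auto simp: K_def intro!: divide_right_mono)
  have c_nn: "0 \<le> c n k" for n k by (simp add: c_def)
  define F where "F n x s = (\<Sum>k\<in>K n. indicator {k - 1 / m n<..k} s * (1 / (k + x)))" for n and x s :: real
  have F_int: "integrable \<nu> (F n x)" "Sn n x = (\<integral>s. F n x s \<partial>\<nu>)" for n x
  proof -
    have i: "integrable \<nu> (\<lambda>s. indicator {k - 1 / m n<..k} s * (1 / (k + x)))" if "k \<in> K n" for k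
      using K_ge[OF that] by (intro integrable_mult_left integrable_real_indicator sets_Ioc fin_Ioc)
    have sub: "{k - 1 / m n<..k} \<inter> space \<nu> = {k - 1 / m n<..k}" if "k \<in> K n" for k
      using sets.sets_into_space[OF sets_Ioc[OF K_ge[OF that]], of k] by (simp add: Int_absorb2)
    show "integrable \<nu> (F n x)" unfolding F_def by (rule Bochner_Integration.integrable_sum[OF i])
    show "Sn n x = (\<integral>s. F n x s \<partial>\<nu>)"
      unfolding F_def Sn_def
      by (subst Bochner_Integration.integral_sum[OF i]) (auto simp: c_def sub intro!: sum.cong)
  qed
  \<comment> \<open>Rounding up keeps the grid points away from \<open>0\<close> and makes the kernels smaller, so they are dominated.\<close>
  define p where "p n s = real_of_int \<lceil>s * m n\<rceil> / m n" for n and s :: real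
  have p_bounds: "s \<le> p n s" "p n s < s + 1 / m n" for n s
    unfolding p_def using m_pos[of n] ceiling_correct[of "s * m n"] by (auto simp: field_simps)
  have F_eq: "F n x s = (if s \<le> m n then 1 / (p n s + x) else 0)" if s: "0 < s" for n x s
  proof -
    have ind: "indicator {k - 1 / m n<..k} s = (if k = p n s then 1 else 0 :: real)" if "k \<in> K n" for k
    proof -
      from that obtain i where i: "k = real i / m n" by (auto simp: K_def)
      have "s \<in> {k - 1 / m n<..k} \<longleftrightarrow> \<lceil>s * m n\<rceil> = int i"
        unfolding i ceiling_eq_iff using m_pos[of n] by (auto simp: field_simps)
      also have "\<dots> \<longleftrightarrow> k = p n s" unfolding i p_def using m_pos[of n] by (auto simp: field_simps)
      finally show ?thesis by (simp add: indicator_def)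
    qed
    have "F n x s = (\<Sum>k\<in>K n. if k = p n s then 1 / (p n s + x) else 0)"
      unfolding F_def by (rule sum.cong) (auto simp: ind)
    also have "\<dots> = (if p n s \<in> K n then 1 / (p n s + x) else 0)" using K(1)[of n] by simp
    also have "p n s \<in> K n \<longleftrightarrow> s \<le> m n"
    proof
      assume "p n s \<in> K n"
      then obtain i where "i \<le> Suc n * Suc n" "p n s = real i / m n" by (auto simp: K_def)
      then have "p n s \<le> real (Suc n * Suc n) / m n" using m_pos[of n] by (simp add: divide_right_mono del: of_nat_mult of_nat_Suc mult_Suc mult_Suc_right)
      also have "\<dots> = m n" by (simp add: m_def del: of_nat_Suc mult_Suc mult_Suc_right)
      finally show "s \<le> m n" using p_bounds(1)[of s n] by simp
    next
      assume "s \<le> m n"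
      then have "s * m n \<le> m n * m n" using m_pos[of n] by simp
      also have "\<dots> = of_int (int (Suc n * Suc n))" by (simp add: m_def algebra_simps)
      finally have le: "\<lceil>s * m n\<rceil> \<le> int (Suc n * Suc n)" by (simp only: ceiling_le_iff)
      have "0 < \<lceil>s * m n\<rceil>" using s m_pos[of n] by simp
      then obtain i where i: "\<lceil>s * m n\<rceil> = int i" "0 < i" using zero_less_imp_eq_int by metis
      then have "p n s = real i / m n" "i \<in> {1..Suc n * Suc n}" using le by (auto simp: p_def simp del: mult_Suc mult_Suc_right of_nat_mult of_nat_Suc)
      then show "p n s \<in> K n" unfolding K_def by blast
    qed
    finally show ?thesis .
  qed
  have p_lim: "(\<lambda>n. p n s) \<longlonglongrightarrow> s" for s
  proof (rule tendsto_sandwich[OF _ _ tendsto_const])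
    show "(\<lambda>n. s + 1 / m n) \<longlonglongrightarrow> s"
      using tendsto_add[OF tendsto_const[of s] LIMSEQ_inverse_real_of_nat] by (simp add: m_def inverse_eq_divide)
  qed (auto intro!: always_eventually less_imp_le[OF p_bounds(2)] p_bounds(1))
  have lim: "(\<lambda>n. Sn n x) \<longlonglongrightarrow> S x" if x: "0 < x" for x
    unfolding F_int(2) S_def
  proof (rule integral_dominated_convergence[where w = "\<lambda>s. 1 / (s + x)"])
    show "(\<lambda>s. 1 / (s + x)) \<in> borel_measurable \<nu>" "integrable \<nu> (\<lambda>s. 1 / (s + x))" using int[OF x] by auto
    show "F n x \<in> borel_measurable \<nu>" for n using F_int(1) by auto
    show "AE s in \<nu>. (\<lambda>n. F n x s) \<longlonglongrightarrow> 1 / (s + x)"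
    proof (rule AE_I2)
      fix s assume "s \<in> space \<nu>"
      then have s: "s > 0" by (simp add: sp)
      have "eventually (\<lambda>n. s \<le> m n) sequentially"
      proof -
        obtain k where "s \<le> real k" using real_arch_simple by blast
        then show ?thesis by (intro eventually_sequentiallyI[of k]) (simp add: m_def)
      qed
      then have "eventually (\<lambda>n. 1 / (p n s + x) = F n x s) sequentially"
        by eventually_elim (simp add: F_eq[OF s])
      moreover have "(\<lambda>n. 1 / (p n s + x)) \<longlonglongrightarrow> 1 / (s + x)"
        using s x by (intro tendsto_intros p_lim) simp
      ultimately show "(\<lambda>n. F n x s) \<longlonglongrightarrow> 1 / (s + x)" by (rule Lim_transform_eventually[rotated])
    qed
    show "AE s in \<nu>. norm (F n x s) \<le> 1 / (s + x)" for n
    proof (rule AE_I2)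
      fix s assume "s \<in> space \<nu>"
      then have s: "s > 0" by (simp add: sp)
      then show "norm (F n x s) \<le> 1 / (s + x)"
        using p_bounds(1)[of s n] x by (auto simp: F_eq[OF s] intro!: frac_le)
    qed
  qed
  define h where "h x = S x / (1 + S x)" for x
  have "\<forall>n. \<exists>N. real_distribution N \<and> measure N {-1<..1} = 1 \<and>
    (\<forall>x>0. Sn n x / (1 + Sn n x) = Sn n 1 / (1 + Sn n 1) * (\<integral>u. unit_kernel x u \<partial>N))"
    unfolding Sn_def by (rule allI) (rule Stieltjes_sum_distribution[OF K c_nn])
  then obtain N where N: "\<And>n. real_distribution (N n)" "\<And>n. measure (N n) {-1<..1} = 1"
    "\<And>n x. 0 < x \<Longrightarrow> Sn n x / (1 + Sn n x) = Sn n 1 / (1 + Sn n 1) * (\<integral>u. unit_kernel x u \<partial>N n)"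
    by metis
  have "\<exists>D. real_distribution D \<and> (\<forall>x>0. h x = h 1 * (\<integral>u. unit_kernel x u \<partial>D))"
  proof (rule unit_kernel_representation_limit[OF N])
    fix x :: real assume "0 < x"
    then show "(\<lambda>n. Sn n x / (1 + Sn n x)) \<longlonglongrightarrow> h x"
      unfolding h_def using S_nn[of x] by (intro tendsto_intros lim) auto
  qed
  then obtain D where D: "real_distribution D" "\<And>x. 0 < x \<Longrightarrow> h x = h 1 * (\<integral>u. unit_kernel x u \<partial>D)" by blast
  have "0 \<le> h 1" using S_nn[of 1] by (simp add: h_def)
  from cbf_rep_unit_kernel[OF D(1) this] obtain a b \<mu> where
    "cbf_rep (\<lambda>t. h 1 * (\<integral>u. unit_kernel (1 / t) u \<partial>D)) a b \<mu>" by blast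
  also have "?this \<longleftrightarrow> cbf_rep (\<lambda>t. S (1 / t) / (1 + S (1 / t))) a b \<mu>"
  proof (rule cbf_rep_cong)
    fix t :: real assume "0 < t"
    then show "h 1 * (\<integral>u. unit_kernel (1 / t) u \<partial>D) = S (1 / t) / (1 + S (1 / t))"
      using D(2)[of "1 / t"] by (simp only: h_def[symmetric]) simp
  qed
  finally show ?thesis by blast
qed

section \<open>Regular variation\<close>

lemma mono_right_limit:
  fixes g :: "real \<Rightarrow> real"
  assumes g: "mono_on {0..} g" and "0 \<le> s"
  shows "Lim (at_right s) g = Inf (g ` {s<..})" and "s < y \<Longrightarrow> Lim (at_right s) g \<le> g y"
    and "g s \<le> Lim (at_right s) g"
proof -
  have bdd: "bdd_below (g ` {s<..})"
    by (rule bdd_belowI2[of _ "g s"]) (use assms in \<open>auto simp: mono_on_def\<close>)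
  have "(g \<longlongrightarrow> Inf (g ` {s<..})) (at_right s)"
  proof (rule order_tendstoI)
    fix a assume a: "a < Inf (g ` {s<..})"
    show "eventually (\<lambda>x. a < g x) (at_right s)"
      unfolding eventually_at_right_field
    proof (intro exI[of _ "s + 1"] conjI allI impI)
      fix y assume "s < y"
      then show "a < g y" using cInf_lower[OF _ bdd, of "g y"] a by force
    qed simp
  next
    fix a assume "Inf (g ` {s<..}) < a"
    then obtain y where y: "s < y" "g y < a" using cInf_lessD[of "g ` {s<..}" a] by auto
    show "eventually (\<lambda>x. g x < a) (at_right s)"
      unfolding eventually_at_right_field
    proof (intro exI[of _ y] conjI allI impI)
      fix z assume "s < z" "z < y"
      then have "g z \<le> g y" using mono_onD[OF g, of z y] assms(2) by simp
      then show "g z < a" using y by simp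
    qed (use y in simp)
  qed
  then show L: "Lim (at_right s) g = Inf (g ` {s<..})"
    by (intro tendsto_Lim) simp_all
  show "Lim (at_right s) g \<le> g y" if "s < y"
    unfolding L using that by (intro cInf_lower bdd) auto
  show "g s \<le> Lim (at_right s) g"
    unfolding L by (rule cInf_greatest) (use assms in \<open>auto simp: mono_on_def\<close>)
qed

lemma
  fixes g :: "real \<Rightarrow> real"
  assumes g: "mono_on {0..} g"
  shows sets_stieltjes_measure: "sets (stieltjes_measure g) = sets (restrict_space borel {0<..})"
    and emeasure_stieltjes_measure_le:
      "\<lbrakk>0 < x; x < y; 0 \<le> g 0\<rbrakk> \<Longrightarrow> emeasure (stieltjes_measure g) {0<..x} \<le> ennreal (g y)"
proof -
  define G where "G s = Lim (at_right (max s 0)) g" for s :: real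
  have eq: "stieltjes_measure g = restrict_space (interval_measure G) {0<..}"
    by (simp add: stieltjes_measure_def G_def[abs_def])
  show "sets (stieltjes_measure g) = sets (restrict_space borel {0<..})"
    unfolding eq by (rule sets_restrict_space_cong) simp
  have G_le: "G s \<le> g y" if "max s 0 < y" for s y unfolding G_def by (rule mono_right_limit(2)[OF g]) (use that in auto)
  have G_ge: "g (max s 0) \<le> G s" for s unfolding G_def by (rule mono_right_limit(3)[OF g]) auto
  have mono: "G x \<le> G y" if "x \<le> y" for x y
  proof (cases "max x 0 < max y 0")
    case True
    then show ?thesis using G_le[of x "max y 0"] G_ge[of y] by simp
  next
    case False
    then have "max x 0 = max y 0" using that by auto
    then show ?thesis by (simp add: G_def)
  qed
  have cont: "continuous (at_right a) G" for a
    unfolding continuous_within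
  proof (rule order_tendstoI)
    fix b assume "b < G a"
    then show "eventually (\<lambda>x. b < G x) (at_right a)"
      unfolding eventually_at_right_field
      by (intro exI[of _ "a + 1"]) (auto intro: less_le_trans[OF _ mono])
  next
    fix b assume b: "G a < b"
    then have "Inf (g ` {max a 0<..}) < b" using mono_right_limit(1)[OF g, of "max a 0"] by (simp add: G_def)
    then obtain y where y: "max a 0 < y" "g y < b" using cInf_lessD[of "g ` {max a 0<..}" b] by auto
    show "eventually (\<lambda>x. G x < b) (at_right a)"
      unfolding eventually_at_right_field
      by (rule exI[of _ y]) (use y in \<open>auto intro!: le_less_trans[OF G_le]\<close>)
  qed
  assume x: "0 < x" "x < y" "0 \<le> g 0"
  have "emeasure (stieltjes_measure g) {0<..x} = emeasure (interval_measure G) {0<..x}"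
    unfolding eq by (rule emeasure_restrict_space) auto
  also have "\<dots> = ennreal (G x - G 0)"
    using emeasure_interval_measure_Ioc_eq[OF mono cont, of 0 x] x by simp
  also have "\<dots> \<le> ennreal (g y)"
    using G_le[of x y] G_ge[of 0] x by (intro ennreal_leI) auto
  finally show "emeasure (stieltjes_measure g) {0<..x} \<le> ennreal (g y)" .
qed

text \<open>
  A pointwise form of the dyadic decomposition: if \<open>k\<close> is least with \<open>s \<le> 2\<^sup>k x\<close>, then
  \<open>s + x \<ge> 2\<^sup>k x / 2\<close>. Integrating it bounds a Stieltjes transform by the masses of the
  intervals \<open>(0, 2\<^sup>k x]\<close> alone.
\<close>

lemma Stieltjes_kernel_dyadic_le:
  fixes s x :: real
  assumes "0 < s" "0 < x"
  shows "ennreal (1 / (s + x)) \<le> (\<Sum>k. ennreal (2 / (2 ^ k * x)) * indicator {0<..2 ^ k * x} s)"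
proof -
  have "\<exists>k. s \<le> 2 ^ k * x"
  proof -
    obtain n where "s / x < 2 ^ n" using real_arch_pow[of 2 "s / x"] by auto
    then show ?thesis using assms by (intro exI[of _ n]) (simp add: field_simps)
  qed
  then obtain k where k: "s \<le> 2 ^ k * x" "\<And>j. j < k \<Longrightarrow> \<not> s \<le> 2 ^ j * x"
    using exists_least_iff[of "\<lambda>k. s \<le> 2 ^ k * x"] by auto
  have "1 / (s + x) \<le> 2 / (2 ^ k * x)"
  proof (cases k)
    case 0
    then show ?thesis using assms by (simp add: field_simps)
  next
    case (Suc j)
    then have "2 ^ j * x < s" using k(2)[of j] by simp
    then have "2 ^ j * x \<le> s + x" using assms by simp
    then have "1 / (s + x) \<le> 1 / (2 ^ j * x)" using assms by (intro divide_left_mono mult_pos_pos add_pos_pos) auto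
    then show ?thesis by (simp add: Suc)
  qed
  then have "ennreal (1 / (s + x)) \<le> ennreal (2 / (2 ^ k * x)) * indicator {0<..2 ^ k * x} s"
    using k(1) assms by (simp add: ennreal_leI)
  also have "\<dots> \<le> (\<Sum>j. ennreal (2 / (2 ^ j * x)) * indicator {0<..2 ^ j * x} s)"
    using sum_le_suminf[of "\<lambda>j. ennreal (2 / (2 ^ j * x)) * indicator {0<..2 ^ j * x} s" "{k}"]
    by (simp only: sum.insert sum.empty finite.intros empty_iff not_False_eq_True add_0_right summableI zero_le)
  finally show ?thesis .
qed

lemma doubling_iterate:
  fixes g :: "real \<Rightarrow> real"
  assumes dbl: "\<And>s. s0 \<le> s \<Longrightarrow> g (2 * s) \<le> q * g s" and q: "0 \<le> q" and s: "0 < s0" "s0 \<le> s"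
  shows "g (2 ^ k * s) \<le> q ^ k * g s"
proof (induction k)
  case (Suc k)
  have "1 * s \<le> 2 ^ k * s" using s by (intro mult_right_mono) auto
  then have "g (2 * (2 ^ k * s)) \<le> q * g (2 ^ k * s)" using s by (intro dbl) linarith
  also have "\<dots> \<le> q * (q ^ k * g s)" using Suc q by (rule mult_left_mono)
  finally show ?case by (simp add: mult_ac)
qed simp

text \<open>
  The interval \<open>(0, 2\<^sup>k x]\<close> has mass at most \<open>g(2\<^bsup>k+1\<^esup> x) \<le> q\<^bsup>k+1\<^esup> g(x)\<close>, so the dyadic sum is a
  geometric series of ratio \<open>q / 2 < 1\<close>. This is an upper bound of Abelian type, as in Karamata's
  theorem.
\<close>

lemma S_fun_doubling_bound:
  fixes g :: "real \<Rightarrow> real"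
  assumes g: "mono_on {0..} g" "0 \<le> g 0"
    and dbl: "\<And>s. s0 \<le> s \<Longrightarrow> g (2 * s) \<le> q * g s" and q: "0 \<le> q" "q < 2" and x: "0 < s0" "s0 \<le> x"
  shows "integrable (stieltjes_measure g) (\<lambda>s. 1 / (s + x))"
    and "0 \<le> S_fun g x" and "S_fun g x \<le> 2 * q / (1 - q / 2) * (g x / x)"
proof -
  let ?\<nu> = "stieltjes_measure g"
  note sets = sets_stieltjes_measure[OF g(1)]
  have sp: "space ?\<nu> = {0<..}" by (rule space_pos[OF sets])
  have x0: "0 < x" using x by simp
  have gx: "0 \<le> g x" using g x0 mono_onD[OF g(1), of 0 x] by simp
  have sets_Ioc: "{0<..b} \<in> sets ?\<nu>" for b
    by (rule sets_pos[OF sets]) auto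
  have meas: "(\<lambda>s. 1 / (s + x)) \<in> borel_measurable ?\<nu>"
    by (rule borel_measurable_pos[OF sets]) measurable
  let ?a = "\<lambda>k. 2 * q / x * g x * (q / 2) ^ k"
  have sums: "?a sums (2 * q / x * g x * (1 / (1 - q / 2)))"
    using q by (intro sums_mult geometric_sums) simp
  have le: "(\<integral>\<^sup>+s. ennreal (1 / (s + x)) \<partial>?\<nu>) \<le> ennreal (2 * q / x * g x * (1 / (1 - q / 2)))"
  proof -
    have "(\<integral>\<^sup>+s. ennreal (1 / (s + x)) \<partial>?\<nu>)
        \<le> (\<integral>\<^sup>+s. (\<Sum>k. ennreal (2 / (2 ^ k * x)) * indicator {0<..2 ^ k * x} s) \<partial>?\<nu>)"
      by (rule nn_integral_mono, rule Stieltjes_kernel_dyadic_le) (use x0 sp in auto)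
    also have "\<dots> = (\<Sum>k. \<integral>\<^sup>+s. ennreal (2 / (2 ^ k * x)) * indicator {0<..2 ^ k * x} s \<partial>?\<nu>)"
      by (rule nn_integral_suminf) (use sets_Ioc in measurable)
    also have "\<dots> \<le> (\<Sum>k. ennreal (?a k))"
    proof (rule suminf_le)
      fix k
      have "(\<integral>\<^sup>+s. ennreal (2 / (2 ^ k * x)) * indicator {0<..2 ^ k * x} s \<partial>?\<nu>)
          = ennreal (2 / (2 ^ k * x)) * emeasure ?\<nu> {0<..2 ^ k * x}"
        by (rule nn_integral_cmult_indicator[OF sets_Ioc])
      also have "\<dots> \<le> ennreal (2 / (2 ^ k * x)) * ennreal (q ^ Suc k * g x)"
      proof (rule mult_left_mono)
        have "emeasure ?\<nu> {0<..2 ^ k * x} \<le> ennreal (g (2 ^ Suc k * x))"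
          by (rule emeasure_stieltjes_measure_le[OF g(1) _ _ g(2)]) (use x0 in auto)
        also have "\<dots> \<le> ennreal (q ^ Suc k * g x)"
          by (rule ennreal_leI, rule doubling_iterate[of s0 g q x "Suc k", OF dbl q(1) x])
        finally show "emeasure ?\<nu> {0<..2 ^ k * x} \<le> ennreal (q ^ Suc k * g x)" .
      qed simp
      also have "\<dots> = ennreal (2 / (2 ^ k * x) * (q ^ Suc k * g x))"
        using x0 by (subst ennreal_mult') auto
      also have "2 / (2 ^ k * x) * (q ^ Suc k * g x) = ?a k"
        using x0 by (simp add: field_simps power_divide)
      finally show "(\<integral>\<^sup>+s. ennreal (2 / (2 ^ k * x)) * indicator {0<..2 ^ k * x} s \<partial>?\<nu>) \<le> ennreal (?a k)" .
    qed auto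
    also have "\<dots> = ennreal (2 * q / x * g x * (1 / (1 - q / 2)))"
      using sums gx q x0 by (intro suminf_ennreal_eq) auto
    finally show ?thesis .
  qed
  show int: "integrable ?\<nu> (\<lambda>s. 1 / (s + x))"
  proof (rule integrableI_nonneg[OF meas])
    show "AE s in ?\<nu>. 0 \<le> 1 / (s + x)" by (rule AE_I2) (use sp x0 in auto)
    show "(\<integral>\<^sup>+s. ennreal (1 / (s + x)) \<partial>?\<nu>) < \<infinity>" using le by (rule le_less_trans) simp
  qed
  show nn: "0 \<le> S_fun g x" unfolding S_fun_def
    by (rule integral_nonneg_AE, rule AE_I2) (use sp x0 in auto)
  have "ennreal (S_fun g x) \<le> ennreal (2 * q / x * g x * (1 / (1 - q / 2)))"
    using le unfolding S_fun_def by (subst nn_integral_eq_integral[symmetric, OF int]) (auto intro!: AE_I2 simp: sp x0 less_imp_le[OF x0])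
  then show "S_fun g x \<le> 2 * q / (1 - q / 2) * (g x / x)"
    using gx q x0 by (subst (asm) ennreal_le_iff) (auto simp: field_simps)
qed

lemma doubling_power_growth:
  fixes g :: "real \<Rightarrow> real"
  assumes g: "mono_on {0..} g" "0 \<le> g 0"
    and dbl: "\<And>s. s0 \<le> s \<Longrightarrow> g (2 * s) \<le> 2 powr p * g s" and p: "0 \<le> p" and x: "0 < s0" "s0 \<le> x"
  shows "g x \<le> 2 powr p * g s0 * (x / s0) powr p"
proof -
  have xs: "1 \<le> x / s0" using x by simp
  \<comment> \<open>\<open>2\<^sup>k s0 \<le> x \<le> 2\<^bsup>k+1\<^esup> s0\<close>\<close>
  define k where "k = nat \<lfloor>log 2 (x / s0)\<rfloor>"
  have lg: "0 \<le> log 2 (x / s0)" using xs by simp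
  have k1: "real k \<le> log 2 (x / s0)" "log 2 (x / s0) \<le> real (Suc k)"
    using lg unfolding k_def by linarith+
  have "2 powr real k \<le> x / s0" "x / s0 \<le> 2 powr real (Suc k)"
    using k1 xs by (auto simp: le_log_iff log_le_iff)
  then have k: "2 ^ k \<le> x / s0" "x / s0 \<le> 2 ^ Suc k" by (simp_all only: powr_realpow)
  have "g x \<le> g (2 ^ Suc k * s0)" using k(2) x by (intro mono_onD[OF g(1)]) (auto simp: field_simps)
  also have "\<dots> \<le> (2 powr p) ^ Suc k * g s0" by (rule doubling_iterate[of s0 g "2 powr p" s0 "Suc k", OF dbl]) (use x in auto)
  also have "(2 powr p) ^ Suc k = 2 powr p * (2 ^ k) powr p"
    by (simp add: powr_powr powr_realpow[symmetric] powr_add[symmetric] mult.commute)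
  also have "2 powr p * (2 ^ k) powr p * g s0 \<le> 2 powr p * (x / s0) powr p * g s0"
    using k(1) p g mono_onD[OF g(1), of 0 s0] x by (intro mult_right_mono mult_left_mono powr_mono2) auto
  finally show ?thesis by (simp add: mult_ac)
qed

lemma reg_fun_eq: "0 < s \<Longrightarrow> reg_fun \<beta> l s = s powr (1 - \<beta>) * l s"
  by (simp add: reg_fun_def)

text \<open>
  The form in which slow variation is used: once \<open>\<ell>(2s) \<le> 2\<^sup>\<epsilon> \<ell>(s)\<close>, monotonicity of \<open>g\<close> extends the
  control from the points \<open>2\<^sup>k s\<close> to all larger arguments. For \<open>\<epsilon> < \<beta>\<close> the factor is less than \<open>2\<close>,
  which makes the dyadic sums converge.
\<close>

lemma reg_fun_doubling:
  assumes "slowly_varying l" and "0 < \<epsilon>"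
  obtains s0 where "0 < s0" "\<And>s. s0 \<le> s \<Longrightarrow> reg_fun \<beta> l (2 * s) \<le> 2 powr (1 - \<beta> + \<epsilon>) * reg_fun \<beta> l s"
proof -
  have l_pos: "\<And>s. 0 \<le> s \<Longrightarrow> 0 < l s" and lim: "((\<lambda>s. l (2 * s) / l s) \<longlongrightarrow> 1) at_top"
    using assms(1) unfolding slowly_varying_def by auto
  have "1 < 2 powr \<epsilon>" using assms(2) by simp
  from order_tendstoD(2)[OF lim this] obtain N where N: "\<And>s. N \<le> s \<Longrightarrow> l (2 * s) / l s < 2 powr \<epsilon>"
    unfolding eventually_at_top_linorder by blast
  show ?thesis
  proof (rule that[of "max 1 N"])
    fix s assume "max 1 N \<le> s"
    then have s: "N \<le> s" "0 < s" by auto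
    have "l (2 * s) \<le> 2 powr \<epsilon> * l s" using N[OF s(1)] l_pos[of s] s by (simp add: field_simps)
    then have "(2 * s) powr (1 - \<beta>) * l (2 * s) \<le> (2 * s) powr (1 - \<beta>) * (2 powr \<epsilon> * l s)"
      by (intro mult_left_mono) auto
    also have "\<dots> = 2 powr (1 - \<beta> + \<epsilon>) * (s powr (1 - \<beta>) * l s)"
      using s by (simp add: powr_mult powr_add)
    finally show "reg_fun \<beta> l (2 * s) \<le> 2 powr (1 - \<beta> + \<epsilon>) * reg_fun \<beta> l s"
      using s by (simp add: reg_fun_eq)
  qed simp
qed

lemma reg_fun_0_nonneg: "slowly_varying l \<Longrightarrow> 0 \<le> reg_fun \<beta> l 0"
  unfolding slowly_varying_def reg_fun_def by (auto intro: less_imp_le)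

text \<open>
  What the operator theory needs to know about \<open>f\<^sub>m\<close>. The last two upper bounds come from
  \<open>f\<^sub>m(t) \<le> S\<^sub>g(1/t) \<le> C t g(1/t)\<close> for small \<open>t\<close>: in the first one \<open>g\<close> is kept, to be cancelled against the hypothesis on
  the resolvent; in the second one it is replaced by a power, at the cost of \<open>\<epsilon>\<close> in the exponent.
\<close>

lemma
  assumes sv: "slowly_varying l" and \<beta>: "0 < \<beta>" "\<beta> \<le> 1" and mono: "mono_on {0..} (reg_fun \<beta> l)"
  shows f_m_cbf: "\<exists>a b \<mu>. cbf_rep (f_m (reg_fun \<beta> l)) a b \<mu>"
    and f_m_nonneg: "\<And>t. 0 < t \<Longrightarrow> 0 \<le> f_m (reg_fun \<beta> l) t"
    and f_m_le_1: "\<And>t. 0 < t \<Longrightarrow> f_m (reg_fun \<beta> l) t \<le> 1"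
    and f_m_le_regular: "\<exists>C\<ge>0. \<exists>t0>0. \<forall>t. 0 < t \<longrightarrow> t \<le> t0 \<longrightarrow> f_m (reg_fun \<beta> l) t \<le> C * (t powr \<beta> * l (1 / t))"
    and f_m_le_powr: "\<And>\<epsilon>. 0 < \<epsilon> \<Longrightarrow> \<epsilon> < \<beta> \<Longrightarrow> \<exists>C\<ge>0. \<forall>t. 0 < t \<longrightarrow> t \<le> 1 \<longrightarrow> f_m (reg_fun \<beta> l) t \<le> C * t powr (\<beta> - \<epsilon>)"
proof -
  let ?g = "reg_fun \<beta> l"
  note g0 = reg_fun_0_nonneg[OF sv, of \<beta>]
  have sets: "sets (stieltjes_measure ?g) = sets (restrict_space borel {0<..})" by (rule sets_stieltjes_measure[OF mono])
  have sp: "space (stieltjes_measure ?g) = {0<..}" by (rule space_pos[OF sets])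
  have S_nn: "0 \<le> S_fun ?g x" if "0 < x" for x unfolding S_fun_def
    by (rule integral_nonneg_AE, rule AE_I2) (use that sp in auto)
  have f_le: "f_m ?g t \<le> S_fun ?g (1 / t)" if "0 < t" for t
    using S_nn[of "1 / t"] that by (simp add: f_m_def f_g_def divide_le_eq mult_nonneg_nonneg algebra_simps)
  show nn: "0 \<le> f_m ?g t" if "0 < t" for t using S_nn[of "1 / t"] that by (simp add: f_m_def f_g_def)
  show le1: "f_m ?g t \<le> 1" if "0 < t" for t using S_nn[of "1 / t"] that by (simp add: f_m_def f_g_def)
  have powr_lt: "2 powr (1 - \<beta> + \<epsilon>) < 2" if "\<epsilon> < \<beta>" for \<epsilon>
    using powr_less_mono[of "1 - \<beta> + \<epsilon>" 1 2] that by simp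
  have bound: "\<exists>C\<ge>0. \<exists>s0>0. (\<forall>s\<ge>s0. ?g (2 * s) \<le> 2 powr (1 - \<beta> + \<epsilon>) * ?g s) \<and>
      (\<forall>x\<ge>s0. integrable (stieltjes_measure ?g) (\<lambda>s. 1 / (s + x)) \<and> S_fun ?g x \<le> C * (?g x / x))"
    if e: "0 < \<epsilon>" "\<epsilon> < \<beta>" for \<epsilon>
  proof -
    obtain s0 where s0: "0 < s0" "\<And>s. s0 \<le> s \<Longrightarrow> ?g (2 * s) \<le> 2 powr (1 - \<beta> + \<epsilon>) * ?g s"
      using reg_fun_doubling[OF sv e(1)] by blast
    note b = S_fun_doubling_bound[OF mono g0 s0(2) _ powr_lt[OF e(2)] s0(1)]
    show ?thesis
    proof (intro exI conjI)
      show "0 \<le> 2 * 2 powr (1 - \<beta> + \<epsilon>) / (1 - 2 powr (1 - \<beta> + \<epsilon>) / 2)" using powr_lt[OF e(2)] by simp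
    qed (use s0 b(1) b(3) in auto)
  qed
  obtain C s0 where C: "0 \<le> C" and s0: "0 < s0" and dom: "\<forall>x\<ge>s0. integrable (stieltjes_measure ?g) (\<lambda>s. 1 / (s + x)) \<and> S_fun ?g x \<le> C * (?g x / x)"
    using bound[of "\<beta> / 2"] \<beta> by auto
  have "integrable (stieltjes_measure ?g) (\<lambda>s. 1 / (s + 1))"
    by (rule integrable_Stieltjes_kernel[OF sets, of s0]) (use dom s0 in auto)
  from Stieltjes_quotient_cbf[OF sets this]
  show "\<exists>a b \<mu>. cbf_rep (f_m ?g) a b \<mu>"
    by (simp add: f_m_def[abs_def] f_g_def[abs_def] S_fun_def[abs_def])
  show "\<exists>C\<ge>0. \<exists>t0>0. \<forall>t. 0 < t \<longrightarrow> t \<le> t0 \<longrightarrow> f_m ?g t \<le> C * (t powr \<beta> * l (1 / t))"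
  proof (rule exI[of _ C], intro conjI exI[of _ "1 / s0"] allI impI)
    fix t assume t: "0 < t" "t \<le> 1 / s0"
    then have "s0 \<le> 1 / t" using s0 by (simp add: field_simps)
    then have "S_fun ?g (1 / t) \<le> C * (?g (1 / t) / (1 / t))" using dom by blast
    also have "?g (1 / t) / (1 / t) = t powr \<beta> * l (1 / t)"
      using t by (simp add: reg_fun_eq powr_diff powr_divide)
    finally show "f_m ?g t \<le> C * (t powr \<beta> * l (1 / t))" using f_le[OF t(1)] by simp
  qed (use C s0 in auto)
  show "\<exists>C\<ge>0. \<forall>t. 0 < t \<longrightarrow> t \<le> 1 \<longrightarrow> f_m ?g t \<le> C * t powr (\<beta> - \<epsilon>)" if e: "0 < \<epsilon>" "\<epsilon> < \<beta>" for \<epsilon>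
  proof -
    obtain C s0 where C: "0 \<le> C" and s0: "0 < s0"
      and dbl: "\<And>s. s0 \<le> s \<Longrightarrow> ?g (2 * s) \<le> 2 powr (1 - \<beta> + \<epsilon>) * ?g s"
      and dom: "\<And>x. s0 \<le> x \<Longrightarrow> S_fun ?g x \<le> C * (?g x / x)"
      using bound[OF e] by auto
    define p where "p = 1 - \<beta> + \<epsilon>"
    have p: "0 \<le> p" using \<beta> e by (simp add: p_def)
    have gs0: "0 \<le> ?g s0" using g0 mono_onD[OF mono, of 0 s0] s0 by simp
    define D where "D = C * (2 powr p * ?g s0 * (1 / s0) powr p) + s0 powr (\<beta> - \<epsilon>)"
    have D1: "0 \<le> C * (2 powr p * ?g s0 * (1 / s0) powr p)" using C gs0 by simp
    have "f_m ?g t \<le> D * t powr (\<beta> - \<epsilon>)" if t: "0 < t" "t \<le> 1" for t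
    proof (cases "s0 \<le> 1 / t")
      case True
      have "f_m ?g t \<le> C * (?g (1 / t) / (1 / t))" using f_le[OF t(1)] dom[OF True] by simp
      also have "\<dots> \<le> C * ((2 powr p * ?g s0 * (1 / t / s0) powr p) / (1 / t))"
        using doubling_power_growth[OF mono g0 dbl _ s0 True] p t C
        unfolding p_def by (intro mult_left_mono divide_right_mono) auto
      also have "\<dots> = C * (2 powr p * ?g s0 * (1 / s0) powr p) * t powr (\<beta> - \<epsilon>)"
      proof -
        have "t = t powr 1" using t by simp
        then have "(1 / t) powr p * t = t powr (1 - p)" using t by (simp add: powr_divide powr_diff)
        moreover have "(1 / t / s0) powr p = (1 / s0) powr p * (1 / t) powr p"
          using t s0 by (simp add: powr_divide powr_mult)
        ultimately show ?thesis using t by (simp add: p_def mult_ac)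
      qed
      also have "\<dots> \<le> D * t powr (\<beta> - \<epsilon>)" unfolding D_def by (intro mult_right_mono) auto
      finally show ?thesis .
    next
      case False
      then have "1 \<le> s0 * t" using t s0 by (simp add: field_simps)
      then have "1 \<le> (s0 * t) powr (\<beta> - \<epsilon>)" using e by (intro ge_one_powr_ge_zero) auto
      also have "\<dots> = s0 powr (\<beta> - \<epsilon>) * t powr (\<beta> - \<epsilon>)" using s0 t by (simp add: powr_mult)
      also have "\<dots> \<le> D * t powr (\<beta> - \<epsilon>)" unfolding D_def using D1 by (intro mult_right_mono) auto
      finally show ?thesis using le1[OF t(1)] by simp
    qed
    moreover have "0 \<le> D" using D1 by (simp add: D_def)
    ultimately show ?thesis by blast
  qed
qed

text \<open>
  Letting \<open>t\<close> tend to \<open>0\<close> gives \<open>a = 0\<close>, letting it tend to \<open>\<infinity>\<close> gives \<open>b = 0\<close> and, by Fatou's lemma,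
  that \<open>\<mu>\<close> has mass at most \<open>1\<close>.
\<close>

lemma cbf_rep_bounded_vanishing:
  assumes rep: "cbf_rep f a b \<mu>" and le: "\<And>t. 0 < t \<Longrightarrow> f t \<le> 1"
    and van: "\<And>t. 0 < t \<Longrightarrow> t \<le> 1 \<Longrightarrow> f t \<le> C * t powr p" and p: "0 < p"
  shows "a = 0" and "b = 0" and "emeasure \<mu> (space \<mu>) \<le> 1"
    and "\<And>t. 0 < t \<Longrightarrow> (\<integral>\<^sup>+s. ennreal (t / (s + t)) \<partial>\<mu>) = ennreal (f t)"
proof -
  have a: "0 \<le> a" and b: "0 \<le> b" and M: "sets \<mu> = sets (restrict_space borel {0<..})"
    and int1: "integrable \<mu> (\<lambda>s. 1 / (s + 1))"
    and f: "\<And>t. 0 < t \<Longrightarrow> f t = a + b * t + (\<integral>s. t / (s + t) \<partial>\<mu>)"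
    using rep unfolding cbf_rep_def by auto
  have sp: "space \<mu> = {0<..}" by (rule space_pos[OF M])
  have int: "integrable \<mu> (\<lambda>s. t / (s + t))" if "0 < t" for t
    using integrable_mult_right[OF integrable_Stieltjes_kernel[OF M int1 that], of t] by simp
  have nn: "0 \<le> (\<integral>s. t / (s + t) \<partial>\<mu>)" if "0 < t" for t
    by (rule integral_nonneg_AE, rule AE_I2) (use that sp in auto)
  show a0: "a = 0"
  proof (rule antisym[OF _ a])
    have "((\<lambda>t. C * t powr p) \<longlongrightarrow> C * 0 powr p) (at_right 0)"
      using p by (intro tendsto_intros tendsto_powr'[where b = p]) (auto simp: eventually_at_right_field intro: exI[of _ 1])
    then have "((\<lambda>t. C * t powr p) \<longlongrightarrow> 0) (at_right 0)" by simp
    moreover have "eventually (\<lambda>t. a \<le> C * t powr p) (at_right 0)"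
      unfolding eventually_at_right_field
    proof (intro exI[of _ 1] conjI allI impI)
      fix t :: real assume t: "0 < t" "t < 1"
      have "a \<le> f t" using f[OF t(1)] nn[OF t(1)] mult_nonneg_nonneg[OF b less_imp_le[OF t(1)]] by linarith
      then show "a \<le> C * t powr p" using van[of t] t by simp
    qed simp
    ultimately show "a \<le> 0" by (intro tendsto_lowerbound) auto
  qed
  show b0: "b = 0"
  proof (rule ccontr)
    assume "b \<noteq> 0"
    then have b: "0 < b" using b by simp
    have "b * (2 / b) \<le> f (2 / b)" using f[of "2 / b"] nn[of "2 / b"] a b by simp
    then show False using le[of "2 / b"] b by simp
  qed
  show eq: "(\<integral>\<^sup>+s. ennreal (t / (s + t)) \<partial>\<mu>) = ennreal (f t)" if "0 < t" for t
  proof -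
    have "(\<integral>\<^sup>+s. ennreal (t / (s + t)) \<partial>\<mu>) = ennreal (\<integral>s. t / (s + t) \<partial>\<mu>)"
      by (rule nn_integral_eq_integral[OF int[OF that]], rule AE_I2) (use sp that in simp)
    then show ?thesis using f[OF that] a0 b0 by simp
  qed
  have "emeasure \<mu> (space \<mu>) = (\<integral>\<^sup>+s. 1 \<partial>\<mu>)" by simp
  also have "\<dots> = (\<integral>\<^sup>+s. liminf (\<lambda>n. ennreal (real (Suc n) / (s + real (Suc n)))) \<partial>\<mu>)"
  proof (rule nn_integral_cong)
    fix s assume "s \<in> space \<mu>"
    have "(\<lambda>n. real (Suc n) / (s + real (Suc n))) \<longlonglongrightarrow> 1"
    proof -
      have "(\<lambda>n. 1 / (1 + s * inverse (real (Suc n)))) \<longlonglongrightarrow> 1 / (1 + s * 0)"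
        by (intro tendsto_intros LIMSEQ_inverse_real_of_nat) auto
      also have "(\<lambda>n. 1 / (1 + s * inverse (real (Suc n)))) = (\<lambda>n. real (Suc n) / (s + real (Suc n)))"
        by (simp add: fun_eq_iff field_simps del: of_nat_Suc)
      finally show ?thesis by simp
    qed
    then have "(\<lambda>n. ennreal (real (Suc n) / (s + real (Suc n)))) \<longlonglongrightarrow> ennreal 1" by (rule tendsto_ennrealI)
    then show "1 = liminf (\<lambda>n. ennreal (real (Suc n) / (s + real (Suc n))))"
      using lim_imp_Liminf[OF sequentially_bot] by fastforce
  qed
  also have "\<dots> \<le> liminf (\<lambda>n. \<integral>\<^sup>+s. ennreal (real (Suc n) / (s + real (Suc n))) \<partial>\<mu>)"
    by (rule nn_integral_liminf) (use int in auto)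
  also have "\<dots> \<le> liminf (\<lambda>n. 1)"
  proof (rule Liminf_mono, rule always_eventually, rule allI)
    fix n
    show "(\<integral>\<^sup>+s. ennreal (real (Suc n) / (s + real (Suc n))) \<partial>\<mu>) \<le> 1"
      using eq[of "real (Suc n)"] le[of "real (Suc n)"] by (simp add: ennreal_le_1 del: of_nat_Suc)
  qed
  also have "\<dots> = 1" by (simp add: Liminf_const)
  finally show "emeasure \<mu> (space \<mu>) \<le> 1" .
qed

section \<open>Integrals of powers\<close>

abbreviation lborel_pos :: "real measure"
  where "lborel_pos \<equiv> restrict_space lborel {0<..}"

lemma sets_lborel_pos: "sets lborel_pos = sets (restrict_space borel {0<..})"
  by (rule sets_restrict_space_cong) simp

lemma emeasure_lborel_pos_Icc: "0 < a \<Longrightarrow> emeasure lborel_pos {a..b} < \<infinity>"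
  by (subst emeasure_restrict_space) (auto simp: emeasure_lborel_Icc_eq)

lemma nn_integral_powr_div_le:
  fixes x \<theta> :: real
  assumes \<theta>: "0 < \<theta>" "\<theta> < 1" and x: "0 < x"
  shows "(\<integral>\<^sup>+t. ennreal (t powr (\<theta> - 1) / (t + x)) \<partial>lborel_pos) \<le> ennreal ((1 / \<theta> + 1 / (1 - \<theta>)) * x powr (\<theta> - 1))"
proof -
  let ?f = "\<lambda>t. ennreal (t powr (\<theta> - 1) / x) * indicator {0..x} t"
  let ?g = "\<lambda>t. ennreal (t powr (\<theta> - 2)) * indicator {x..} t"
  have "(\<integral>\<^sup>+t. ennreal (t powr (\<theta> - 1) / (t + x)) \<partial>lborel_pos)
      = (\<integral>\<^sup>+t. ennreal (t powr (\<theta> - 1) / (t + x)) * indicator {0<..} t \<partial>lborel)"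
    by (rule nn_integral_restrict_space) simp
  also have "\<dots> \<le> (\<integral>\<^sup>+t. ?f t + ?g t \<partial>lborel)"
  proof (rule nn_integral_mono)
    fix t :: real
    show "ennreal (t powr (\<theta> - 1) / (t + x)) * indicator {0<..} t \<le> ?f t + ?g t"
    proof (cases "0 < t")
      case True
      have "t powr (\<theta> - 1) / (t + x) \<le> t powr (\<theta> - 1) / x" using True x by (intro divide_left_mono) auto
      moreover have "t powr (\<theta> - 1) / (t + x) \<le> t powr (\<theta> - 2)"
      proof -
        have "t powr (\<theta> - 1) / (t + x) \<le> t powr (\<theta> - 1) / t" using True x by (intro divide_left_mono) auto
        also have "\<dots> = t powr (\<theta> - 2)" using True powr_diff[of t "\<theta> - 1" 1] by simp
        finally show ?thesis .
      qed
      ultimately show ?thesis using True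
        by (cases "t \<le> x") (auto intro!: ennreal_leI add_increasing2 simp: not_le)
    qed simp
  qed
  also have "\<dots> = (\<integral>\<^sup>+t. ?f t \<partial>lborel) + (\<integral>\<^sup>+t. ?g t \<partial>lborel)"
    by (rule nn_integral_add) auto
  also have "(\<integral>\<^sup>+t. ?f t \<partial>lborel) = ennreal (x powr (\<theta> - 1 + 1) / (\<theta> - 1 + 1) / x)"
    using has_integral_divide[OF has_integral_powr_from_0[of "\<theta> - 1" x], of x] \<theta> x
    by (intro nn_integral_has_integral_lebesgue') auto
  also have "(\<integral>\<^sup>+t. ?g t \<partial>lborel) = ennreal (- (x powr (\<theta> - 2 + 1)) / (\<theta> - 2 + 1))"
    using has_integral_powr_to_inf[of "\<theta> - 2" x] \<theta> x by (intro nn_integral_has_integral_lebesgue') auto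
  also have "x powr (\<theta> - 1 + 1) / (\<theta> - 1 + 1) / x = 1 / \<theta> * x powr (\<theta> - 1)"
    using x powr_diff[of x \<theta> 1] by simp
  also have "- (x powr (\<theta> - 2 + 1)) / (\<theta> - 2 + 1) = 1 / (1 - \<theta>) * x powr (\<theta> - 1)"
  proof -
    have "\<theta> - 2 + 1 = - (1 - \<theta>)" "\<theta> - 1 = - (1 - \<theta>)" by auto
    then show ?thesis by (simp only: minus_divide_divide mult_1_left times_divide_eq_left)
  qed
  also have "ennreal (1 / \<theta> * x powr (\<theta> - 1)) + ennreal (1 / (1 - \<theta>) * x powr (\<theta> - 1))
      = ennreal ((1 / \<theta> + 1 / (1 - \<theta>)) * x powr (\<theta> - 1))"
    using \<theta> by (subst ennreal_plus[symmetric]) (auto simp: distrib_right)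
  finally show ?thesis .
qed

text \<open>
  The integrand \<open>t / (s + t)\<close> is at least \<open>1/2\<close> for \<open>s \<le> t\<close>, whence \<open>\<mu> (0, t] \<le> 2 f(t) \<le> 2 C t\<^sup>p\<close>. Summing
  over the dyadic intervals \<open>(2\<^bsup>-k-1\<^esup>, 2\<^sup>-\<^sup>k]\<close> gives a geometric series of ratio \<open>2\<^bsup>-(p+e)\<^esup>\<close>.
\<close>

lemma negative_moment_finite:
  fixes \<mu> :: "real measure"
  assumes M: "sets \<mu> = sets (restrict_space borel {0<..})" and mass: "emeasure \<mu> (space \<mu>) < \<infinity>"
    and f: "\<And>t. 0 < t \<Longrightarrow> (\<integral>\<^sup>+s. ennreal (t / (s + t)) \<partial>\<mu>) = ennreal (f t)"
    and le: "\<And>t. 0 < t \<Longrightarrow> t \<le> 1 \<Longrightarrow> f t \<le> C * t powr p" and e: "e \<le> 0" "0 < p + e" and C: "0 \<le> C"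
  shows "(\<integral>\<^sup>+s. ennreal (s powr e) \<partial>\<mu>) < \<infinity>"
proof -
  have sp: "space \<mu> = {0<..}" by (rule space_pos[OF M])
  have sets_Ioc: "{0<..b} \<in> sets \<mu>" for b
    by (rule sets_pos[OF M]) auto
  let ?r = "\<lambda>k. (1 / 2 :: real) ^ k"
  have tail: "emeasure \<mu> {0<..t} \<le> ennreal (2 * f t)" if "0 < t" for t
  proof -
    have "emeasure \<mu> {0<..t} = (\<integral>\<^sup>+s. indicator {0<..t} s \<partial>\<mu>)" using sets_Ioc by simp
    also have "\<dots> \<le> (\<integral>\<^sup>+s. 2 * ennreal (t / (s + t)) \<partial>\<mu>)"
    proof (rule nn_integral_mono)
      fix s assume "s \<in> space \<mu>"
      then have s: "s > 0" by (simp add: sp)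
      have "1 \<le> 2 * ennreal (t / (s + t))" if "s \<le> t"
      proof -
        have "1 \<le> 2 * (t / (s + t))" using s that by (simp add: field_simps)
        then have "ennreal 1 \<le> ennreal (2 * (t / (s + t)))" by (rule ennreal_leI)
        also have "ennreal (2 * (t / (s + t))) = 2 * ennreal (t / (s + t))" by (subst ennreal_mult') auto
        finally show ?thesis by simp
      qed
      then show "indicator {0<..t} s \<le> 2 * ennreal (t / (s + t))" by (auto split: split_indicator)
    qed
    also have "\<dots> = 2 * (\<integral>\<^sup>+s. ennreal (t / (s + t)) \<partial>\<mu>)"
      by (rule nn_integral_cmult, rule borel_measurable_pos[OF M]) measurable
    also have "\<dots> = ennreal (2 * f t)" unfolding f[OF that] by (subst ennreal_mult') auto
    finally show ?thesis .
  qed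
  let ?h = "\<lambda>k s. ennreal (?r (Suc k) powr e) * indicator {0<..?r k} s"
  have pt: "ennreal (s powr e) \<le> 1 + (\<Sum>k. ?h k s)" if s: "0 < s" for s
  proof (cases "1 \<le> s")
    case True
    then have "s powr e \<le> 1" using powr_mono[of e 0 s] e(1) by simp
    then show ?thesis by (simp add: ennreal_le_1 add_increasing2)
  next
    case False
    have ex: "\<exists>k. ?r (Suc k) < s"
    proof -
      obtain k where "?r k < s" using real_arch_pow_inv[of s "1/2"] s by auto
      moreover have "?r (Suc k) \<le> ?r k" by simp
      ultimately show ?thesis using le_less_trans by blast
    qed
    then obtain k where k: "?r (Suc k) < s" "\<And>j. j < k \<Longrightarrow> \<not> ?r (Suc j) < s"
      using exists_least_iff[of "\<lambda>k. ?r (Suc k) < s"] by auto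
    have sk: "s \<le> ?r k" using k(2)[of "k - 1"] False by (cases k) auto
    have "s powr e \<le> ?r (Suc k) powr e" using k(1) e(1) by (intro powr_mono2') auto
    then have "ennreal (s powr e) \<le> ?h k s" using s sk by (simp add: ennreal_leI del: power_Suc)
    also have "\<dots> \<le> (\<Sum>k. ?h k s)"
      using sum_le_suminf[of "\<lambda>k. ?h k s" "{k}"]
      by (simp only: sum.insert sum.empty finite.intros empty_iff not_False_eq_True add_0_right summableI zero_le)
    finally show ?thesis by (simp add: add_increasing)
  qed
  define q where "q = (1 / 2 :: real) powr (p + e)"
  have q: "0 < q" "q < 1" using e(2) powr_less_mono2[of "p + e" "1/2" 1] by (auto simp: q_def)
  let ?a = "\<lambda>k. 2 * C * (1 / 2) powr e * q ^ k"
  have "(\<integral>\<^sup>+s. ennreal (s powr e) \<partial>\<mu>) \<le> (\<integral>\<^sup>+s. 1 + (\<Sum>k. ?h k s) \<partial>\<mu>)"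
    by (rule nn_integral_mono, rule pt) (simp add: sp)
  also have "\<dots> = (\<integral>\<^sup>+s. 1 \<partial>\<mu>) + (\<integral>\<^sup>+s. (\<Sum>k. ?h k s) \<partial>\<mu>)"
    by (rule nn_integral_add) (use sets_Ioc in measurable)
  also have "(\<integral>\<^sup>+s. (\<Sum>k. ?h k s) \<partial>\<mu>) = (\<Sum>k. \<integral>\<^sup>+s. ?h k s \<partial>\<mu>)"
    by (rule nn_integral_suminf) (use sets_Ioc in measurable)
  also have "\<dots> \<le> (\<Sum>k. ennreal (?a k))"
  proof (rule suminf_le)
    fix k
    have "(\<integral>\<^sup>+s. ?h k s \<partial>\<mu>) = ennreal (?r (Suc k) powr e) * emeasure \<mu> {0<..?r k}"
      by (rule nn_integral_cmult_indicator[OF sets_Ioc])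
    also have "\<dots> \<le> ennreal (?r (Suc k) powr e) * ennreal (2 * (C * ?r k powr p))"
      by (intro mult_left_mono order_trans[OF tail] ennreal_leI le) (auto simp: power_le_one)
    also have "\<dots> = ennreal (?r (Suc k) powr e * (2 * (C * ?r k powr p)))"
      by (subst ennreal_mult') auto
    also have "?r (Suc k) powr e * (2 * (C * ?r k powr p)) = ?a k"
    proof -
      have "?r (Suc k) powr e = (1 / 2) powr e * ?r k powr e" using powr_mult[of "1 / 2" "?r k" e] by simp
      moreover have "?r k powr e * ?r k powr p = q ^ k"
        unfolding powr_add[symmetric] q_def by (simp add: powr_realpow[symmetric] powr_powr mult.commute add.commute)
      ultimately show ?thesis by (simp add: mult_ac)
    qed
    finally show "(\<integral>\<^sup>+s. ?h k s \<partial>\<mu>) \<le> ennreal (?a k)" .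
  qed auto
  also have "\<dots> = ennreal (2 * C * (1 / 2) powr e * (1 / (1 - q)))"
    using q C by (intro suminf_ennreal_eq sums_mult geometric_sums) auto
  finally have "(\<integral>\<^sup>+s. ennreal (s powr e) \<partial>\<mu>) \<le> emeasure \<mu> (space \<mu>) + ennreal (2 * C * (1 / 2) powr e * (1 / (1 - q)))"
    by (simp add: add_left_mono)
  also have "\<dots> < \<infinity>" using mass by simp
  finally show ?thesis .
qed

section \<open>Estimates for resolvents\<close>

lemma scaleC_zero_left [simp]: "0 *\<^sub>C (x :: 'a::complex_banach) = 0"
  using scaleC_of_real[of 0 x] by simp

lemma scaleC_one [simp]: "1 *\<^sub>C (x :: 'a::complex_banach) = x"
  using scaleC_of_real[of 1 x] by simp

lemma scaleC_zero_right [simp]: "c *\<^sub>C (0 :: 'a::complex_banach) = 0"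
  using scaleC_add_right[of c 0 0] by simp

lemma scaleC_minus_right: "c *\<^sub>C (- x :: 'a::complex_banach) = - (c *\<^sub>C x)"
  using scaleC_add_right[of c x "- x"] by (simp add: eq_neg_iff_add_eq_0 add.commute)

lemma scaleC_minus_left: "(- c) *\<^sub>C (x :: 'a::complex_banach) = - (c *\<^sub>C x)"
  using scaleC_add_left[of c "- c" x] by (simp add: eq_neg_iff_add_eq_0 add.commute)

lemma scaleC_diff_right: "c *\<^sub>C (x - y :: 'a::complex_banach) = c *\<^sub>C x - c *\<^sub>C y"
  using scaleC_add_right[of c x "- y"] by (simp add: scaleC_minus_right)

lemma scaleC_diff_left: "(c - d) *\<^sub>C (x :: 'a::complex_banach) = c *\<^sub>C x - d *\<^sub>C x"
  using scaleC_add_left[of c "- d" x] by (simp add: scaleC_minus_left)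

lemma bounded_linear_scaleC: "bounded_linear (\<lambda>x :: 'a::complex_banach. c *\<^sub>C x)"
proof (rule bounded_linear_intro[where K = "cmod c"])
  fix r and x :: 'a
  show "c *\<^sub>C r *\<^sub>R x = r *\<^sub>R c *\<^sub>C x"
    unfolding scaleC_of_real[symmetric] scaleC_scaleC by (simp only: mult.commute)
qed (simp_all add: scaleC_add_right norm_scaleC mult.commute)

text \<open>
  The resolvents \<open>(z + A)\<^sup>-\<^sup>1\<close>, \<open>z \<noteq> 0\<close> in the closed right half-plane, considered by themselves; the
  last but one assumption is the Hille--Yosida type bound that holds for a bounded semigroup.
\<close>

locale resolvent_family =
  fixes R :: "complex \<Rightarrow> 'a::complex_banach \<Rightarrow> 'a" and M :: real
  assumes linear: "\<And>z. z \<noteq> 0 \<Longrightarrow> 0 \<le> Re z \<Longrightarrow> bounded_linear (R z)"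
    and scaleC: "\<And>z c x. z \<noteq> 0 \<Longrightarrow> 0 \<le> Re z \<Longrightarrow> R z (c *\<^sub>C x) = c *\<^sub>C R z x"
    and resolvent: "\<And>z w x. \<lbrakk>z \<noteq> 0; 0 \<le> Re z; w \<noteq> 0; 0 \<le> Re w\<rbrakk> \<Longrightarrow> R z x - R w x = (w - z) *\<^sub>C R z (R w x)"
    and bound: "\<And>z x. 0 < Re z \<Longrightarrow> norm (R z x) \<le> M / Re z * norm x"
    and M_nonneg: "0 \<le> M"
begin

text \<open>
  The operator \<open>A (s + A)\<^sup>-\<^sup>1\<close>, written without reference to \<open>A\<close>.
\<close>

definition Q :: "real \<Rightarrow> 'a \<Rightarrow> 'a" where "Q s x = x - s *\<^sub>R R (of_real s) x"

lemma commute: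
  assumes "z \<noteq> 0" "0 \<le> Re z" "w \<noteq> 0" "0 \<le> Re w"
  shows "R z (R w x) = R w (R z x)"
proof (cases "z = w")
  case False
  have "(w - z) *\<^sub>C R z (R w x) = (w - z) *\<^sub>C R w (R z x)"
    using resolvent[of z w x] resolvent[of w z x] assms by (metis minus_diff_eq scaleC_minus_left)
  then have "(1 / (w - z)) *\<^sub>C (w - z) *\<^sub>C R z (R w x) = (1 / (w - z)) *\<^sub>C (w - z) *\<^sub>C R w (R z x)" by simp
  then show ?thesis using False by (simp add: scaleC_scaleC)
qed simp

lemma bound_real: "0 < s \<Longrightarrow> norm (R (of_real s) x) \<le> M / s * norm x"
  using bound[of "of_real s" x] by simp

lemma linear_real: "0 < s \<Longrightarrow> bounded_linear (R (of_real s))" by (rule linear) auto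

lemma bounded_linear_Q: "0 < s \<Longrightarrow> bounded_linear (Q s)"
  unfolding Q_def[abs_def]
  by (intro bounded_linear_sub bounded_linear_ident bounded_linear_const_scaleR linear_real)

lemma norm_Q: assumes "0 < s" shows "norm (Q s x) \<le> (1 + M) * norm x"
proof -
  have "norm (Q s x) \<le> norm x + norm (s *\<^sub>R R (of_real s) x)" unfolding Q_def by (rule norm_triangle_ineq4)
  also have "norm (s *\<^sub>R R (of_real s) x) \<le> s * (M / s * norm x)"
    using assms by (simp add: mult_left_mono[OF bound_real] del: times_divide_eq_left)
  also have "\<dots> = M * norm x" using assms by simp
  finally show ?thesis by (simp add: algebra_simps)
qed

lemma R_diff: assumes "z \<noteq> 0" "0 \<le> Re z" shows "R z (x - y) = R z x - R z y"
  using linear[OF assms] by (rule linear_diff[OF bounded_linear.linear])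

lemma R_scaleR: assumes "z \<noteq> 0" "0 \<le> Re z" shows "R z (c *\<^sub>R x) = c *\<^sub>R R z x"
  using linear[OF assms] by (rule linear_scale[OF bounded_linear.linear])

lemma R_Q: assumes "z \<noteq> 0" "0 \<le> Re z" "0 < s"
  shows "R z (Q s x) = Q s (R z x)"
  unfolding Q_def using assms by (simp add: R_diff R_scaleR commute[of z "of_real s"])

text \<open>
  In operator terms \<open>(z + A)\<^sup>-\<^sup>1 A (s + A)\<^sup>-\<^sup>1 = A (z + A)\<^sup>-\<^sup>1 (s + A)\<^sup>-\<^sup>1\<close>: the factor \<open>A\<close> may be moved to either
  resolvent.
\<close>

lemma R_Q_swap: assumes "0 < s" "z \<noteq> 0" "0 \<le> Re z"
  shows "R z (Q s x) = R (of_real s) x - z *\<^sub>C R (of_real s) (R z x)"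
proof -
  have c: "R z (R (of_real s) x) = R (of_real s) (R z x)" using assms by (intro commute) auto
  have "R z x - R (of_real s) x = (of_real s - z) *\<^sub>C R z (R (of_real s) x)" using assms by (intro resolvent) auto
  also have "\<dots> = s *\<^sub>R R z (R (of_real s) x) - z *\<^sub>C R z (R (of_real s) x)"
    by (simp add: scaleC_diff_left scaleC_of_real)
  finally show ?thesis using assms by (simp add: Q_def R_diff R_scaleR c algebra_simps)
qed

lemma scaleC_R_Q: assumes "0 < s" "z \<noteq> 0" "0 \<le> Re z"
  shows "(of_real s - z) *\<^sub>C R z (Q s x) = s *\<^sub>R R (of_real s) x - z *\<^sub>C R z x"
proof -
  let ?y = "R z (R (of_real s) x)"
  have e: "(of_real s - z) *\<^sub>C ?y = R z x - R (of_real s) x"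
    using assms by (intro resolvent[symmetric]) auto
  have "(of_real s - z) *\<^sub>C R z (Q s x) = (of_real s - z) *\<^sub>C R z x - (of_real s - z) *\<^sub>C s *\<^sub>R ?y"
    using assms by (simp add: Q_def R_diff R_scaleR scaleC_diff_right)
  also have "(of_real s - z) *\<^sub>C s *\<^sub>R ?y = s *\<^sub>R (R z x - R (of_real s) x)"
    unfolding e[symmetric] using linear_scale[OF bounded_linear.linear[OF bounded_linear_scaleC]] by blast
  finally show ?thesis by (simp add: scaleC_diff_left scaleC_of_real algebra_simps)
qed

text \<open>
  The central estimate: \<open>s\<close> is real and \<open>z = i\<tau>\<close> is imaginary, so the factor \<open>s - z\<close> in the preceding
  identity is bounded below by \<open>(s + \<bar>\<tau>\<bar>) / 2\<close> and can be divided out.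
\<close>

lemma norm_R_Q_imaginary_le:
  assumes s: "0 < s" and \<tau>: "\<tau> \<noteq> 0"
  shows "norm (R (\<i> * of_real \<tau>) (Q s x)) \<le> 2 / (s + \<bar>\<tau>\<bar>) *
    (\<bar>\<tau>\<bar> * norm (R (\<i> * of_real \<tau>) x) + s * norm (R (of_real s) x))"
proof -
  let ?z = "\<i> * of_real \<tau>" and ?N = "norm (R (\<i> * of_real \<tau>) (Q s x))"
  have "\<bar>Re (of_real s - ?z)\<bar> \<le> cmod (of_real s - ?z)" "\<bar>Im (of_real s - ?z)\<bar> \<le> cmod (of_real s - ?z)"
    by (rule abs_Re_le_cmod abs_Im_le_cmod)+
  then have "(s + \<bar>\<tau>\<bar>) / 2 * ?N \<le> cmod (of_real s - ?z) * ?N"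
    using s by (intro mult_right_mono) auto
  also have "\<dots> = norm (s *\<^sub>R R (of_real s) x - ?z *\<^sub>C R ?z x)"
    using scaleC_R_Q[of s ?z x] s \<tau> by (simp add: norm_scaleC[symmetric])
  also have "\<dots> \<le> norm (s *\<^sub>R R (of_real s) x) + norm (?z *\<^sub>C R ?z x)" by (rule norm_triangle_ineq4)
  also have "\<dots> = \<bar>\<tau>\<bar> * norm (R ?z x) + s * norm (R (of_real s) x)"
    using s by (simp add: norm_scaleC norm_mult)
  finally have "?N * (s + \<bar>\<tau>\<bar>) \<le> 2 * (\<bar>\<tau>\<bar> * norm (R ?z x) + s * norm (R (of_real s) x))" by (simp add: algebra_simps)
  then have "?N \<le> 2 * (\<bar>\<tau>\<bar> * norm (R ?z x) + s * norm (R (of_real s) x)) / (s + \<bar>\<tau>\<bar>)"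
    using s by (subst pos_le_divide_eq) auto
  then show ?thesis by simp
qed

text \<open>
  For two real points \<open>s - r\<close> may vanish. Instead, moving \<open>A\<close> to either resolvent gives the bounds
  \<open>C / r\<close> and \<open>C / s\<close>, and the smaller of them is at most \<open>2 C / (s + r)\<close>.
\<close>

lemma norm_R_Q_real_le:
  assumes s: "0 < s" and r: "0 < r"
  shows "norm (R (of_real r) (Q s x)) \<le> 2 * M * (1 + M) / (s + r) * norm x"
proof -
  let ?N = "norm (R (of_real r) (Q s x))"
  have "?N \<le> M / r * ((1 + M) * norm x)"
    by (rule order_trans[OF bound_real[OF r] mult_left_mono[OF norm_Q[OF s]]]) (use M_nonneg r in auto)
  then have 1: "r * ?N \<le> M * (1 + M) * norm x" using r by (simp add: field_simps)
  have "R (of_real r) (Q s x) = Q r (R (of_real s) x)"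
    using R_Q_swap[of s "of_real r" x] s r commute[of "of_real r" "of_real s" x]
    by (simp add: Q_def scaleC_of_real R_diff R_scaleR)
  then have "?N \<le> (1 + M) * (M / s * norm x)"
    using order_trans[OF norm_Q[OF r] mult_left_mono[OF bound_real[OF s]], of "R (of_real s) x"]
      norm_Q[OF r, of "R (of_real s) x"] mult_left_mono[OF bound_real[OF s, of x], of "1 + M"] M_nonneg by simp
  then have 2: "s * ?N \<le> M * (1 + M) * norm x" using s by (simp add: field_simps)
  have "?N * (s + r) \<le> 2 * M * (1 + M) * norm x" using 1 2 by (simp add: algebra_simps)
  then have "?N \<le> 2 * M * (1 + M) * norm x / (s + r)" using s r by (subst pos_le_divide_eq) auto
  then show ?thesis by simp
qed

lemma continuous_on_Q: "continuous_on {0<..} (\<lambda>s. Q s x)"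
proof -
  have "continuous_on {0<..} (\<lambda>s. R (complex_of_real s) x)"
    unfolding continuous_on_def
  proof (intro ballI)
    fix s :: real assume "s \<in> {0<..}"
    then have s: "0 < s" by simp
    have "((\<lambda>r. R (of_real r) x - R (of_real s) x) \<longlongrightarrow> 0) (at s within {0<..})"
    proof (rule Lim_null_comparison)
      show "((\<lambda>r. \<bar>s - r\<bar> * (M / r * (M / s * norm x))) \<longlongrightarrow> 0) (at s within {0<..})"
      proof -
        have "((\<lambda>r. \<bar>s - r\<bar> * (M / r * (M / s * norm x))) \<longlongrightarrow> \<bar>s - s\<bar> * (M / s * (M / s * norm x))) (at s within {0<..})"
          using s by (intro tendsto_intros) auto
        then show ?thesis by simp
      qed
      show "eventually (\<lambda>r. norm (R (of_real r) x - R (of_real s) x) \<le> \<bar>s - r\<bar> * (M / r * (M / s * norm x))) (at s within {0<..})"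
        unfolding eventually_at_filter
      proof (intro always_eventually allI impI)
        fix r :: real assume "r \<in> {0<..}"
        then have r: "0 < r" by simp
        have "norm (R (of_real r) x - R (of_real s) x) = \<bar>s - r\<bar> * norm (R (of_real r) (R (of_real s) x))"
          using r s by (subst resolvent) (auto simp: norm_scaleC simp flip: of_real_diff)
        also have "\<dots> \<le> \<bar>s - r\<bar> * (M / r * (M / s * norm x))"
          using r s M_nonneg
          by (intro mult_left_mono order_trans[OF bound_real[OF r]] bound_real) auto
        finally show "norm (R (of_real r) x - R (of_real s) x) \<le> \<bar>s - r\<bar> * (M / r * (M / s * norm x))" .
      qed
    qed
    then show "((\<lambda>r. R (of_real r) x) \<longlongrightarrow> R (of_real s) x) (at s within {0<..})"
      by (rule LIM_zero_cancel)
  qed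
  then show ?thesis unfolding Q_def by (intro continuous_intros)
qed

text \<open>
  Both \<open>f(A)\<close> and the fractional powers of \<open>B\<close> are averages \<open>\<integral> k(t) Q(\<phi>(t)) d\<mu>(t)\<close>. Their properties
  used below are collected here once: boundedness, commutation with every bounded operator that commutes
  with all \<open>Q(s)\<close>, and norm estimates under the integral sign.
\<close>

lemma weighted_average:
  fixes \<mu> :: "real measure" and k \<phi> :: "real \<Rightarrow> real"
  assumes \<mu>: "sets \<mu> = sets (restrict_space borel {0<..})" "\<And>a b. 0 < a \<Longrightarrow> emeasure \<mu> {a..b} < \<infinity>"
    and k: "continuous_on {0<..} k" "k \<in> borel_measurable borel" "\<And>t. 0 < t \<Longrightarrow> 0 \<le> k t" "(\<integral>\<^sup>+t. ennreal (k t) \<partial>\<mu>) < \<infinity>"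
    and \<phi>: "continuous_on {0<..} \<phi>" "\<And>t. 0 < t \<Longrightarrow> 0 < \<phi> t"
  obtains I where "bounded_linear I" "\<And>x. has_bochner \<mu> (\<lambda>t. k t *\<^sub>R Q (\<phi> t) x) (I x)"
    "\<And>L x. bounded_linear L \<Longrightarrow> (\<And>s x. 0 < s \<Longrightarrow> L (Q s x) = Q s (L x)) \<Longrightarrow> L (I x) = I (L x)"
    "\<And>(L :: 'a \<Rightarrow> 'a) h x. bounded_linear L \<Longrightarrow> h \<in> borel_measurable \<mu> \<Longrightarrow> (\<And>t. 0 < t \<Longrightarrow> ennreal (norm (k t *\<^sub>R L (Q (\<phi> t) x))) \<le> h t)
      \<Longrightarrow> ennreal (norm (L (I x))) \<le> (\<integral>\<^sup>+t. h t \<partial>\<mu>)"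
proof -
  have sp: "space \<mu> = {0<..}" by (rule space_pos[OF \<mu>(1)])
  have km: "(\<lambda>t. ennreal (k t)) \<in> borel_measurable \<mu>"
    using borel_measurable_pos[OF \<mu>(1) k(2)] by measurable
  have nb: "norm (k t *\<^sub>R Q (\<phi> t) x) \<le> k t * ((1 + M) * norm x)" if "0 < t" for t x
    using k(3)[OF that] norm_Q[OF \<phi>(2)[OF that], of x] by (simp add: mult_left_mono)
  have nb': "ennreal (norm (k t *\<^sub>R Q (\<phi> t) x)) \<le> ennreal (k t) * ennreal ((1 + M) * norm x)" if "0 < t" for t x
    using nb[OF that, of x] k(3)[OF that] M_nonneg by (subst ennreal_mult[symmetric]) (auto intro: ennreal_leI)
  have ni: "(\<integral>\<^sup>+t. ennreal (k t) * ennreal ((1 + M) * norm x) \<partial>\<mu>) = (\<integral>\<^sup>+t. ennreal (k t) \<partial>\<mu>) * ennreal ((1 + M) * norm x)" for x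
    by (rule nn_integral_multc[OF km])
  have "\<exists>y. has_bochner \<mu> (\<lambda>t. k t *\<^sub>R Q (\<phi> t) x) y" for x
  proof (rule has_bochner_exists_continuous[OF \<mu>])
    show "continuous_on {0<..} (\<lambda>t. k t *\<^sub>R Q (\<phi> t) x)"
      by (intro continuous_on_scaleR k(1) continuous_on_compose2[OF continuous_on_Q \<phi>(1)]) (use \<phi>(2) in auto)
    show "(\<lambda>t. ennreal (k t) * ennreal ((1 + M) * norm x)) \<in> borel_measurable \<mu>" using km by measurable
    show "(\<integral>\<^sup>+t. ennreal (k t) * ennreal ((1 + M) * norm x) \<partial>\<mu>) < \<infinity>"
      unfolding ni using k(4) by (simp add: ennreal_mult_less_top)
  qed (assumption, rule nb')
  then obtain I where I: "\<And>x. has_bochner \<mu> (\<lambda>t. k t *\<^sub>R Q (\<phi> t) x) (I x)" by metis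
  have diff: "I (x - y) = I x - I y" for x y
  proof (rule has_bochner_unique[OF I])
    have "has_bochner \<mu> (\<lambda>t. k t *\<^sub>R Q (\<phi> t) x - k t *\<^sub>R Q (\<phi> t) y) (I x - I y)" by (rule has_bochner_diff[OF I I])
    also have "?this \<longleftrightarrow> has_bochner \<mu> (\<lambda>t. k t *\<^sub>R Q (\<phi> t) (x - y)) (I x - I y)"
      by (rule has_bochner_cong)
        (simp add: sp linear_diff[OF bounded_linear.linear[OF bounded_linear_Q[OF \<phi>(2)]]] scaleR_diff_right)
    finally show "has_bochner \<mu> (\<lambda>t. k t *\<^sub>R Q (\<phi> t) (x - y)) (I x - I y)" .
  qed
  have com: "L (I x) = I (L x)" if L: "bounded_linear L" "\<And>s x. 0 < s \<Longrightarrow> L (Q s x) = Q s (L x)" for L x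
  proof (rule has_bochner_unique)
    have "has_bochner \<mu> (\<lambda>t. L (k t *\<^sub>R Q (\<phi> t) x)) (L (I x))" by (rule has_bochner_bounded_linear[OF L(1) I])
    also have "?this \<longleftrightarrow> has_bochner \<mu> (\<lambda>t. k t *\<^sub>R Q (\<phi> t) (L x)) (L (I x))"
      by (rule has_bochner_cong) (simp add: sp L(2) \<phi>(2) linear_scale[OF bounded_linear.linear[OF L(1)]])
    finally show "has_bochner \<mu> (\<lambda>t. k t *\<^sub>R Q (\<phi> t) (L x)) (L (I x))" .
  qed (rule I)
  have scale: "I (c *\<^sub>R x) = c *\<^sub>R I x" for c x
    by (rule com[symmetric, of "\<lambda>x. c *\<^sub>R x"])
      (auto intro: bounded_linear_scaleR_right simp: linear_scale[OF bounded_linear.linear[OF bounded_linear_Q]])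
  have add: "I (x + y) = I x + I y" for x y
    using diff[of x "(- 1) *\<^sub>R y"] scale[of "- 1" y] by simp
  show thesis
  proof (rule that[OF _ I com])
    show "bounded_linear I"
    proof (rule bounded_linear_intro[where K = "enn2real (\<integral>\<^sup>+t. ennreal (k t) \<partial>\<mu>) * (1 + M)"])
      fix x
      have "ennreal (norm (I x)) \<le> (\<integral>\<^sup>+t. ennreal (k t) * ennreal ((1 + M) * norm x) \<partial>\<mu>)"
        by (rule has_bochner_norm_le[OF I]) (use km nb' in \<open>auto intro!: AE_I2 simp: sp\<close>)
      also have "\<dots> = ennreal (enn2real (\<integral>\<^sup>+t. ennreal (k t) \<partial>\<mu>)) * ennreal ((1 + M) * norm x)"
        unfolding ni using k(4) by simp
      also have "\<dots> = ennreal (enn2real (\<integral>\<^sup>+t. ennreal (k t) \<partial>\<mu>) * ((1 + M) * norm x))"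
        using M_nonneg by (subst ennreal_mult) auto
      finally show "norm (I x) \<le> norm x * (enn2real (\<integral>\<^sup>+t. ennreal (k t) \<partial>\<mu>) * (1 + M))"
        using M_nonneg by (subst (asm) ennreal_le_iff) (auto simp: mult_ac)
    qed (rule add scale)+
    show "ennreal (norm (L (I x))) \<le> (\<integral>\<^sup>+t. h t \<partial>\<mu>)"
      if L: "bounded_linear L" "h \<in> borel_measurable \<mu>" "\<And>t. 0 < t \<Longrightarrow> ennreal (norm (k t *\<^sub>R L (Q (\<phi> t) x))) \<le> h t" for L :: "'a \<Rightarrow> 'a" and h x
      by (rule has_bochner_norm_le[OF has_bochner_bounded_linear[OF L(1) I] L(2)])
        (use L(3) in \<open>auto intro!: AE_I2 simp: sp linear_scale[OF bounded_linear.linear[OF L(1)]]\<close>)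
  qed
qed

lemma norm_iterate_Q1: "norm ((Q 1 ^^ n) x) \<le> (1 + M) ^ n * norm x"
proof (induction n)
  case (Suc n)
  have "norm ((Q 1 ^^ Suc n) x) \<le> (1 + M) * norm ((Q 1 ^^ n) x)" using norm_Q[of 1] by simp
  also have "\<dots> \<le> (1 + M) * ((1 + M) ^ n * norm x)" using Suc M_nonneg by (intro mult_left_mono) auto
  finally show ?case by simp
qed simp

lemma bounded_linear_iterate_Q1: "bounded_linear (Q 1 ^^ n)"
proof (induction n)
  case (Suc n)
  then show ?case using bounded_linear_compose[OF bounded_linear_Q[of 1]] by (simp add: o_def)
qed (simp add: id_def)

text \<open>
  Each factor \<open>Q(1)\<close> in front of \<open>Y\<close> improves a bound \<open>b\<close> for \<open>R(z) Y\<close> to \<open>C (1 + \<bar>z\<bar> b)\<close>, by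
  \<open>R(z) Q(1) = R(1) - z R(1) R(z)\<close>. Without such factors the summand \<open>1\<close> is absent, which is
  essential for exponents \<open>\<gamma> < 1\<close>.
\<close>

lemma norm_R_iterate_Q1_le:
  assumes Y: "\<And>x. norm (Y x) \<le> y * norm x" and y: "0 \<le> y"
  shows "\<exists>K\<ge>0. \<forall>z b x. z \<noteq> 0 \<and> 0 \<le> Re z \<and> cmod z \<le> 1 \<and> 0 \<le> b \<and> (\<forall>x. norm (R z (Y x)) \<le> b * norm x) \<longrightarrow>
    norm (R z ((Q 1 ^^ n) (Y x))) \<le> K * ((if n = 0 then 0 else 1) + cmod z ^ n * b) * norm x"
proof (induction n)
  case 0
  then show ?case by (intro exI[of _ 1]) auto
next
  case (Suc n)
  then obtain K where K: "0 \<le> K" "\<And>z b x. \<lbrakk>z \<noteq> 0; 0 \<le> Re z; cmod z \<le> 1; 0 \<le> b; \<And>x. norm (R z (Y x)) \<le> b * norm x\<rbrakk> \<Longrightarrow>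
    norm (R z ((Q 1 ^^ n) (Y x))) \<le> K * ((if n = 0 then 0 else 1) + cmod z ^ n * b) * norm x" by blast
  define K' where "K' = M * ((1 + M) ^ n * y) + M * K"
  have K'0: "0 \<le> K'" unfolding K'_def using M_nonneg K(1) y by simp
  have "norm (R z ((Q 1 ^^ Suc n) (Y x))) \<le> K' * ((if Suc n = 0 then 0 else 1) + cmod z ^ Suc n * b) * norm x"
    if z: "z \<noteq> 0" "0 \<le> Re z" "cmod z \<le> 1" "0 \<le> b" "\<And>x. norm (R z (Y x)) \<le> b * norm x" for z b x
  proof -
    let ?v = "(Q 1 ^^ n) (Y x)"
    have v: "norm ?v \<le> (1 + M) ^ n * y * norm x"
      using order_trans[OF norm_iterate_Q1 mult_left_mono[OF Y]] M_nonneg by (simp add: mult.assoc)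
    have c: "cmod z * ((if n = 0 then 0 else 1) + cmod z ^ n * b) \<le> 1 + cmod z ^ Suc n * b"
      using z(3) by (auto simp: distrib_left)
    have "R z ((Q 1 ^^ Suc n) (Y x)) = R 1 ?v - z *\<^sub>C R 1 (R z ?v)"
      using R_Q_swap[of 1 z ?v] z by simp
    then have "norm (R z ((Q 1 ^^ Suc n) (Y x))) \<le> norm (R 1 ?v) + cmod z * norm (R 1 (R z ?v))"
      using norm_triangle_ineq4[of "R 1 ?v" "z *\<^sub>C R 1 (R z ?v)"] by (simp add: norm_scaleC)
    also have "\<dots> \<le> M * norm ?v + cmod z * (M * norm (R z ?v))"
      using bound[of 1] by (intro add_mono mult_left_mono) auto
    also have "\<dots> \<le> M * ((1 + M) ^ n * y * norm x) + cmod z * (M * (K * ((if n = 0 then 0 else 1) + cmod z ^ n * b) * norm x))"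
      by (intro add_mono mult_left_mono v K(2) z M_nonneg norm_ge_zero)
    also have "\<dots> = (M * ((1 + M) ^ n * y) + M * K * (cmod z * ((if n = 0 then 0 else 1) + cmod z ^ n * b))) * norm x"
      by (simp add: algebra_simps)
    also have "\<dots> \<le> (M * ((1 + M) ^ n * y) * (1 + cmod z ^ Suc n * b) + M * K * (1 + cmod z ^ Suc n * b)) * norm x"
    proof (intro mult_right_mono add_mono mult_left_mono c)
      show "M * ((1 + M) ^ n * y) \<le> M * ((1 + M) ^ n * y) * (1 + cmod z ^ Suc n * b)"
        using mult_left_mono[of 1 "1 + cmod z ^ Suc n * b" "M * ((1 + M) ^ n * y)"] M_nonneg y z(4) by simp
    qed (use M_nonneg K(1) in auto)
    finally show ?thesis by (simp add: K'_def distrib_right)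
  qed
  then show ?case using K'0 by blast
qed

lemma norm_R_Q1_real_le: assumes "0 < s" shows "norm (R (of_real s) (Q 1 x)) \<le> (1 + M) * M * norm x"
proof -
  have "R (of_real s) (Q 1 x) = Q s (R 1 x)"
    using R_Q_swap[of 1 "of_real s" x] assms commute[of "of_real s" 1 x]
    by (simp add: Q_def scaleC_of_real)
  then have "norm (R (of_real s) (Q 1 x)) \<le> (1 + M) * norm (R 1 x)" using norm_Q[OF assms] by simp
  also have "\<dots> \<le> (1 + M) * (M * norm x)" using bound[of 1 x] M_nonneg by (intro mult_left_mono) auto
  finally show ?thesis by (simp add: mult_ac)
qed

text \<open>
  Substituting \<open>s = t / (1 + t)\<close>, as Balakrishnan's formula for \<open>B\<close> demands, does not spoil the decay of
  the integrand: \<open>(1 + t) (s + c) \<ge> t + c\<close>.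
\<close>

lemma frac_weight:
  fixes \<theta> c t :: real
  assumes \<theta>: "0 < \<theta>" "\<theta> < 1" and c: "0 < c" "0 < t"
  shows "t powr (\<theta> - 1) / (1 + t) * (1 / (t / (1 + t) + c)) \<le> t powr (\<theta> - 1) / (t + c)"
proof -
  have "1 + t \<noteq> 0" using c by linarith
  then have "(1 + t) * (t / (1 + t)) = t" by simp
  then have "(1 + t) * (t / (1 + t) + c) = t + c + c * t" by (simp add: distrib_left distrib_right)
  then have "t + c \<le> (1 + t) * (t / (1 + t) + c)" using c by simp
  then have "t powr (\<theta> - 1) / ((1 + t) * (t / (1 + t) + c)) \<le> t powr (\<theta> - 1) / (t + c)"
    using c by (intro divide_left_mono mult_pos_pos add_pos_pos) auto
  then show ?thesis by simp
qed

text \<open>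
  Up to the constant \<open>sin(\<pi>\<theta>)/\<pi>\<close>, the operator \<open>I\<close> is \<open>B\<^sup>\<theta>\<close>. Both estimates insert a bound of the form
  \<open>a / (s + c)\<close> for \<open>R(z) Q(s)\<close> and use \<open>\<integral> t\<^bsup>\<theta>-1\<^esup> / (t + c) dt \<le> C c\<^bsup>\<theta>-1\<^esup>\<close>.
\<close>

lemma Balakrishnan_average:
  assumes \<theta>: "0 < \<theta>" "\<theta> < 1"
  obtains I K where "bounded_linear I" "0 \<le> K"
    "\<And>x. has_bochner lborel_pos (\<lambda>t. (t powr (\<theta> - 1) / (1 + t)) *\<^sub>R Q (t / (1 + t)) x) (I x)"
    "\<And>L x. bounded_linear L \<Longrightarrow> (\<And>s x. 0 < s \<Longrightarrow> L (Q s x) = Q s (L x)) \<Longrightarrow> L (I x) = I (L x)"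
    "\<And>\<tau> N x. \<tau> \<noteq> 0 \<Longrightarrow> 0 \<le> N \<Longrightarrow> (\<And>x. norm (R (\<i> * of_real \<tau>) x) \<le> N * norm x) \<Longrightarrow>
      norm (R (\<i> * of_real \<tau>) (I x)) \<le> K * (\<bar>\<tau>\<bar> powr \<theta> * N + \<bar>\<tau>\<bar> powr (\<theta> - 1)) * norm x"
    "\<And>s x. 0 < s \<Longrightarrow> norm (R (of_real s) (I x)) \<le> K * s powr (\<theta> - 1) * norm x"
proof -
  let ?k = "\<lambda>t::real. t powr (\<theta> - 1) / (1 + t)" and ?\<phi> = "\<lambda>t::real. t / (1 + t)"
  define c where "c = 1 / \<theta> + 1 / (1 - \<theta>)"
  have c: "0 \<le> c" using \<theta> by (simp add: c_def)
  have kint: "(\<integral>\<^sup>+t. ennreal (?k t) \<partial>lborel_pos) < \<infinity>"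
    using nn_integral_powr_div_le[OF \<theta>, of 1] by (simp add: add.commute le_less_trans)
  have kc: "continuous_on {0<..} ?k" "continuous_on {0<..} ?\<phi>"
    by (intro continuous_intros; force)+
  have km: "?k \<in> borel_measurable borel" by measurable
  have hm: "(\<lambda>t. ennreal a * ennreal (t powr (\<theta> - 1) / (t + b))) \<in> borel_measurable lborel_pos" for a b :: real
    by (rule borel_measurable_pos[OF sets_lborel_pos]) measurable
  have hint: "(\<integral>\<^sup>+t. ennreal a * ennreal (t powr (\<theta> - 1) / (t + b)) \<partial>lborel_pos) \<le> ennreal (a * (c * b powr (\<theta> - 1)))"
    if "0 \<le> a" "0 < b" for a b
  proof -
    have "(\<integral>\<^sup>+t. ennreal a * ennreal (t powr (\<theta> - 1) / (t + b)) \<partial>lborel_pos)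
      = ennreal a * (\<integral>\<^sup>+t. ennreal (t powr (\<theta> - 1) / (t + b)) \<partial>lborel_pos)"
      by (rule nn_integral_cmult, rule borel_measurable_pos[OF sets_lborel_pos]) measurable
    also have "\<dots> \<le> ennreal a * ennreal (c * b powr (\<theta> - 1))"
      unfolding c_def by (intro mult_left_mono nn_integral_powr_div_le \<theta> that(2)) simp
    also have "\<dots> = ennreal (a * (c * b powr (\<theta> - 1)))" using that c by (subst ennreal_mult) auto
    finally show ?thesis .
  qed
  obtain I where I: "bounded_linear I" "\<And>x. has_bochner lborel_pos (\<lambda>t. ?k t *\<^sub>R Q (?\<phi> t) x) (I x)"
    "\<And>L x. bounded_linear L \<Longrightarrow> (\<And>s x. 0 < s \<Longrightarrow> L (Q s x) = Q s (L x)) \<Longrightarrow> L (I x) = I (L x)"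
    "\<And>(L :: 'a \<Rightarrow> 'a) h x. bounded_linear L \<Longrightarrow> h \<in> borel_measurable lborel_pos \<Longrightarrow> (\<And>t. 0 < t \<Longrightarrow> ennreal (norm (?k t *\<^sub>R L (Q (?\<phi> t) x))) \<le> h t)
      \<Longrightarrow> ennreal (norm (L (I x))) \<le> (\<integral>\<^sup>+t. h t \<partial>lborel_pos)"
    using weighted_average[OF sets_lborel_pos emeasure_lborel_pos_Icc kc(1) km _ kint kc(2)] by (auto simp: divide_nonneg_pos)
  have avg: "norm (L (I x)) \<le> a * (c * b powr (\<theta> - 1))"
    if L: "bounded_linear L" and a: "0 \<le> a" and b: "0 < b" and le: "\<And>s. 0 < s \<Longrightarrow> norm (L (Q s x)) \<le> a * (1 / (s + b))" for L :: "'a \<Rightarrow> 'a" and a b x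
  proof -
    have "ennreal (norm (L (I x))) \<le> (\<integral>\<^sup>+t. ennreal a * ennreal (t powr (\<theta> - 1) / (t + b)) \<partial>lborel_pos)"
    proof (rule I(4)[OF L hm])
      fix t :: real assume t: "0 < t"
      have "norm (?k t *\<^sub>R L (Q (?\<phi> t) x)) = ?k t * norm (L (Q (?\<phi> t) x))" using t by simp
      also have "\<dots> \<le> ?k t * (a * (1 / (?\<phi> t + b)))" using t by (intro mult_left_mono le) auto
      also have "\<dots> = a * (?k t * (1 / (?\<phi> t + b)))" by (simp only: mult_ac)
      also have "\<dots> \<le> a * (t powr (\<theta> - 1) / (t + b))" by (intro mult_left_mono frac_weight \<theta> a b t)
      finally show "ennreal (norm (?k t *\<^sub>R L (Q (?\<phi> t) x))) \<le> ennreal a * ennreal (t powr (\<theta> - 1) / (t + b))"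
        using a by (simp add: ennreal_mult'[symmetric] ennreal_leI)
    qed
    also have "\<dots> \<le> ennreal (a * (c * b powr (\<theta> - 1)))" by (rule hint[OF a b])
    finally show ?thesis using a c by (subst (asm) ennreal_le_iff) auto
  qed
  define K where "K = 2 * c * (1 + M) + 2 * M * (1 + M) * c"
  have K1: "2 * c \<le> K" "2 * c * M \<le> K" "2 * M * (1 + M) * c \<le> K"
    unfolding K_def using c M_nonneg by (auto simp: algebra_simps)
  show ?thesis
  proof (rule that[OF I(1) _ I(2) I(3)])
    show "0 \<le> K" using K1(1) c by simp
    show "norm (R (of_real s) (I x)) \<le> K * s powr (\<theta> - 1) * norm x" if s: "0 < s" for s x
    proof -
      have "norm (R (of_real s) (I x)) \<le> (2 * M * (1 + M) * norm x) * (c * s powr (\<theta> - 1))"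
        by (rule avg[OF linear_real[OF s] _ s]) (use M_nonneg norm_R_Q_real_le[OF _ s, of _ x] in auto)
      also have "\<dots> = 2 * M * (1 + M) * c * s powr (\<theta> - 1) * norm x" by (simp add: mult_ac)
      also have "\<dots> \<le> K * s powr (\<theta> - 1) * norm x" by (intro mult_right_mono K1) auto
      finally show ?thesis .
    qed
    show "norm (R (\<i> * of_real \<tau>) (I x)) \<le> K * (\<bar>\<tau>\<bar> powr \<theta> * N + \<bar>\<tau>\<bar> powr (\<theta> - 1)) * norm x"
      if \<tau>: "\<tau> \<noteq> 0" and N: "0 \<le> N" "\<And>x. norm (R (\<i> * of_real \<tau>) x) \<le> N * norm x" for \<tau> N x
    proof -
      have "norm (R (\<i> * of_real \<tau>) (I x)) \<le> (2 * (\<bar>\<tau>\<bar> * N + M) * norm x) * (c * \<bar>\<tau>\<bar> powr (\<theta> - 1))"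
      proof (rule avg)
        show "bounded_linear (R (\<i> * of_real \<tau>))" using \<tau> by (intro linear) auto
        fix s :: real assume s: "0 < s"
        have "norm (R (\<i> * of_real \<tau>) (Q s x)) \<le> 2 / (s + \<bar>\<tau>\<bar>) * (\<bar>\<tau>\<bar> * norm (R (\<i> * of_real \<tau>) x) + s * norm (R (of_real s) x))"
          by (rule norm_R_Q_imaginary_le[OF s \<tau>])
        also have "\<dots> \<le> 2 / (s + \<bar>\<tau>\<bar>) * (\<bar>\<tau>\<bar> * (N * norm x) + s * (M / s * norm x))"
          using s by (intro mult_left_mono add_mono N(2) bound_real) auto
        also have "\<dots> = 2 * (\<bar>\<tau>\<bar> * N + M) * norm x * (1 / (s + \<bar>\<tau>\<bar>))" using s by (simp add: algebra_simps)
        finally show "norm (R (\<i> * of_real \<tau>) (Q s x)) \<le> 2 * (\<bar>\<tau>\<bar> * N + M) * norm x * (1 / (s + \<bar>\<tau>\<bar>))" .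
      qed (use \<tau> N(1) M_nonneg in auto)
      also have "\<dots> = (2 * c * (\<bar>\<tau>\<bar> * \<bar>\<tau>\<bar> powr (\<theta> - 1) * N) + 2 * c * M * \<bar>\<tau>\<bar> powr (\<theta> - 1)) * norm x"
        by (simp add: algebra_simps)
      also have "\<bar>\<tau>\<bar> * \<bar>\<tau>\<bar> powr (\<theta> - 1) = \<bar>\<tau>\<bar> powr \<theta>" using powr_add[of "\<bar>\<tau>\<bar>" 1 "\<theta> - 1"] \<tau> by simp
      also have "(2 * c * (\<bar>\<tau>\<bar> powr \<theta> * N) + 2 * c * M * \<bar>\<tau>\<bar> powr (\<theta> - 1)) * norm x
          \<le> (K * (\<bar>\<tau>\<bar> powr \<theta> * N) + K * \<bar>\<tau>\<bar> powr (\<theta> - 1)) * norm x"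
        using N(1) by (intro mult_right_mono add_mono K1) auto
      finally show ?thesis by (simp add: algebra_simps)
    qed
  qed
qed

text \<open>
  Here \<open>(Q 1 ^^ n) \<circ> Y\<close> is \<open>B\<^sup>\<gamma>\<close>. The term \<open>\<bar>\<tau>\<bar>\<^sup>e\<close> has exponent \<open>\<gamma> - 1\<close> only if \<open>\<gamma> < 1\<close>; for larger \<open>\<gamma>\<close>
  the resolvent at \<open>1\<close>, split off with an integer power of \<open>B\<close>, leaves a bounded remainder, whence
  \<open>e = min (\<gamma> - 1) 0\<close>.
\<close>

lemma fractional_power_estimates:
  fixes \<gamma> :: real
  assumes \<gamma>: "0 < \<gamma>"
  defines "n \<equiv> nat \<lfloor>\<gamma>\<rfloor>" and "\<theta> \<equiv> frac \<gamma>" and "e \<equiv> min (\<gamma> - 1) 0"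
  obtains Y K where "bounded_linear Y"
    "\<theta> = 0 \<Longrightarrow> Y = (\<lambda>x. x)"
    "\<And>x. \<theta> \<noteq> 0 \<Longrightarrow> \<exists>w. has_bochner lborel_pos (\<lambda>t. (t powr (\<theta> - 1) / (1 + t)) *\<^sub>R Q (t / (1 + t)) x) w \<and>
      Y x = (sin (pi * \<theta>) / pi) *\<^sub>R w"
    "\<And>L x. bounded_linear L \<Longrightarrow> (\<And>s x. 0 < s \<Longrightarrow> L (Q s x) = Q s (L x)) \<Longrightarrow> L (Y x) = Y (L x)"
    "0 \<le> K"
    "\<And>\<tau> N x. \<tau> \<noteq> 0 \<Longrightarrow> \<bar>\<tau>\<bar> \<le> 1 \<Longrightarrow> 0 \<le> N \<Longrightarrow> (\<And>x. norm (R (\<i> * of_real \<tau>) x) \<le> N * norm x) \<Longrightarrow>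
      norm (R (\<i> * of_real \<tau>) ((Q 1 ^^ n) (Y x))) \<le> K * (\<bar>\<tau>\<bar> powr \<gamma> * N + \<bar>\<tau>\<bar> powr e) * norm x"
    "\<And>s x. 0 < s \<Longrightarrow> norm (R (of_real s) ((Q 1 ^^ n) (Y x))) \<le> K * s powr e * norm x"
proof -
  have \<gamma>_eq: "\<gamma> = real n + \<theta>" using \<gamma> by (simp add: n_def \<theta>_def frac_def)
  have \<theta>: "0 \<le> \<theta>" "\<theta> < 1" by (simp_all add: \<theta>_def frac_ge_0 frac_lt_1)
  have real_est: "norm (R (of_real s) ((Q 1 ^^ n) v)) \<le> (1 + M) * M * (1 + M) ^ (n - 1) * norm v"
    if "0 < s" and n0: "n \<noteq> 0" for s v
  proof -
    obtain k where k: "n = Suc k" using n0 by (cases n) auto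
    have "norm (R (of_real s) ((Q 1 ^^ n) v)) \<le> (1 + M) * M * norm ((Q 1 ^^ k) v)"
      unfolding k using norm_R_Q1_real_le[OF \<open>0 < s\<close>] by simp
    also have "\<dots> \<le> (1 + M) * M * ((1 + M) ^ k * norm v)"
      using norm_iterate_Q1 M_nonneg by (intro mult_left_mono) auto
    finally show ?thesis by (simp add: k mult_ac)
  qed
  show ?thesis
  proof (cases "\<theta> = 0")
    case True
    then have n: "n \<noteq> 0" "\<gamma> = real n" using \<gamma> \<gamma>_eq by auto
    then have e: "e = 0" by (cases n) (auto simp: e_def)
    obtain K where K: "0 \<le> K" and KK: "\<forall>z b x. z \<noteq> 0 \<and> 0 \<le> Re z \<and> cmod z \<le> 1 \<and> 0 \<le> b \<and> (\<forall>x. norm (R z x) \<le> b * norm x) \<longrightarrow>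
      norm (R z ((Q 1 ^^ n) x)) \<le> K * ((if n = 0 then 0 else 1) + cmod z ^ n * b) * norm x"
      using norm_R_iterate_Q1_le[of "\<lambda>x. x" 1 n] by auto
    define K' where "K' = K + (1 + M) * M * (1 + M) ^ (n - 1)"
    have K': "K \<le> K'" "(1 + M) * M * (1 + M) ^ (n - 1) \<le> K'" "0 \<le> K'"
      unfolding K'_def using K M_nonneg by auto
    show ?thesis
    proof (rule that[of "\<lambda>x. x" K'])
      show "norm (R (\<i> * of_real \<tau>) ((Q 1 ^^ n) x)) \<le> K' * (\<bar>\<tau>\<bar> powr \<gamma> * N + \<bar>\<tau>\<bar> powr e) * norm x"
        if "\<tau> \<noteq> 0" "\<bar>\<tau>\<bar> \<le> 1" "0 \<le> N" "\<And>x. norm (R (\<i> * of_real \<tau>) x) \<le> N * norm x" for \<tau> N x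
      proof -
        have "norm (R (\<i> * of_real \<tau>) ((Q 1 ^^ n) x)) \<le> K * ((if n = 0 then 0 else 1) + cmod (\<i> * of_real \<tau>) ^ n * N) * norm x"
          using KK[rule_format, of "\<i> * of_real \<tau>" N x] that by (simp add: norm_mult)
        also have "\<dots> = K * (\<bar>\<tau>\<bar> powr \<gamma> * N + \<bar>\<tau>\<bar> powr e) * norm x"
          using that(1) n by (simp add: e norm_mult powr_realpow add.commute)
        also have "\<dots> \<le> K' * (\<bar>\<tau>\<bar> powr \<gamma> * N + \<bar>\<tau>\<bar> powr e) * norm x"
          using that(3) by (intro mult_right_mono K') auto
        finally show ?thesis .
      qed
      show "norm (R (of_real s) ((Q 1 ^^ n) x)) \<le> K' * s powr e * norm x" if "0 < s" for s x
        using order_trans[OF real_est[OF that n(1)] mult_right_mono[OF K'(2)]] that by (simp add: e)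
    qed (use True K' in auto)
  next
    case False
    then have \<theta>0: "0 < \<theta>" using \<theta> by simp
    obtain I K0 where I: "bounded_linear I" "0 \<le> K0"
      "\<And>x. has_bochner lborel_pos (\<lambda>t. (t powr (\<theta> - 1) / (1 + t)) *\<^sub>R Q (t / (1 + t)) x) (I x)"
      "\<And>L x. bounded_linear L \<Longrightarrow> (\<And>s x. 0 < s \<Longrightarrow> L (Q s x) = Q s (L x)) \<Longrightarrow> L (I x) = I (L x)"
      "\<And>\<tau> N x. \<tau> \<noteq> 0 \<Longrightarrow> 0 \<le> N \<Longrightarrow> (\<And>x. norm (R (\<i> * of_real \<tau>) x) \<le> N * norm x) \<Longrightarrow>
        norm (R (\<i> * of_real \<tau>) (I x)) \<le> K0 * (\<bar>\<tau>\<bar> powr \<theta> * N + \<bar>\<tau>\<bar> powr (\<theta> - 1)) * norm x"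
      "\<And>s x. 0 < s \<Longrightarrow> norm (R (of_real s) (I x)) \<le> K0 * s powr (\<theta> - 1) * norm x"
      using Balakrishnan_average[OF \<theta>0 \<theta>(2)] by blast
    define c where "c = sin (pi * \<theta>) / pi"
    define Y where "Y x = c *\<^sub>R I x" for x
    define K1 where "K1 = \<bar>c\<bar> * K0"
    have K1: "0 \<le> K1" using I(2) by (simp add: K1_def)
    have Ylin: "bounded_linear Y" unfolding Y_def[abs_def] by (rule bounded_linear_const_scaleR[OF I(1)])
    have Yim: "norm (R (\<i> * of_real \<tau>) (Y x)) \<le> K1 * (\<bar>\<tau>\<bar> powr \<theta> * N + \<bar>\<tau>\<bar> powr (\<theta> - 1)) * norm x"
      if "\<tau> \<noteq> 0" "0 \<le> N" "\<And>x. norm (R (\<i> * of_real \<tau>) x) \<le> N * norm x" for \<tau> N x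
    proof -
      have "norm (R (\<i> * of_real \<tau>) (Y x)) = \<bar>c\<bar> * norm (R (\<i> * of_real \<tau>) (I x))"
        unfolding Y_def using that(1) by (subst R_scaleR) auto
      also have "\<dots> \<le> \<bar>c\<bar> * (K0 * (\<bar>\<tau>\<bar> powr \<theta> * N + \<bar>\<tau>\<bar> powr (\<theta> - 1)) * norm x)"
        by (intro mult_left_mono I(5) that) auto
      finally show ?thesis by (simp add: K1_def mult_ac)
    qed
    have Yre: "norm (R (of_real s) (Y x)) \<le> K1 * s powr (\<theta> - 1) * norm x" if "0 < s" for s x
    proof -
      have "norm (R (of_real s) (Y x)) = \<bar>c\<bar> * norm (R (of_real s) (I x))"
        unfolding Y_def using that by (subst R_scaleR) auto
      also have "\<dots> \<le> \<bar>c\<bar> * (K0 * s powr (\<theta> - 1) * norm x)"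
        by (intro mult_left_mono I(6) that) auto
      finally show ?thesis by (simp add: K1_def mult_ac)
    qed
    obtain y where y: "0 \<le> y" "\<And>x. norm (Y x) \<le> y * norm x"
      using bounded_linear.nonneg_bounded[OF Ylin] by (auto simp: mult.commute)
    obtain K2 where K2: "0 \<le> K2" and KK: "\<And>z b x. \<lbrakk>z \<noteq> 0; 0 \<le> Re z; cmod z \<le> 1; 0 \<le> b; \<forall>x. norm (R z (Y x)) \<le> b * norm x\<rbrakk> \<Longrightarrow>
      norm (R z ((Q 1 ^^ n) (Y x))) \<le> K2 * ((if n = 0 then 0 else 1) + cmod z ^ n * b) * norm x"
      using norm_R_iterate_Q1_le[of Y y n, OF y(2,1)] by blast
    define K where "K = K2 * (1 + K1) + (1 + M) * M * (1 + M) ^ (n - 1) * y + K1"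
    have nn: "0 \<le> K2 * (1 + K1)" "0 \<le> (1 + M) * M * (1 + M) ^ (n - 1) * y"
      using K1 K2 y M_nonneg by auto
    have K: "K2 * (1 + K1) \<le> K" "(1 + M) * M * (1 + M) ^ (n - 1) * y \<le> K" "K1 \<le> K" "0 \<le> K"
      unfolding K_def using nn K1 by auto
    show ?thesis
    proof (rule that[of Y K, OF Ylin])
      show "L (Y x) = Y (L x)" if "bounded_linear L" "\<And>s x. 0 < s \<Longrightarrow> L (Q s x) = Q s (L x)" for L x
        using I(4)[OF that] linear_scale[OF bounded_linear.linear[OF that(1)]] by (simp add: Y_def)
      show "\<exists>w. has_bochner lborel_pos (\<lambda>t. (t powr (\<theta> - 1) / (1 + t)) *\<^sub>R Q (t / (1 + t)) x) w \<and>
        Y x = (sin (pi * \<theta>) / pi) *\<^sub>R w" for x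
        using I(3)[of x] by (auto simp: Y_def c_def)
      show "norm (R (of_real s) ((Q 1 ^^ n) (Y x))) \<le> K * s powr e * norm x" if s: "0 < s" for s x
      proof (cases "n = 0")
        case True
        then have "e = \<theta> - 1" using \<gamma>_eq \<theta> by (simp add: e_def)
        then show ?thesis
          using True order_trans[OF Yre[OF s] mult_right_mono[OF mult_right_mono[OF K(3)]]] by simp
      next
        case False
        then have e: "e = 0" using \<gamma>_eq \<theta> by (simp add: e_def)
        have "norm (R (of_real s) ((Q 1 ^^ n) (Y x))) \<le> (1 + M) * M * (1 + M) ^ (n - 1) * (y * norm x)"
          by (rule order_trans[OF real_est[OF s False] mult_left_mono[OF y(2)]]) (use M_nonneg in auto)
        also have "\<dots> = (1 + M) * M * (1 + M) ^ (n - 1) * y * norm x" by simp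
        also have "\<dots> \<le> K * norm x" by (intro mult_right_mono K) auto
        finally show ?thesis using s by (simp add: e)
      qed
      show "norm (R (\<i> * of_real \<tau>) ((Q 1 ^^ n) (Y x))) \<le> K * (\<bar>\<tau>\<bar> powr \<gamma> * N + \<bar>\<tau>\<bar> powr e) * norm x"
        if \<tau>: "\<tau> \<noteq> 0" "\<bar>\<tau>\<bar> \<le> 1" and N: "0 \<le> N" "\<And>x. norm (R (\<i> * of_real \<tau>) x) \<le> N * norm x" for \<tau> N x
      proof -
        let ?b = "K1 * (\<bar>\<tau>\<bar> powr \<theta> * N + \<bar>\<tau>\<bar> powr (\<theta> - 1))"
        let ?T = "\<bar>\<tau>\<bar> powr \<gamma> * N + \<bar>\<tau>\<bar> powr e"
        have T0: "0 \<le> ?T" using N by simp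
        have "norm (R (\<i> * of_real \<tau>) ((Q 1 ^^ n) (Y x))) \<le> K2 * ((if n = 0 then 0 else 1) + cmod (\<i> * of_real \<tau>) ^ n * ?b) * norm x"
          by (rule KK) (use \<tau> N K1 Yim[OF \<tau>(1) N] in \<open>auto simp: norm_mult\<close>)
        also have "cmod (\<i> * of_real \<tau>) ^ n * ?b = K1 * (\<bar>\<tau>\<bar> powr \<gamma> * N + \<bar>\<tau>\<bar> powr (\<gamma> - 1))"
        proof -
          have "cmod (\<i> * of_real \<tau>) ^ n = \<bar>\<tau>\<bar> powr real n" using \<tau> by (simp add: norm_mult powr_realpow)
          moreover have "\<bar>\<tau>\<bar> powr real n * \<bar>\<tau>\<bar> powr \<theta> = \<bar>\<tau>\<bar> powr \<gamma>" "\<bar>\<tau>\<bar> powr real n * \<bar>\<tau>\<bar> powr (\<theta> - 1) = \<bar>\<tau>\<bar> powr (\<gamma> - 1)"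
            by (simp_all add: \<gamma>_eq powr_add[symmetric] algebra_simps)
          ultimately show ?thesis by (simp add: distrib_left mult_ac)
        qed
        also have "K2 * ((if n = 0 then 0 else 1) + K1 * (\<bar>\<tau>\<bar> powr \<gamma> * N + \<bar>\<tau>\<bar> powr (\<gamma> - 1))) * norm x
          \<le> K2 * (?T + K1 * ?T) * norm x"
        proof (intro mult_right_mono mult_left_mono add_mono K2 K1 norm_ge_zero)
          have e0: "e = 0" if "n \<noteq> 0" using that \<gamma>_eq \<theta> by (simp add: e_def)
          show "(if n = 0 then 0 else 1) \<le> ?T" using e0 \<tau> N by auto
          show "\<bar>\<tau>\<bar> powr (\<gamma> - 1) \<le> \<bar>\<tau>\<bar> powr e" using \<tau> by (intro powr_mono') (auto simp: e_def)
        qed (use N in auto)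
        also have "\<dots> = K2 * (1 + K1) * ?T * norm x" by (simp add: algebra_simps)
        also have "\<dots> \<le> K * ?T * norm x" using T0 by (intro mult_right_mono K) auto
        finally show ?thesis .
      qed
    qed (use False K in auto)
  qed
qed

text \<open>
  With \<open>w = i Im z\<close> the resolvent identity reads \<open>R(z) = R(w) - (Re z) R(z) R(w)\<close>, and
  \<open>(Re z) \<parallel>R(z)\<parallel> \<le> M\<close>. Points of the positive real axis, for which \<open>w = 0\<close> is excluded, are limits of others.
\<close>

lemma half_plane_bound:
  assumes c: "\<And>\<tau>. \<tau> \<noteq> 0 \<Longrightarrow> norm (R (\<i> * of_real \<tau>) v) \<le> c" and z: "0 < Re z"
  shows "norm (R z v) \<le> (1 + M) * c"
proof -
  have off: "norm (R w v) \<le> (1 + M) * c" if w: "0 < Re w" "Im w \<noteq> 0" for w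
  proof -
    let ?i = "\<i> * of_real (Im w)"
    have "?i - w = - of_real (Re w)" by (simp add: complex_eq_iff)
    moreover have "R w v - R ?i v = (?i - w) *\<^sub>C R w (R ?i v)" by (rule resolvent) (use w in auto)
    ultimately have "R w v - R ?i v = - (of_real (Re w) *\<^sub>C R w (R ?i v))" by (simp only: scaleC_minus_left)
    then have "R w v = R ?i v - of_real (Re w) *\<^sub>C R w (R ?i v)" by (simp add: algebra_simps)
    then have "norm (R w v) \<le> norm (R ?i v) + Re w * norm (R w (R ?i v))"
      using norm_triangle_ineq4[of "R ?i v" "of_real (Re w) *\<^sub>C R w (R ?i v)"] w by (simp add: norm_scaleC)
    also have "\<dots> \<le> norm (R ?i v) + Re w * (M / Re w * norm (R ?i v))"
      using w by (intro add_left_mono mult_left_mono bound) auto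
    also have "\<dots> = (1 + M) * norm (R ?i v)" using w by (simp add: algebra_simps)
    also have "\<dots> \<le> (1 + M) * c" using M_nonneg by (intro mult_left_mono c w) auto
    finally show ?thesis .
  qed
  show ?thesis
  proof (cases "Im z = 0")
    case True
    have "norm (R z v) \<le> (1 + M) * c + \<epsilon> * (M / Re z * (M / Re z * norm v))" if \<epsilon>: "0 < \<epsilon>" for \<epsilon>
    proof -
      let ?w = "z + \<i> * of_real \<epsilon>"
      have w: "0 < Re ?w" "Im ?w \<noteq> 0" using z True \<epsilon> by auto
      have "R z v - R ?w v = (?w - z) *\<^sub>C R z (R ?w v)" by (rule resolvent) (use z w in \<open>auto simp: complex_eq_iff\<close>)
      then have "R z v = R ?w v + (?w - z) *\<^sub>C R z (R ?w v)" by (simp only: diff_eq_eq add.commute)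
      then have "norm (R z v) \<le> norm (R ?w v) + \<epsilon> * norm (R z (R ?w v))"
        using norm_triangle_ineq[of "R ?w v" "(?w - z) *\<^sub>C R z (R ?w v)"] \<epsilon> by (simp add: norm_scaleC norm_mult)
      also have "norm (R z (R ?w v)) \<le> M / Re z * (M / Re z * norm v)"
        using bound[OF w(1), of v] M_nonneg z by (intro order_trans[OF bound[OF z]] mult_left_mono) auto
      finally show ?thesis using off[OF w] \<epsilon> by (simp add: mult_left_mono)
    qed
    \<comment> \<open>The error term vanishes as \<open>\<epsilon>\<close> does; it is rescaled to be at most \<open>\<epsilon>\<close>.\<close>
    note lim = this
    define \<kappa> where "\<kappa> = M / Re z * (M / Re z * norm v)"
    have \<kappa>: "0 \<le> \<kappa>" using M_nonneg z by (simp add: \<kappa>_def)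
    show ?thesis
    proof (rule field_le_epsilon)
      fix \<epsilon> :: real assume \<epsilon>: "0 < \<epsilon>"
      have "norm (R z v) \<le> (1 + M) * c + \<epsilon> / (1 + \<kappa>) * \<kappa>" unfolding \<kappa>_def[symmetric]
        using lim[folded \<kappa>_def, of "\<epsilon> / (1 + \<kappa>)"] \<epsilon> \<kappa> by simp
      also have "\<epsilon> / (1 + \<kappa>) * \<kappa> \<le> \<epsilon> / (1 + \<kappa>) * (1 + \<kappa>)" using \<epsilon> \<kappa> by (intro mult_left_mono) auto
      also have "\<dots> = \<epsilon>" using \<kappa> by simp
      finally show "norm (R z v) \<le> (1 + M) * c + \<epsilon>" by simp
    qed
  qed (rule off[OF z])
qed

text \<open>
  If \<open>\<parallel>R(i\<tau>)\<parallel>\<close> were unbounded on the compact set \<open>\<delta> \<le> \<bar>\<tau>\<bar> \<le> T\<close>, it would be so near some point \<open>u\<close>; but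
  the resolvent identity bounds \<open>\<parallel>R(i\<tau>)\<parallel>\<close> by \<open>2 \<parallel>R(iu)\<parallel>\<close> for \<open>\<tau>\<close> close to \<open>u\<close>.
\<close>

lemma imaginary_bounded_away:
  assumes far: "\<And>\<tau>. T \<le> \<bar>\<tau>\<bar> \<Longrightarrow> \<tau> \<noteq> 0 \<Longrightarrow> onorm (R (\<i> * of_real \<tau>)) \<le> D" and \<delta>: "0 < \<delta>"
  shows "\<exists>D. \<forall>\<tau>. \<delta> \<le> \<bar>\<tau>\<bar> \<longrightarrow> onorm (R (\<i> * of_real \<tau>)) \<le> D"
proof (rule ccontr)
  let ?N = "\<lambda>\<tau>. onorm (R (\<i> * complex_of_real \<tau>))"
  have lin: "bounded_linear (R (\<i> * of_real \<tau>))" if "\<tau> \<noteq> 0" for \<tau> using that by (intro linear) auto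
  assume "\<not> ?thesis"
  then have "\<forall>n. \<exists>\<tau>. \<delta> \<le> \<bar>\<tau>\<bar> \<and> max D (real n) < ?N \<tau>" by (meson not_le)
  then obtain t where t: "\<And>n. \<delta> \<le> \<bar>t n\<bar>" "\<And>n. max D (real n) < ?N (t n)" by metis
  have t0: "t n \<noteq> 0" for n using t(1)[of n] \<delta> by auto
  have tT: "\<bar>t n\<bar> < T" for n using far[of "t n"] t(2)[of n] t0[of n] by force
  let ?S = "{- T..- \<delta>} \<union> {\<delta>..T}"
  have "compact ?S" by (intro compact_Un) auto
  moreover have "\<forall>n. t n \<in> ?S"
  proof
    fix n show "t n \<in> ?S" using t(1)[of n] tT[of n] by (cases "0 \<le> t n") auto
  qed
  ultimately obtain u r where u: "u \<in> ?S" "strict_mono r" "(t \<circ> r) \<longlonglongrightarrow> u"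
    unfolding compact_def by blast
  have u0: "u \<noteq> 0" using u(1) \<delta> by auto
  define c where "c = ?N u"
  have c0: "0 \<le> c" unfolding c_def by (rule onorm_pos_le[OF lin[OF u0]])
  have step: "?N (t n) \<le> c + \<bar>t n - u\<bar> * ?N (t n) * c" for n
  proof (rule onorm_bound)
    show "0 \<le> c + \<bar>t n - u\<bar> * ?N (t n) * c" using c0 onorm_pos_le[OF lin[OF t0]] by simp
    fix x
    let ?z = "\<i> * complex_of_real (t n)" and ?w = "\<i> * complex_of_real u"
    have "R ?z x - R ?w x = (?w - ?z) *\<^sub>C R ?z (R ?w x)"
      by (rule resolvent) (use t0[of n] u0 in auto)
    then have "R ?z x = R ?w x + (?w - ?z) *\<^sub>C R ?z (R ?w x)" by (simp only: diff_eq_eq add.commute)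
    then have "norm (R ?z x) \<le> norm (R ?w x) + cmod (?w - ?z) * norm (R ?z (R ?w x))"
      using norm_triangle_ineq[of "R ?w x" "(?w - ?z) *\<^sub>C R ?z (R ?w x)"] by (simp add: norm_scaleC)
    also have "cmod (?w - ?z) = \<bar>t n - u\<bar>"
      by (simp add: right_diff_distrib[symmetric] norm_mult abs_minus_commute flip: of_real_diff)
    also have "norm (R ?w x) + \<bar>t n - u\<bar> * norm (R ?z (R ?w x)) \<le> c * norm x + \<bar>t n - u\<bar> * (?N (t n) * (c * norm x))"
    proof (intro add_mono mult_left_mono abs_ge_zero)
      show Rw: "norm (R ?w x) \<le> c * norm x" unfolding c_def by (rule onorm[OF lin[OF u0]])
      show "norm (R ?z (R ?w x)) \<le> ?N (t n) * (c * norm x)"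
        by (rule order_trans[OF onorm[OF lin[OF t0]] mult_left_mono[OF Rw onorm_pos_le[OF lin[OF t0]]]])
    qed
    finally show "norm (R ?z x) \<le> (c + \<bar>t n - u\<bar> * ?N (t n) * c) * norm x" by (simp add: algebra_simps)
  qed
  have "(\<lambda>n. \<bar>(t \<circ> r) n - u\<bar> * c) \<longlonglongrightarrow> \<bar>u - u\<bar> * c" by (intro tendsto_intros u(3))
  then have "eventually (\<lambda>n. \<bar>(t \<circ> r) n - u\<bar> * c < 1 / 2) sequentially"
    by (intro order_tendstoD(2)) auto
  moreover have "eventually (\<lambda>n. 2 * c \<le> real n) sequentially"
    using eventually_ge_at_top[of "nat \<lceil>2 * c\<rceil>"] by eventually_elim linarith
  ultimately have "eventually (\<lambda>n. False) sequentially"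
  proof eventually_elim
    case (elim n)
    let ?a = "?N (t (r n))"
    have a: "0 \<le> ?a" by (rule onorm_pos_le[OF lin[OF t0]])
    have "?a \<le> c + (\<bar>t (r n) - u\<bar> * c) * ?a" using step[of "r n"] by (simp add: mult_ac)
    also have "(\<bar>t (r n) - u\<bar> * c) * ?a \<le> 1 / 2 * ?a" using elim(1) a by (intro mult_right_mono) auto
    finally have "?a \<le> 2 * c" by simp
    moreover have "real n \<le> real (r n)" using seq_suble[OF u(2), of n] by simp
    ultimately show False using t(2)[of "r n"] elim(2) by linarith
  qed
  then show False by simp
qed

text \<open>
  In the application \<open>W\<close> is \<open>B\<^sup>\<gamma>\<close> and \<open>F\<close> is \<open>f(A) = \<integral> Q(s) d\<mu>(s)\<close>, characterised here by the norm
  estimates under the integral that it admits. The assumption for \<open>\<bar>\<tau>\<bar> \<le> \<delta>\<close> is the only place where the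
  resolvent growth at \<open>0\<close> and the size of \<open>f\<close> meet.
\<close>

theorem half_plane_bound_of_average:
  fixes \<mu> :: "real measure" and f N :: "real \<Rightarrow> real" and F W :: "'a \<Rightarrow> 'a"
  assumes \<mu>: "sets \<mu> = sets (restrict_space borel {0<..})" "emeasure \<mu> (space \<mu>) < \<infinity>"
    and f: "\<And>t. 0 < t \<Longrightarrow> (\<integral>\<^sup>+s. ennreal (t / (s + t)) \<partial>\<mu>) = ennreal (f t)" "\<And>t. 0 < t \<Longrightarrow> 0 \<le> f t"
    and fp: "\<And>t. 0 < t \<Longrightarrow> t \<le> 1 \<Longrightarrow> f t \<le> C * t powr p" and C: "0 \<le> C" and e: "e \<le> 0" "0 < p + e"
    and F: "bounded_linear F" "\<And>x. W (F x) = F (W x)"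
      "\<And>(L :: 'a \<Rightarrow> 'a) h x. bounded_linear L \<Longrightarrow> h \<in> borel_measurable \<mu> \<Longrightarrow> (\<And>t. 0 < t \<Longrightarrow> ennreal (norm (L (Q t x))) \<le> h t)
      \<Longrightarrow> ennreal (norm (L (F x))) \<le> (\<integral>\<^sup>+t. h t \<partial>\<mu>)"
    and N: "\<And>\<tau> x. \<tau> \<noteq> 0 \<Longrightarrow> norm (R (\<i> * of_real \<tau>) x) \<le> N \<tau> * norm x" "\<And>\<tau>. \<tau> \<noteq> 0 \<Longrightarrow> 0 \<le> N \<tau>"
    and K: "0 \<le> K"
    and W: "bounded_linear W"
      "\<And>\<tau> x. \<tau> \<noteq> 0 \<Longrightarrow> \<bar>\<tau>\<bar> \<le> 1 \<Longrightarrow> norm (R (\<i> * of_real \<tau>) (W x)) \<le> K * (\<bar>\<tau>\<bar> powr \<gamma> * N \<tau> + \<bar>\<tau>\<bar> powr e) * norm x"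
      "\<And>s x. 0 < s \<Longrightarrow> norm (R (of_real s) (W x)) \<le> K * s powr e * norm x"
    and near: "0 < \<delta>" "\<delta> \<le> 1" "\<And>\<tau>. \<tau> \<noteq> 0 \<Longrightarrow> \<bar>\<tau>\<bar> \<le> \<delta> \<Longrightarrow> f \<bar>\<tau>\<bar> * (\<bar>\<tau>\<bar> powr \<gamma> * N \<tau>) \<le> D"
    and far: "\<And>\<tau>. \<delta> \<le> \<bar>\<tau>\<bar> \<Longrightarrow> N \<tau> \<le> E"
  shows "\<exists>B. \<forall>z x. 0 < Re z \<longrightarrow> norm (R z (W (F x))) \<le> B * norm x"
proof -
  have sp: "space \<mu> = {0<..}" by (rule space_pos[OF \<mu>(1)])
  define m where "m = enn2real (\<integral>\<^sup>+s. ennreal (s powr e) \<partial>\<mu>)"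
  have m: "(\<integral>\<^sup>+s. ennreal (s powr e) \<partial>\<mu>) = ennreal m" "0 \<le> m"
    using negative_moment_finite[OF \<mu> f(1) fp e C] by (simp_all add: m_def)
  have E: "0 \<le> E" using far[of \<delta>] N(2)[of \<delta>] near(1) by simp
  obtain k where k: "0 \<le> k" "\<And>x. norm (W (F x)) \<le> k * norm x"
    using bounded_linear.nonneg_bounded[OF bounded_linear_compose[OF W(1) F(1)]] by (auto simp: mult.commute)
  define B where "B = 2 * K * (D + C) + 2 * K * m + E * k"
  have D: "0 \<le> D" using near(3)[of \<delta>] near(1) f(2)[of \<delta>] N(2)[of \<delta>]
    by (smt (verit, best) mult_nonneg_nonneg powr_ge_zero)
  have im: "norm (R (\<i> * of_real \<tau>) (W (F x))) \<le> B * norm x" if \<tau>: "\<tau> \<noteq> 0" for \<tau> x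
  proof (cases "\<delta> \<le> \<bar>\<tau>\<bar>")
    case True
    have "norm (R (\<i> * of_real \<tau>) (W (F x))) \<le> N \<tau> * norm (W (F x))" by (rule N(1)[OF \<tau>])
    also have "\<dots> \<le> E * (k * norm x)" using True E by (intro mult_mono far k) auto
    also have "\<dots> \<le> B * norm x"
      unfolding B_def mult.assoc[symmetric] using K D C m by (intro mult_right_mono) auto
    finally show ?thesis .
  next
    case False
    then have \<tau>1: "\<bar>\<tau>\<bar> \<le> \<delta>" "\<bar>\<tau>\<bar> \<le> 1" using near by auto
    have \<tau>p: "0 < \<bar>\<tau>\<bar>" using \<tau> by simp
    define a where "a = norm (R (\<i> * of_real \<tau>) (W x))"
    let ?h = "\<lambda>t. ennreal (2 * a) * ennreal (\<bar>\<tau>\<bar> / (t + \<bar>\<tau>\<bar>)) + ennreal (2 * K * norm x) * ennreal (t powr e)"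
    have h1: "(\<lambda>t. ennreal (\<bar>\<tau>\<bar> / (t + \<bar>\<tau>\<bar>))) \<in> borel_measurable \<mu>" "(\<lambda>t. ennreal (t powr e)) \<in> borel_measurable \<mu>"
      by (rule borel_measurable_pos[OF \<mu>(1)], measurable)+
    have "ennreal (norm (R (\<i> * of_real \<tau>) (F (W x)))) \<le> (\<integral>\<^sup>+t. ?h t \<partial>\<mu>)"
    proof (rule F(3))
      show "bounded_linear (R (\<i> * of_real \<tau>))" using \<tau> by (intro linear) auto
      show "?h \<in> borel_measurable \<mu>" using h1 by (intro borel_measurable_add borel_measurable_times) auto
      fix t :: real assume t: "0 < t"
      have "norm (R (\<i> * of_real \<tau>) (Q t (W x))) \<le> 2 / (t + \<bar>\<tau>\<bar>) * (\<bar>\<tau>\<bar> * a + t * norm (R (of_real t) (W x)))"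
        unfolding a_def by (rule norm_R_Q_imaginary_le[OF t \<tau>])
      also have "\<dots> \<le> 2 / (t + \<bar>\<tau>\<bar>) * (\<bar>\<tau>\<bar> * a + t * (K * t powr e * norm x))"
        using t by (intro mult_left_mono add_left_mono W(3)) auto
      also have "\<dots> = 2 * a * (\<bar>\<tau>\<bar> / (t + \<bar>\<tau>\<bar>)) + t / (t + \<bar>\<tau>\<bar>) * (2 * K * norm x * t powr e)"
        by (simp add: algebra_simps add_divide_distrib)
      also have "\<dots> \<le> 2 * a * (\<bar>\<tau>\<bar> / (t + \<bar>\<tau>\<bar>)) + 1 * (2 * K * norm x * t powr e)"
        using t K by (intro add_left_mono mult_right_mono) auto
      finally have "ennreal (norm (R (\<i> * of_real \<tau>) (Q t (W x)))) \<le> ennreal (2 * a * (\<bar>\<tau>\<bar> / (t + \<bar>\<tau>\<bar>)) + 2 * K * norm x * t powr e)"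
        by (intro ennreal_leI) simp
      also have "\<dots> = ennreal (2 * a * (\<bar>\<tau>\<bar> / (t + \<bar>\<tau>\<bar>))) + ennreal (2 * K * norm x * t powr e)"
        using t K by (intro ennreal_plus) (auto simp: a_def)
      also have "ennreal (2 * a * (\<bar>\<tau>\<bar> / (t + \<bar>\<tau>\<bar>))) = ennreal (2 * a) * ennreal (\<bar>\<tau>\<bar> / (t + \<bar>\<tau>\<bar>))"
        by (rule ennreal_mult') (simp add: a_def)
      also have "ennreal (2 * K * norm x * t powr e) = ennreal (2 * K * norm x) * ennreal (t powr e)"
        by (rule ennreal_mult') (use K in simp)
      finally show "ennreal (norm (R (\<i> * of_real \<tau>) (Q t (W x)))) \<le> ?h t" .
    qed
    also have "(\<integral>\<^sup>+t. ?h t \<partial>\<mu>) = ennreal (2 * a) * ennreal (f \<bar>\<tau>\<bar>) + ennreal (2 * K * norm x) * ennreal m"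
      using h1 by (simp add: nn_integral_add nn_integral_cmult f(1)[OF \<tau>p] m(1))
    also have "\<dots> = ennreal (2 * a * f \<bar>\<tau>\<bar> + 2 * K * norm x * m)"
    proof -
      have "ennreal (2 * a * f \<bar>\<tau>\<bar>) = ennreal (2 * a) * ennreal (f \<bar>\<tau>\<bar>)" by (rule ennreal_mult') (simp add: a_def)
      moreover have "ennreal (2 * K * norm x * m) = ennreal (2 * K * norm x) * ennreal m" by (rule ennreal_mult') (use K in simp)
      moreover have "ennreal (2 * a * f \<bar>\<tau>\<bar> + 2 * K * norm x * m) = ennreal (2 * a * f \<bar>\<tau>\<bar>) + ennreal (2 * K * norm x * m)"
        using f(2)[OF \<tau>p] K m(2) by (intro ennreal_plus) (auto simp: a_def)
      ultimately show ?thesis by simp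
    qed
    finally have "norm (R (\<i> * of_real \<tau>) (F (W x))) \<le> 2 * a * f \<bar>\<tau>\<bar> + 2 * K * norm x * m"
      using f(2)[OF \<tau>p] K m(2) by (subst (asm) ennreal_le_iff) (auto simp: a_def)
    moreover have "a * f \<bar>\<tau>\<bar> \<le> K * (D + C) * norm x"
    proof -
      have "a * f \<bar>\<tau>\<bar> \<le> K * (\<bar>\<tau>\<bar> powr \<gamma> * N \<tau> + \<bar>\<tau>\<bar> powr e) * norm x * f \<bar>\<tau>\<bar>"
        unfolding a_def by (intro mult_right_mono W(2) \<tau> \<tau>1 f \<tau>p)
      also have "\<dots> = K * (f \<bar>\<tau>\<bar> * (\<bar>\<tau>\<bar> powr \<gamma> * N \<tau>) + f \<bar>\<tau>\<bar> * \<bar>\<tau>\<bar> powr e) * norm x"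
        by (simp add: algebra_simps)
      also have "\<dots> \<le> K * (D + C) * norm x"
      proof (intro mult_right_mono mult_left_mono add_mono near(3) \<tau> \<tau>1 K norm_ge_zero)
        have "f \<bar>\<tau>\<bar> * \<bar>\<tau>\<bar> powr e \<le> C * \<bar>\<tau>\<bar> powr p * \<bar>\<tau>\<bar> powr e"
          by (intro mult_right_mono fp \<tau>p \<tau>1) auto
        also have "\<dots> = C * \<bar>\<tau>\<bar> powr (p + e)" by (simp add: powr_add)
        also have "\<dots> \<le> C * 1" using e \<tau>1 C powr_le1[of "p + e" "\<bar>\<tau>\<bar>"] by (intro mult_left_mono) auto
        finally show "f \<bar>\<tau>\<bar> * \<bar>\<tau>\<bar> powr e \<le> C" by simp
      qed
      finally show ?thesis .
    qed
    ultimately have "norm (R (\<i> * of_real \<tau>) (F (W x))) \<le> (2 * K * (D + C) + 2 * K * m) * norm x"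
      by (simp add: algebra_simps)
    also have "\<dots> \<le> B * norm x" unfolding B_def using E k by (intro mult_right_mono) auto
    finally show ?thesis by (simp add: F(2))
  qed
  have "norm (R z (W (F x))) \<le> (1 + M) * B * norm x" if "0 < Re z" for z x
    using half_plane_bound[of "W (F x)" "B * norm x", OF im that] by simp
  then show ?thesis by blast
qed

end

section \<open>Semigroups and their generators\<close>

text \<open>
  A bound of Hille--Yosida type. Put \<open>P(h) = e\<^bsup>-zh\<^esup> T(h)\<close>. From the telescoping sum
  \<open>x - P(nh) x = \<Sum>\<^sub>k P(kh) (x - P(h) x)\<close> and \<open>n \<rightarrow> \<infinity>\<close> one gets
  \<open>\<parallel>x\<parallel> (1 - e\<^bsup>-h Re z\<^esup>) \<le> M \<parallel>x - P(h) x\<parallel>\<close>; dividing by \<open>h\<close> and letting \<open>h \<rightarrow> 0\<close> gives the claim, as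
  \<open>(x - P(h) x) / h\<close> tends to \<open>z x + y\<close>.
\<close>

lemma semigroup_resolvent_estimate:
  fixes T :: "real \<Rightarrow> 'a::complex_banach \<Rightarrow>\<^sub>L 'a"
  assumes T: "c0_semigroup T" and M: "\<And>t. 0 \<le> t \<Longrightarrow> norm (T t) \<le> M"
    and xy: "(x, - y) \<in> generator T" and z: "0 < Re z"
  shows "norm x \<le> M / Re z * norm (z *\<^sub>C x + y)"
proof -
  have Tc: "\<And>t c x. 0 \<le> t \<Longrightarrow> T t (c *\<^sub>C x) = c *\<^sub>C T t x" and T0: "T 0 = id_blinfun"
    and Tadd: "\<And>s t. 0 \<le> s \<Longrightarrow> 0 \<le> t \<Longrightarrow> T (s + t) = T s o\<^sub>L T t"
    and Tcont: "\<And>x. ((\<lambda>t. T t x) \<longlongrightarrow> x) (at_right 0)"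
    using T unfolding c0_semigroup_def by auto
  have gen: "((\<lambda>t. (T t x - x) /\<^sub>R t) \<longlongrightarrow> - y) (at_right 0)" using xy by (simp add: generator_def)
  have M0: "0 \<le> M" using M[of 0] norm_ge_zero[of "T 0"] by linarith
  have TM: "norm (T t v) \<le> M * norm v" if "0 \<le> t" for t v
    using order_trans[OF norm_blinfun mult_right_mono[OF M[OF that]]] by simp
  define P where "P t v = exp (- (z * of_real t)) *\<^sub>C T t v" for t v
  have nP: "norm (P t v) \<le> exp (- (Re z * t)) * (M * norm v)" if "0 \<le> t" for t v
    using TM[OF that, of v] by (simp add: P_def norm_scaleC)
  define u where "u h = x - P h x" for h
  have Padd: "P (s + t) v = P s (P t v)" if "0 \<le> s" "0 \<le> t" for s t v
    using that by (simp add: P_def Tadd Tc scaleC_scaleC exp_add[symmetric] algebra_simps)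
  have Pdiff: "P t (v - w) = P t v - P t w" if "0 \<le> t" for t v w
    by (simp add: P_def blinfun.diff_right scaleC_diff_right)
  have tele: "x - P (real n * h) x = (\<Sum>k<n. P (real k * h) (u h))" if "0 \<le> h" for n h
  proof (induction n)
    case 0
    show ?case by (simp add: P_def T0)
  next
    case (Suc n)
    have "P (real (Suc n) * h) x = P (real n * h) (P h x)"
      using Padd[of "real n * h" h x] that by (simp add: algebra_simps)
    then have e: "P (real n * h) (u h) = P (real n * h) x - P (real (Suc n) * h) x"
      using that by (simp add: u_def Pdiff)
    show ?case unfolding sum.lessThan_Suc Suc.IH[symmetric] e by simp
  qed
  have key: "norm x * (1 - exp (- (Re z * h))) \<le> M * norm (u h)" if h: "0 < h" for h
  proof -
    define q where "q = exp (- (Re z * h))"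
    have q: "0 < q" "q < 1" using z h by (auto simp: q_def)
    have qk: "exp (- (Re z * (real k * h))) = q ^ k" for k
      by (simp add: q_def exp_of_nat_mult[symmetric] algebra_simps)
    have "norm x \<le> q ^ n * (M * norm x) + M * norm (u h) / (1 - q)" for n
    proof -
      have "norm x \<le> norm (P (real n * h) x) + norm (\<Sum>k<n. P (real k * h) (u h))"
      proof -
        have "x = P (real n * h) x + (\<Sum>k<n. P (real k * h) (u h))"
          unfolding tele[OF less_imp_le[OF h], symmetric] by simp
        then show ?thesis using norm_triangle_ineq by metis
      qed
      also have "\<dots> \<le> q ^ n * (M * norm x) + (\<Sum>k<n. q ^ k * (M * norm (u h)))"
        using nP h by (intro add_mono order_trans[OF norm_sum] sum_mono) (auto simp: qk[symmetric])
      also have "(\<Sum>k<n. q ^ k * (M * norm (u h))) = (\<Sum>k<n. q ^ k) * (M * norm (u h))"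
        by (rule sum_distrib_right[symmetric])
      also have "(\<Sum>k<n. q ^ k) \<le> 1 / (1 - q)"
        using q sum_le_suminf[OF summable_geometric[of q], of "{..<n}"] suminf_geometric[of q] by simp
      finally show ?thesis using M0 by (simp add: mult_right_mono)
    qed
    moreover have "(\<lambda>n. q ^ n * (M * norm x) + M * norm (u h) / (1 - q)) \<longlonglongrightarrow> 0 * (M * norm x) + M * norm (u h) / (1 - q)"
      using q by (intro tendsto_intros LIMSEQ_realpow_zero) auto
    ultimately have "norm x \<le> M * norm (u h) / (1 - q)"
      using LIMSEQ_le_const[of _ _ "norm x"] by fastforce
    then show ?thesis using q by (simp add: q_def[symmetric] pos_le_divide_eq)
  qed
  let ?E = "\<lambda>h. exp (- (z * complex_of_real h))"
  have "((\<lambda>h. (?E h - 1) / of_real h) \<longlongrightarrow> - z) (at_right 0)"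
  proof -
    have "((\<lambda>w. exp (- (z * w))) has_field_derivative - z) (at 0)"
      by (auto intro!: derivative_eq_intros)
    then have "((\<lambda>w. (exp (- (z * w)) - 1) / w) \<longlongrightarrow> - z) (at 0)" by (simp add: has_field_derivative_iff)
    moreover have "filterlim complex_of_real (at 0) (at_right 0)"
      unfolding filterlim_at
      by (auto simp: eventually_at_right_field intro!: exI[of _ 1] tendsto_eq_intros)
    ultimately show ?thesis by (rule filterlim_compose)
  qed
  note Elim = this
  have Re_lim: "((\<lambda>h. (1 - exp (- (Re z * h))) / h) \<longlongrightarrow> Re z) (at_right 0)"
  proof -
    have "((\<lambda>h. exp (- (Re z * h))) has_field_derivative - Re z) (at 0)"
      by (auto intro!: derivative_eq_intros)
    then have "((\<lambda>h. (exp (- (Re z * h)) - 1) / h) \<longlongrightarrow> - Re z) (at 0)" by (simp add: has_field_derivative_iff)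
    then have "((\<lambda>h. - ((exp (- (Re z * h)) - 1) / h)) \<longlongrightarrow> - (- Re z)) (at_right 0)"
      by (intro tendsto_minus) (rule tendsto_mono[OF at_le], auto)
    then show ?thesis by (simp add: minus_divide_left)
  qed
  have u_lim: "((\<lambda>h. u h /\<^sub>R h) \<longlongrightarrow> z *\<^sub>C x + y) (at_right 0)"
  proof -
    have "((\<lambda>h. - (((?E h - 1) / of_real h) *\<^sub>C T h x) - (T h x - x) /\<^sub>R h) \<longlongrightarrow> - ((- z) *\<^sub>C x) - (- y)) (at_right 0)"
    proof (intro tendsto_diff tendsto_minus gen)
      let ?D = "\<lambda>h. (?E h - 1) / complex_of_real h"
      have "((\<lambda>h. ?D h *\<^sub>C (T h x - x)) \<longlongrightarrow> 0) (at_right 0)"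
      proof (rule Lim_null_comparison)
        show "eventually (\<lambda>h. norm (?D h *\<^sub>C (T h x - x)) \<le> cmod (?D h) * norm (T h x - x)) (at_right 0)"
          by (simp add: norm_scaleC)
        have "((\<lambda>h. cmod (?D h) * norm (T h x - x)) \<longlongrightarrow> cmod (- z) * norm (x - x)) (at_right 0)"
          by (intro tendsto_intros Elim Tcont)
        then show "((\<lambda>h. cmod (?D h) * norm (T h x - x)) \<longlongrightarrow> 0) (at_right 0)" by simp
      qed
      moreover have "((\<lambda>h. ?D h *\<^sub>C x) \<longlongrightarrow> (- z) *\<^sub>C x) (at_right 0)"
      proof (rule LIM_zero_cancel, rule Lim_null_comparison)
        show "eventually (\<lambda>h. norm (?D h *\<^sub>C x - (- z) *\<^sub>C x) \<le> cmod (?D h - (- z)) * norm x) (at_right 0)"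
          by (simp only: scaleC_diff_left[symmetric] norm_scaleC) simp
        have "((\<lambda>h. cmod (?D h - (- z)) * norm x) \<longlongrightarrow> cmod (- z - (- z)) * norm x) (at_right 0)"
          by (intro tendsto_intros Elim)
        then show "((\<lambda>h. cmod (?D h - (- z)) * norm x) \<longlongrightarrow> 0) (at_right 0)" by simp
      qed
      ultimately have "((\<lambda>h. ?D h *\<^sub>C (T h x - x) + ?D h *\<^sub>C x) \<longlongrightarrow> 0 + (- z) *\<^sub>C x) (at_right 0)" by (rule tendsto_add)
      then show "((\<lambda>h. ?D h *\<^sub>C T h x) \<longlongrightarrow> (- z) *\<^sub>C x) (at_right 0)" by (simp add: scaleC_diff_right)
    qed
    moreover have "eventually (\<lambda>h. - (((?E h - 1) / of_real h) *\<^sub>C T h x) - (T h x - x) /\<^sub>R h = u h /\<^sub>R h) (at_right 0)"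
      unfolding eventually_at_right_field
    proof (intro exI[of _ 1] conjI allI impI)
      fix h :: real assume h: "0 < h"
      have "((?E h - 1) / of_real h) *\<^sub>C T h x = (of_real (1 / h) * (?E h - 1)) *\<^sub>C T h x" by simp
      also have "\<dots> = (P h x - T h x) /\<^sub>R h"
        by (simp only: scaleC_scaleC[symmetric] scaleC_of_real scaleC_diff_left scaleC_one P_def inverse_eq_divide)
      finally show "- (((?E h - 1) / of_real h) *\<^sub>C T h x) - (T h x - x) /\<^sub>R h = u h /\<^sub>R h"
        by (simp add: u_def scaleR_diff_right)
    qed simp
    ultimately show ?thesis by (simp add: tendsto_cong scaleC_minus_left)
  qed
  have "norm x * Re z \<le> M * norm (z *\<^sub>C x + y)"
  proof (rule tendsto_le[of "at_right (0::real)"])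
    show "((\<lambda>h. M * norm (u h /\<^sub>R h)) \<longlongrightarrow> M * norm (z *\<^sub>C x + y)) (at_right 0)" by (intro tendsto_intros u_lim)
    show "((\<lambda>h. norm x * ((1 - exp (- (Re z * h))) / h)) \<longlongrightarrow> norm x * Re z) (at_right 0)" by (intro tendsto_intros Re_lim)
    show "eventually (\<lambda>h. norm x * ((1 - exp (- (Re z * h))) / h) \<le> M * norm (u h /\<^sub>R h)) (at_right 0)"
      unfolding eventually_at_right_field
    proof (intro exI[of _ 1] conjI allI impI)
      fix h :: real assume h: "0 < h"
      show "norm x * ((1 - exp (- (Re z * h))) / h) \<le> M * norm (u h /\<^sub>R h)"
        using divide_right_mono[OF key[OF h], of h] h by (simp add: divide_inverse mult_ac)
    qed simp
  qed simp
  then show ?thesis using z by (simp add: pos_le_divide_eq)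
qed

lemma average_tendsto_right:
  fixes f :: "real \<Rightarrow> 'a::banach"
  assumes f: "continuous_on {u..} f"
  shows "((\<lambda>t. integral {u..u + t} f /\<^sub>R t) \<longlongrightarrow> f u) (at_right 0)"
proof (rule tendstoI)
  fix \<epsilon> :: real assume \<epsilon>: "0 < \<epsilon>"
  have "(f \<longlongrightarrow> f u) (at u within {u..})" using f by (auto simp: continuous_on_def)
  from tendstoD[OF this, of "\<epsilon> / 2"] obtain d where d: "0 < d" "\<And>s. u \<le> s \<Longrightarrow> s < u + d \<Longrightarrow> dist (f s) (f u) < \<epsilon> / 2"
    using \<epsilon> unfolding eventually_at by (force simp: dist_real_def)
  show "eventually (\<lambda>t. dist (integral {u..u + t} f /\<^sub>R t) (f u) < \<epsilon>) (at_right 0)"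
    unfolding eventually_at_right_field
  proof (intro exI[of _ d] conjI allI impI)
    fix t :: real assume t: "0 < t" "t < d"
    have c: "continuous_on {u..u + t} f" by (rule continuous_on_subset[OF f]) auto
    have "integral {u..u + t} f - t *\<^sub>R f u = integral {u..u + t} (\<lambda>s. f s - f u)"
      using t by (subst Henstock_Kurzweil_Integration.integral_diff) (auto intro!: integrable_continuous_real c)
    also have "norm \<dots> \<le> \<epsilon> / 2 * (u + t - u)"
      using t d by (intro integral_bound) (auto intro!: continuous_intros c simp: dist_norm less_imp_le)
    finally have "norm ((integral {u..u + t} f - t *\<^sub>R f u) /\<^sub>R t) \<le> \<epsilon> / 2"
      unfolding norm_scaleR using t by (simp add: field_simps)
    moreover have "(integral {u..u + t} f - t *\<^sub>R f u) /\<^sub>R t = integral {u..u + t} f /\<^sub>R t - f u"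
      using t by (simp add: scaleR_diff_right)
    ultimately show "dist (integral {u..u + t} f /\<^sub>R t) (f u) < \<epsilon>" using \<epsilon> by (simp add: dist_norm)
  qed (rule d)
qed

text \<open>
  The averages \<open>(1/h) \<integral>\<^sub>0\<^sup>h T(s) x ds\<close> belong to the domain and tend to \<open>x\<close>.
\<close>

lemma generator_dense:
  fixes T :: "real \<Rightarrow> 'a::complex_banach \<Rightarrow>\<^sub>L 'a"
  assumes T: "c0_semigroup T" and M: "\<And>t. 0 \<le> t \<Longrightarrow> norm (T t) \<le> M"
  shows "closure (Domain (generator T)) = UNIV"
proof -
  have T0: "T 0 = id_blinfun"
    and Tadd: "\<And>s t. 0 \<le> s \<Longrightarrow> 0 \<le> t \<Longrightarrow> T (s + t) = T s o\<^sub>L T t"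
    and Tcont: "\<And>x. ((\<lambda>t. T t x) \<longlongrightarrow> x) (at_right 0)"
    using T unfolding c0_semigroup_def by auto
  have M0: "0 \<le> M" using M[of 0] norm_ge_zero[of "T 0"] by linarith
  have TM: "norm (T t v) \<le> M * norm v" if "0 \<le> t" for t v
    using order_trans[OF norm_blinfun mult_right_mono[OF M[OF that]]] by simp
  have diff_le: "norm (T s x - T t x) \<le> M * norm (T \<bar>s - t\<bar> x - x)" if "0 \<le> s" "0 \<le> t" for s t x
  proof -
    have *: "norm (T s x - T t x) \<le> M * norm (T (s - t) x - x)" if "0 \<le> t" "t \<le> s" for s t
    proof -
      have "T s x = T t (T (s - t) x)" using Tadd[of t "s - t"] that by simp
      then have "T s x - T t x = T t (T (s - t) x - x)" by (simp add: blinfun.diff_right)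
      then show ?thesis using TM[OF that(1)] by simp
    qed
    show ?thesis using *[of t s] *[of s t] that by (cases "t \<le> s") (auto simp: norm_minus_commute)
  qed
  have cont: "continuous_on {0..} (\<lambda>t. T t x)" for x
    unfolding continuous_on_iff
  proof (intro ballI allI impI)
    fix t \<epsilon> :: real assume t: "t \<in> {0..}" and \<epsilon>: "0 < \<epsilon>"
    from tendstoD[OF Tcont[of x], of "\<epsilon> / (M + 1)"] \<epsilon> M0
    obtain d where d: "0 < d" "\<And>h. 0 < h \<Longrightarrow> h < d \<Longrightarrow> dist (T h x) x < \<epsilon> / (M + 1)"
      unfolding eventually_at_right_field by auto
    show "\<exists>d>0. \<forall>s\<in>{0..}. dist s t < d \<longrightarrow> dist (T s x) (T t x) < \<epsilon>"
    proof (intro exI[of _ d] conjI ballI impI d(1))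
      fix s assume s: "s \<in> {0..}" "dist s t < d"
      have "norm (T \<bar>s - t\<bar> x - x) < \<epsilon> / (M + 1)"
        using d(2)[of "\<bar>s - t\<bar>"] s(2) \<epsilon> M0 T0 by (cases "s = t") (auto simp: dist_norm)
      then have "(M + 1) * norm (T \<bar>s - t\<bar> x - x) < \<epsilon>" using M0 by (simp add: field_simps)
      moreover have "norm (T s x - T t x) \<le> (M + 1) * norm (T \<bar>s - t\<bar> x - x)"
        using diff_le[of s t x] s t by (simp add: distrib_right add_increasing2)
      ultimately show "dist (T s x) (T t x) < \<epsilon>" by (simp add: dist_norm)
    qed
  qed
  have int: "(\<lambda>s. T s x) integrable_on {a..b}" if "0 \<le> a" for a b x
    by (rule integrable_continuous_real, rule continuous_on_subset[OF cont]) (use that in auto)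
  have in_gen: "(integral {0..h} (\<lambda>s. T s x), T h x - x) \<in> generator T" if h: "0 < h" for h x
  proof -
    let ?f = "\<lambda>s. T s x" and ?y = "integral {0..h} (\<lambda>s. T s x)"
    have shift: "T t ?y = integral {t..h + t} ?f" if t: "0 \<le> t" for t
    proof -
      have "T t ?y = integral {0..h} (\<lambda>s. T t (T s x))"
        using integral_linear[OF int[of 0 x h] blinfun.bounded_linear_right[of "T t"]] by (simp add: o_def)
      also have "\<dots> = integral {0..h} (\<lambda>s. T (s + t) x)"
        by (rule integral_cong) (use t in \<open>simp add: Tadd[symmetric] add.commute flip: blinfun_apply_blinfun_compose\<close>)
      also have "\<dots> = integral {t..h + t} ?f"
        using integral_shift_real_ivl[of t t "h + t" ?f] by simp
      finally show ?thesis .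
    qed
    have eq: "T t ?y - ?y = integral {h..h + t} ?f - integral {0..0 + t} ?f" if t: "0 < t" for t
    proof -
      have 1: "integral {0..t} ?f + integral {t..h + t} ?f = integral {0..h + t} ?f"
        using t h int by (intro Henstock_Kurzweil_Integration.integral_combine) auto
      have 2: "integral {0..h} ?f + integral {h..h + t} ?f = integral {0..h + t} ?f"
        using t h int by (intro Henstock_Kurzweil_Integration.integral_combine) auto
      show ?thesis using 1 2 shift[of t] t by (simp add: algebra_simps)
    qed
    have "((\<lambda>t. integral {h..h + t} ?f /\<^sub>R t - integral {0..0 + t} ?f /\<^sub>R t) \<longlongrightarrow> ?f h - ?f 0) (at_right 0)"
      by (intro tendsto_diff average_tendsto_right continuous_on_subset[OF cont]) (use h in auto)
    moreover have "eventually (\<lambda>t. integral {h..h + t} ?f /\<^sub>R t - integral {0..0 + t} ?f /\<^sub>R t = (T t ?y - ?y) /\<^sub>R t) (at_right 0)"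
      unfolding eventually_at_right_field
      by (intro exI[of _ 1]) (auto simp: eq scaleR_diff_right simp del: add_0)
    ultimately show ?thesis unfolding generator_def by (simp add: tendsto_cong T0)
  qed
  have "x \<in> closure (Domain (generator T))" for x
  proof (rule Lim_in_closed_set[OF closed_closure])
    have "((\<lambda>h. integral {0..0 + h} (\<lambda>s. T s x) /\<^sub>R h) \<longlongrightarrow> T 0 x) (at_right 0)"
      by (rule average_tendsto_right) (rule cont)
    then show "((\<lambda>h. integral {0..0 + h} (\<lambda>s. T s x) /\<^sub>R h) \<longlongrightarrow> x) (at_right 0)" by (simp add: T0)
    show "eventually (\<lambda>h. integral {0..0 + h} (\<lambda>s. T s x) /\<^sub>R h \<in> closure (Domain (generator T))) (at_right 0)"
      unfolding eventually_at_right_field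
    proof (intro exI[of _ 1] conjI allI impI)
      fix h :: real assume h: "0 < h"
      have "((\<lambda>t. (1 / h) *\<^sub>R ((T t (integral {0..h} (\<lambda>s. T s x)) - integral {0..h} (\<lambda>s. T s x)) /\<^sub>R t)) \<longlongrightarrow> (1 / h) *\<^sub>R (T h x - x)) (at_right 0)"
        using in_gen[OF h, of x] unfolding generator_def by (intro tendsto_intros) simp
      then have "(integral {0..h} (\<lambda>s. T s x) /\<^sub>R h, (1 / h) *\<^sub>R (T h x - x)) \<in> generator T"
        unfolding generator_def
        by (simp add: blinfun.scaleR_right scaleR_diff_right[symmetric] inverse_eq_divide mult.commute)
      then have "integral {0..h} (\<lambda>s. T s x) /\<^sub>R h \<in> Domain (generator T)" by (rule DomainI)
      then show "integral {0..0 + h} (\<lambda>s. T s x) /\<^sub>R h \<in> closure (Domain (generator T))"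
        unfolding add_0 by (rule subsetD[OF closure_subset])
    qed simp
  qed simp
  then show ?thesis by auto
qed

section \<open>Operators as graphs\<close>

text \<open>
  An everywhere defined operator as a graph. Kept as a constant of its own so that compositions,
  powers and norms of such graphs can be rewritten to the corresponding functions.
\<close>

definition graph_of :: "('a \<Rightarrow> 'a) \<Rightarrow> 'a oper"
  where "graph_of f = {(x, f x) | x. True}"

lemma in_graph_of [simp]: "(x, y) \<in> graph_of f \<longleftrightarrow> y = f x"
  by (auto simp: graph_of_def)

lemma op_app_graph [simp]: "op_app (graph_of f) x = f x"
  by (simp add: op_app_def)

lemma op_comp_graph [simp]: "op_comp (graph_of f) (graph_of g) = graph_of (\<lambda>x. f (g x))"
  by (auto simp: op_comp_def)

lemma bounded_op_graph: "bounded_linear f \<Longrightarrow> bounded_op (graph_of f)"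
  unfolding bounded_op_def graph_of_def by blast

lemma op_norm_graph: "bounded_linear f \<Longrightarrow> op_norm (graph_of f) = ennreal (onorm f)"
proof -
  assume f: "bounded_linear f"
  have "op_app (graph_of f) = f" by (rule ext) simp
  then show ?thesis by (simp add: op_norm_def bounded_op_graph[OF f])
qed

lemma graph_relpow: "graph_of f ^^ n = graph_of (f ^^ n)"
proof (induction n)
  case 0
  show ?case by (auto simp: Id_def)
next
  case (Suc n)
  have "graph_of f ^^ Suc n = graph_of (f ^^ n) O graph_of f" by (simp add: Suc)
  also have "\<dots> = graph_of (f ^^ Suc n)" by (auto simp: relcomp_unfold funpow_swap1)
  finally show ?case .
qed

text \<open>
  Used to identify the closure in the definition of \<open>f(A)\<close>, where the integral is at first taken on the
  domain of \<open>A\<close> only.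
\<close>

lemma closure_dense_graph:
  fixes F :: "'a::real_normed_vector \<Rightarrow> 'a"
  assumes F: "bounded_linear F" and D: "closure D = UNIV"
  shows "closure {(x, F x) | x. x \<in> D} = graph_of F"
proof
  have "closed {p. snd p = F (fst p)}"
    by (rule closed_Collect_eq) (intro continuous_on_snd continuous_on_fst continuous_on_id bounded_linear.continuous_on[OF F])+
  also have "{p. snd p = F (fst p)} = graph_of F" by (auto simp: graph_of_def)
  finally have cl: "closed (graph_of F)" .
  show "closure {(x, F x) | x. x \<in> D} \<subseteq> graph_of F"
    by (rule closure_minimal[OF _ cl]) auto
  show "graph_of F \<subseteq> closure {(x, F x) | x. x \<in> D}"
  proof
    fix p assume "p \<in> graph_of F"
    then obtain x where p: "p = (x, F x)" by (auto simp: graph_of_def)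
    have "x \<in> closure D" using D by simp
    then obtain s where s: "\<And>n. s n \<in> D" "s \<longlonglongrightarrow> x" unfolding closure_sequential by blast
    have "(\<lambda>n. (s n, F (s n))) \<longlonglongrightarrow> (x, F x)"
      by (intro tendsto_intros s(2) bounded_linear.tendsto[OF F])
    moreover have "(s n, F (s n)) \<in> {(x, F x) | x. x \<in> D}" for n using s(1) by blast
    ultimately show "p \<in> closure {(x, F x) | x. x \<in> D}" unfolding p closure_sequential
      by (intro exI[of _ "\<lambda>n. (s n, F (s n))"] conjI allI)
  qed
qed

context resolvent_family
begin

lemma Q_commute: "0 < s \<Longrightarrow> 0 < r \<Longrightarrow> Q s (Q r x) = Q r (Q s x)"
  using R_Q[of "of_real s" r x] linear_diff[OF bounded_linear.linear[OF bounded_linear_Q[of r]]]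
    linear_scale[OF bounded_linear.linear[OF bounded_linear_Q[of r]]]
  by (simp add: Q_def[of s])

lemma iterate_Q1_commute: "0 < s \<Longrightarrow> (Q 1 ^^ n) (Q s x) = Q s ((Q 1 ^^ n) x)"
  by (induction n) (simp_all add: Q_commute)

text \<open>
  Formally \<open>t + B = (t + (1 + t) A) (1 + A)\<^sup>-\<^sup>1\<close>, hence \<open>(t + B)\<^sup>-\<^sup>1 = (1 + A) (s + A)\<^sup>-\<^sup>1 / (1 + t)\<close> with
  \<open>s = t / (1 + t)\<close>; and \<open>(1 + A) (s + A)\<^sup>-\<^sup>1 = I + (1 - s) R(s)\<close> with \<open>1 - s = 1 / (1 + t)\<close>.
\<close>

lemma inverse_shift_Q1:
  assumes t: "0 < t"
  defines "s \<equiv> t / (1 + t)"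
  shows "op_inv (op_shift (of_real t) (graph_of (Q 1))) = graph_of (\<lambda>y. (1 / (1 + t)) *\<^sub>R (y + (1 / (1 + t)) *\<^sub>R R (of_real s) y))"
    and "Q 1 ((1 / (1 + t)) *\<^sub>R (y + (1 / (1 + t)) *\<^sub>R R (of_real s) y)) = (1 / (1 + t)) *\<^sub>R Q s y"
proof -
  define J where "J y = (1 / (1 + t)) *\<^sub>R (y + (1 / (1 + t)) *\<^sub>R R (of_real s) y)" for y
  have s: "0 < s" using t by (simp add: s_def)
  have t1: "1 + t \<noteq> 0" using t by linarith
  have s1: "1 - s = 1 / (1 + t)" using t1 by (simp add: s_def field_simps)
  have ts: "t * (1 / (1 + t)) = s" by (simp add: s_def)
  have linR: "linear (R (of_real s))" "linear (R 1)" "linear (Q 1)"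
    using linear_real[OF s] linear[of 1] bounded_linear_Q[of 1] by (auto intro: bounded_linear.linear)
  have Jlin: "J (x + y) = J x + J y" "J (c *\<^sub>R x) = c *\<^sub>R J x" for x y c
    unfolding J_def using linear_add[OF linR(1)] linear_scale[OF linR(1)] by (simp_all add: scaleR_add_right mult_ac)
  have res: "R 1 (R (of_real s) y) = (1 + t) *\<^sub>R (R (of_real s) y - R 1 y)" for y
  proof -
    have "R 1 y - R (of_real s) y = (of_real s - 1) *\<^sub>C R 1 (R (of_real s) y)"
      by (rule resolvent) (use s in auto)
    also have "\<dots> = (s - 1) *\<^sub>R R 1 (R (of_real s) y)" using scaleC_of_real[of "s - 1"] by simp
    also have "s - 1 = - (1 / (1 + t))" using s1 by simp
    finally have "R (of_real s) y - R 1 y = (1 / (1 + t)) *\<^sub>R R 1 (R (of_real s) y)" by (simp add: algebra_simps)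
    then show ?thesis using t1 by simp
  qed
  have R1J: "R 1 (J y) = (1 / (1 + t)) *\<^sub>R R (of_real s) y" for y
  proof -
    have "R 1 (J y) = (1 / (1 + t)) *\<^sub>R (R 1 y + (1 / (1 + t)) *\<^sub>R R 1 (R (of_real s) y))"
      unfolding J_def by (simp only: linear_add[OF linR(2)] linear_scale[OF linR(2)])
    also have "(1 / (1 + t)) *\<^sub>R R 1 (R (of_real s) y) = R (of_real s) y - R 1 y"
      unfolding res using t1 by simp
    finally show ?thesis by simp
  qed
  have tJ: "t *\<^sub>R J y + Q 1 (J y) = y" for y
  proof -
    have "t *\<^sub>R J y + Q 1 (J y) = (1 + t) *\<^sub>R J y - R 1 (J y)" by (simp add: Q_def scaleR_add_left)
    also have "\<dots> = y" unfolding R1J unfolding J_def using t1 by simp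
    finally show ?thesis .
  qed
  have JQ: "J (Q 1 y) = Q 1 (J y)" for y
  proof -
    have "R (of_real s) (Q 1 y) = Q 1 (R (of_real s) y)" by (rule R_Q) (use s in auto)
    then show ?thesis unfolding J_def by (simp only: linear_add[OF linR(3)] linear_scale[OF linR(3)])
  qed
  have QJ: "Q 1 (J y) = (1 / (1 + t)) *\<^sub>R Q s y" for y
  proof -
    have "Q 1 (J y) = y - t *\<^sub>R J y" using tJ[of y] by (simp add: eq_diff_eq add.commute)
    also have "t *\<^sub>R J y = s *\<^sub>R (y + (1 / (1 + t)) *\<^sub>R R (of_real s) y)" unfolding J_def by (simp only: scaleR_scaleR ts)
    also have "y - \<dots> = (1 - s) *\<^sub>R y - (s * (1 / (1 + t))) *\<^sub>R R (of_real s) y"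
      by (simp add: scaleR_add_right scaleR_diff_left)
    finally show ?thesis unfolding s1 by (simp add: Q_def scaleR_diff_right mult.commute)
  qed
  show "Q 1 ((1 / (1 + t)) *\<^sub>R (y + (1 / (1 + t)) *\<^sub>R R (of_real s) y)) = (1 / (1 + t)) *\<^sub>R Q s y"
    using QJ[of y] by (simp add: J_def)
  have "op_inv (op_shift (of_real t) (graph_of (Q 1))) = {(t *\<^sub>R x + Q 1 x, x) | x. True}"
    by (auto simp: op_inv_def op_shift_def scaleC_of_real)
  also have "\<dots> = graph_of J"
  proof -
    have "J (t *\<^sub>R x + Q 1 x) = x" for x using tJ[of x] by (simp add: Jlin JQ)
    moreover have "\<exists>x. y = t *\<^sub>R x + Q 1 x \<and> J y = x" for y using tJ[of y] by metis
    ultimately show ?thesis by auto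
  qed
  finally show "op_inv (op_shift (of_real t) (graph_of (Q 1))) = graph_of (\<lambda>y. (1 / (1 + t)) *\<^sub>R (y + (1 / (1 + t)) *\<^sub>R R (of_real s) y))"
    by (simp only: J_def[abs_def])
qed

lemma op_quot_Q1:
  assumes "0 < t"
  shows "op_app (op_quot (graph_of (Q 1)) t) x = (1 / (1 + t)) *\<^sub>R Q (t / (1 + t)) x"
  unfolding op_quot_def inverse_shift_Q1(1)[OF assms] op_comp_graph op_app_graph
  by (rule inverse_shift_Q1(2)[OF assms])

lemma frac_power_graph:
  assumes \<gamma>: "0 < \<gamma>"
    and Y0: "frac \<gamma> = 0 \<Longrightarrow> Y = (\<lambda>x. x)"
    and Y: "\<And>x. frac \<gamma> \<noteq> 0 \<Longrightarrow> \<exists>w. has_bochner lborel_pos (\<lambda>t. (t powr (frac \<gamma> - 1) / (1 + t)) *\<^sub>R Q (t / (1 + t)) x) w \<and>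
      Y x = (sin (pi * frac \<gamma>) / pi) *\<^sub>R w"
  shows "frac_power (graph_of (Q 1)) \<gamma> = graph_of (\<lambda>x. (Q 1 ^^ nat \<lfloor>\<gamma>\<rfloor>) (Y x))"
proof -
  have "(if frac \<gamma> = 0 then Id else balakrishnan (graph_of (Q 1)) (frac \<gamma>)) = graph_of Y"
  proof (cases "frac \<gamma> = 0")
    case True
    then show ?thesis using Y0 by (auto simp: Id_def)
  next
    case False
    have eq: "has_bochner lborel_pos (\<lambda>t. (t powr (frac \<gamma> - 1)) *\<^sub>R op_app (op_quot (graph_of (Q 1)) t) x) w
      \<longleftrightarrow> has_bochner lborel_pos (\<lambda>t. (t powr (frac \<gamma> - 1) / (1 + t)) *\<^sub>R Q (t / (1 + t)) x) w" for x w
      by (rule has_bochner_cong) (simp add: space_restrict_space op_quot_Q1)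
    have "(x, y) \<in> balakrishnan (graph_of (Q 1)) (frac \<gamma>) \<longleftrightarrow> y = Y x" for x y
    proof -
      obtain w where w: "has_bochner lborel_pos (\<lambda>t. (t powr (frac \<gamma> - 1) / (1 + t)) *\<^sub>R Q (t / (1 + t)) x) w"
        "Y x = (sin (pi * frac \<gamma>) / pi) *\<^sub>R w" using Y[OF False] by blast
      have "has_bochner lborel_pos (\<lambda>t. (t powr (frac \<gamma> - 1) / (1 + t)) *\<^sub>R Q (t / (1 + t)) x) v \<longleftrightarrow> v = w" for v
        using w(1) has_bochner_unique by blast
      then show ?thesis unfolding balakrishnan_def eq w(2) by simp
    qed
    then have "balakrishnan (graph_of (Q 1)) (frac \<gamma>) = graph_of Y" by (auto simp: graph_of_def)
    then show ?thesis using False by simp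
  qed
  then show ?thesis by (simp add: frac_power_def graph_relpow)
qed

end

locale negative_generator = resolvent_family R M for R :: "complex \<Rightarrow> 'a::complex_banach \<Rightarrow> 'a" and M +
  fixes A :: "'a oper"
  assumes inverse_shift: "\<And>z. z \<noteq> 0 \<Longrightarrow> 0 \<le> Re z \<Longrightarrow> op_inv (op_shift z A) = graph_of (R z)"
    and single_valued: "\<And>x y y'. (x, y) \<in> A \<Longrightarrow> (x, y') \<in> A \<Longrightarrow> y = y'"
    and dense: "closure (Domain A) = UNIV"
begin

lemma resolvent_in_graph: assumes "z \<noteq> 0" "0 \<le> Re z" shows "(R z v, v - z *\<^sub>C R z v) \<in> A"
proof -
  have "(v, R z v) \<in> op_inv (op_shift z A)" unfolding inverse_shift[OF assms] by simp
  then obtain y where y: "(R z v, y) \<in> A" "v = z *\<^sub>C R z v + y"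
    unfolding op_inv_def op_shift_def by auto
  from y(2) have "v - z *\<^sub>C R z v = y" by (simp add: diff_eq_eq add.commute)
  then show ?thesis using y(1) by simp
qed

lemma op_quot_graph: assumes "0 < t" shows "op_quot A t = graph_of (Q t)"
proof -
  have g: "(R (of_real t) v, Q t v) \<in> A" for v
    using resolvent_in_graph[of "of_real t" v] assms by (simp add: Q_def scaleC_of_real)
  have "op_quot A t = graph_of (R (of_real t)) O A"
    using inverse_shift[of "of_real t"] assms by (simp add: op_quot_def op_comp_def)
  also have "\<dots> = graph_of (Q t)" using g single_valued by (auto 0 3)
  finally show ?thesis .
qed

lemma cbf_op_of_graph:
  assumes F: "bounded_linear F" "\<And>x. has_bochner \<mu> (\<lambda>t. Q t x) (F x)" and sp: "space \<mu> \<subseteq> {0<..}"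
  shows "cbf_op_of 0 0 \<mu> A = graph_of F"
proof -
  have eq: "has_bochner \<mu> (\<lambda>t. op_app (op_quot A t) x) w \<longleftrightarrow> w = F x" for x w
  proof -
    have "has_bochner \<mu> (\<lambda>t. op_app (op_quot A t) x) w \<longleftrightarrow> has_bochner \<mu> (\<lambda>t. Q t x) w"
      by (rule has_bochner_cong) (use sp in \<open>simp add: op_quot_graph subset_eq\<close>)
    then show ?thesis using has_bochner_unique F(2) by metis
  qed
  have "{(x, 0 *\<^sub>R x + 0 *\<^sub>R y + w) | x y w. (x, y) \<in> A \<and> has_bochner \<mu> (\<lambda>t. op_app (op_quot A t) x) w}
      = {(x, F x) | x. x \<in> Domain A}"
    unfolding eq by auto
  then show ?thesis unfolding cbf_op_of_def by (simp only: closure_dense_graph[OF F(1) dense])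
qed

end

text \<open>
  The half-plane \<open>Re z \<ge> 0\<close> without \<open>0\<close> consists of points with \<open>-z\<close> in the resolvent set, and there
  \<open>z + A = -((-z) - A)\<close>. The generator is complex linear because the semigroup is.
\<close>

lemma negative_generator_of_semigroup:
  fixes T :: "real \<Rightarrow> 'a::complex_banach \<Rightarrow>\<^sub>L 'a" and A :: "'a oper"
  assumes T: "c0_semigroup T" and "bounded_semigroup T" and gen: "generator T = op_neg A"
    and spec: "op_spectrum A \<subseteq> {z. 0 < Re z} \<union> {0}"
  shows "\<exists>M. negative_generator (\<lambda>z. op_app (op_inv (op_shift z A))) M A"
proof -
  obtain M where M: "\<And>t. 0 \<le> t \<Longrightarrow> norm (T t) \<le> M" using assms(2) unfolding bounded_semigroup_def by blast
  have M0: "0 \<le> M" using M[of 0] norm_ge_zero[of "T 0"] by linarith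
  define R where "R z = op_app (op_inv (op_shift z A))" for z
  have A_iff: "(x, y) \<in> A \<longleftrightarrow> (x, - y) \<in> generator T" for x y
    unfolding gen op_neg_def by (auto simp: minus_equation_iff)
  have single: "y = y'" if "(x, y) \<in> A" "(x, y') \<in> A" for x y y'
  proof -
    have "((\<lambda>t. (T t x - x) /\<^sub>R t) \<longlongrightarrow> - y) (at_right 0)" "((\<lambda>t. (T t x - x) /\<^sub>R t) \<longlongrightarrow> - y') (at_right 0)"
      using that by (simp_all add: A_iff generator_def)
    from tendsto_unique[OF _ this] show ?thesis by simp
  qed
  have A_scaleC: "(c *\<^sub>C x, c *\<^sub>C y) \<in> A" if "(x, y) \<in> A" for c x y
  proof -
    have "((\<lambda>t. c *\<^sub>C ((T t x - x) /\<^sub>R t)) \<longlongrightarrow> c *\<^sub>C (- y)) (at_right 0)"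
      using that by (intro bounded_linear.tendsto[OF bounded_linear_scaleC]) (simp add: A_iff generator_def)
    moreover have "eventually (\<lambda>t. c *\<^sub>C ((T t x - x) /\<^sub>R t) = (T t (c *\<^sub>C x) - c *\<^sub>C x) /\<^sub>R t) (at_right 0)"
      unfolding eventually_at_right_field
    proof (intro exI[of _ 1] conjI allI impI)
      fix t :: real assume "0 < t"
      then have "T t (c *\<^sub>C x) = c *\<^sub>C T t x" using T by (simp add: c0_semigroup_def)
      moreover have "c *\<^sub>C ((T t x - x) /\<^sub>R t) = (c *\<^sub>C (T t x - x)) /\<^sub>R t"
        by (rule linear_scale[OF bounded_linear.linear[OF bounded_linear_scaleC]])
      ultimately show "c *\<^sub>C ((T t x - x) /\<^sub>R t) = (T t (c *\<^sub>C x) - c *\<^sub>C x) /\<^sub>R t"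
        by (simp only: scaleC_diff_right)
    qed simp
    ultimately show ?thesis by (simp add: A_iff generator_def tendsto_cong scaleC_minus_right)
  qed
  have R: "op_inv (op_shift z A) = graph_of (R z) \<and> bounded_linear (R z)" if z: "z \<noteq> 0" "0 \<le> Re z" for z
  proof -
    have "- z \<notin> op_spectrum A" using spec z by auto
    then have "bounded_op (op_inv (op_shift (- z) (op_neg A)))" by (simp add: op_spectrum_def op_resolvent_set_def)
    then obtain f where f: "bounded_linear f" "op_inv (op_shift (- z) (op_neg A)) = graph_of f" unfolding bounded_op_def graph_of_def by blast
    have inv: "(v, x) \<in> op_inv (op_shift z A) \<longleftrightarrow> x = f (- v)" for v x
    proof -
      have "(v, x) \<in> op_inv (op_shift z A) \<longleftrightarrow> (\<exists>y. (x, y) \<in> A \<and> v = z *\<^sub>C x + y)"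
        by (auto simp: op_inv_def op_shift_def)
      also have "\<dots> \<longleftrightarrow> (\<exists>y. (x, y) \<in> A \<and> - v = - (z *\<^sub>C x) + - y)"
        by (simp only: minus_add_distrib[symmetric] neg_equal_iff_equal)
      also have "\<dots> \<longleftrightarrow> (- v, x) \<in> op_inv (op_shift (- z) (op_neg A))"
        by (auto simp: op_inv_def op_shift_def op_neg_def scaleC_minus_left)
      also have "\<dots> \<longleftrightarrow> x = f (- v)" unfolding f(2) by simp
      finally show ?thesis .
    qed
    then have eq: "op_inv (op_shift z A) = graph_of (\<lambda>v. f (- v))" by (auto simp: graph_of_def)
    then have Rz: "R z = (\<lambda>v. f (- v))" unfolding R_def by (simp add: fun_eq_iff)
    show ?thesis unfolding eq Rz
      using bounded_linear_compose[OF f(1) bounded_linear_minus[OF bounded_linear_ident]] by simp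
  qed
  have R_in: "(R z v, v - z *\<^sub>C R z v) \<in> A" if "z \<noteq> 0" "0 \<le> Re z" for z v
  proof -
    have "(v, R z v) \<in> op_inv (op_shift z A)" using R[OF that] by auto
    then obtain y where y: "(R z v, y) \<in> A" "v = z *\<^sub>C R z v + y" unfolding op_inv_def op_shift_def by auto
    from y(2) have "v - z *\<^sub>C R z v = y" by (simp add: diff_eq_eq add.commute)
    then show ?thesis using y(1) by simp
  qed
  have R_eq: "R z (z *\<^sub>C x + y) = x" if "z \<noteq> 0" "0 \<le> Re z" "(x, y) \<in> A" for z x y
  proof -
    have "(z *\<^sub>C x + y, x) \<in> op_inv (op_shift z A)" using that(3) unfolding op_inv_def op_shift_def by auto
    then show ?thesis using R[OF that(1,2)] by auto
  qed
  have "negative_generator R M A"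
  proof (intro negative_generator.intro resolvent_family.intro negative_generator_axioms.intro)
    show "bounded_linear (R z)" if "z \<noteq> 0" "0 \<le> Re z" for z using R[OF that] by simp
    show "R z (c *\<^sub>C x) = c *\<^sub>C R z x" if "z \<noteq> 0" "0 \<le> Re z" for z c x
      using R_eq[OF that A_scaleC[OF R_in[OF that, of x], of c]]
      by (simp add: scaleC_diff_right scaleC_scaleC mult.commute)
    show "R z x - R w x = (w - z) *\<^sub>C R z (R w x)" if zw: "z \<noteq> 0" "0 \<le> Re z" "w \<noteq> 0" "0 \<le> Re w" for z w x
    proof -
      have lin: "linear (R z)" using R[OF zw(1,2)] by (auto intro: bounded_linear.linear)
      have sc: "R z (c *\<^sub>C x) = c *\<^sub>C R z x" for c x
        using R_eq[OF zw(1,2) A_scaleC[OF R_in[OF zw(1,2), of x], of c]]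
        by (simp add: scaleC_diff_right scaleC_scaleC mult.commute)
      have "R z (z *\<^sub>C R w x + (x - w *\<^sub>C R w x)) = R w x" by (rule R_eq[OF zw(1,2) R_in[OF zw(3,4)]])
      also have "z *\<^sub>C R w x + (x - w *\<^sub>C R w x) = x - (w - z) *\<^sub>C R w x" by (simp add: scaleC_diff_left)
      also have "R z \<dots> = R z x - (w - z) *\<^sub>C R z (R w x)" by (simp only: linear_diff[OF lin] sc)
      finally show ?thesis by (simp add: algebra_simps)
    qed
    show "norm (R z x) \<le> M / Re z * norm x" if z: "0 < Re z" for z x
    proof -
      have z': "z \<noteq> 0" "0 \<le> Re z" using z by auto
      have "(R z x, - (x - z *\<^sub>C R z x)) \<in> generator T" using R_in[OF z', of x] by (simp only: A_iff)
      from semigroup_resolvent_estimate[OF T M this z] show ?thesis by simp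
    qed
    show "0 \<le> M" by (rule M0)
    show "op_inv (op_shift z A) = graph_of (R z)" if "z \<noteq> 0" "0 \<le> Re z" for z using R[OF that] by simp
    show "y = y'" if "(x, y) \<in> A" "(x, y') \<in> A" for x y y' using single[OF that] .
    have "Domain A = Domain (generator T)" unfolding gen op_neg_def by auto
    then show "closure (Domain A) = UNIV" using generator_dense[OF T M] by simp
  qed
  then show ?thesis unfolding R_def by blast
qed

section \<open>The resolvent estimate\<close>

theorem theorem7p3:
  fixes T :: "real \<Rightarrow> 'a::complex_banach \<Rightarrow>\<^sub>L 'a"
    and A :: "'a oper"
    and l :: "real \<Rightarrow> real"
    and \<alpha> \<beta> :: real
  assumes "c0_semigroup T"
    and "bounded_semigroup T"
    and "generator T = op_neg A"
    and "0 \<in> op_spectrum A"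
    and "op_spectrum A \<subseteq> {z. 0 < Re z} \<union> {0}"
    and "(\<lambda>s::real. enn2real (op_norm (op_inv (op_shift (\<i> * of_real s) A)))) \<in> O[at_infinity](\<lambda>_. 1)"
    and "slowly_varying l"
    and "0 < \<beta>" and "\<beta> \<le> 1"
    and "mono_on {0..} (reg_fun \<beta> l)"
    and "1 < \<alpha>"
    and "(\<lambda>s::real. enn2real (op_norm (op_inv (op_shift (\<i> * of_real s) A))))
           \<in> O[at 0](\<lambda>s. 1 / (\<bar>s\<bar> powr \<alpha> * l (1 / \<bar>s\<bar>)))"
  shows "(SUP z\<in>{z. 0 < Re z}. op_norm (op_comp (op_inv (op_shift z A)) (V_op \<alpha> \<beta> l A))) < \<infinity>"
proof -
  define R where "R z = op_app (op_inv (op_shift z A))" for z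
  obtain M where "negative_generator R M A"
    using negative_generator_of_semigroup[OF assms(1,2,3,5)] unfolding R_def by blast
  then interpret negative_generator R M A .
  define N where "N \<tau> = onorm (R (\<i> * of_real \<tau>))" for \<tau>
  have lin: "bounded_linear (R (\<i> * of_real \<tau>))" if "\<tau> \<noteq> 0" for \<tau> using that by (intro linear) auto
  have N_eq: "enn2real (op_norm (op_inv (op_shift (\<i> * of_real \<tau>) A))) = N \<tau>" if "\<tau> \<noteq> 0" for \<tau>
    using that op_norm_graph[OF lin[OF that]] onorm_pos_le[OF lin[OF that]] by (simp add: inverse_shift N_def)
  have N_nn: "0 \<le> N \<tau>" if "\<tau> \<noteq> 0" for \<tau> unfolding N_def by (rule onorm_pos_le[OF lin[OF that]])
  have l_pos: "0 < l s" if "0 \<le> s" for s using assms(7) that by (simp add: slowly_varying_def)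

  define \<gamma> where "\<gamma> = \<alpha> - \<beta>"
  define e where "e = min (\<gamma> - 1) 0"
  \<comment> \<open>Small enough for \<open>\<integral> s\<^sup>e d\<mu>(s)\<close> to converge, where \<open>f\<^sub>m\<close> is of order \<open>t\<^bsup>\<beta>-\<epsilon>\<^esup>\<close> near \<open>0\<close>.\<close>
  define \<epsilon> where "\<epsilon> = (\<beta> + e) / 2"
  have \<gamma>: "0 < \<gamma>" using assms(9,11) by (simp add: \<gamma>_def)
  have be: "0 < \<beta> + e" using assms(8,11) by (auto simp: e_def \<gamma>_def)
  have e0: "e \<le> 0" by (simp add: e_def)
  have \<epsilon>: "0 < \<epsilon>" "\<epsilon> < \<beta>" "0 < \<beta> - \<epsilon> + e" using be e0 assms(8) by (auto simp: \<epsilon>_def field_simps)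

  let ?f = "f_m (reg_fun \<beta> l)"
  note fm = assms(7,8,9,10)
  obtain a b \<mu> where abmu: "(SOME (a, b, \<mu>). cbf_rep ?f a b \<mu>) = (a, b, \<mu>)"
    by (cases "SOME (a, b, \<mu>). cbf_rep ?f a b \<mu>") auto
  \<comment> \<open>The chosen triple represents \<open>f\<^sub>m\<close> because some triple does.\<close>
  have rep: "cbf_rep ?f a b \<mu>"
    using someI_ex[of "\<lambda>(a, b, \<mu>). cbf_rep ?f a b \<mu>"] f_m_cbf[OF fm] abmu by fastforce
  have \<mu>_sets: "sets \<mu> = sets (restrict_space borel {0<..})" using rep by (simp add: cbf_rep_def)
  obtain C where C: "0 \<le> C" "\<And>t. 0 < t \<Longrightarrow> t \<le> 1 \<Longrightarrow> ?f t \<le> C * t powr (\<beta> - \<epsilon>)"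
    using f_m_le_powr[OF fm \<epsilon>(1,2)] by blast
  have \<epsilon>': "0 < \<beta> - \<epsilon>" using \<epsilon> by simp
  have a0: "a = 0" and b0: "b = 0" and mass1: "emeasure \<mu> (space \<mu>) \<le> 1"
    and f_eq: "\<And>t. 0 < t \<Longrightarrow> (\<integral>\<^sup>+s. ennreal (t / (s + t)) \<partial>\<mu>) = ennreal (?f t)"
    using cbf_rep_bounded_vanishing[OF rep _ _ \<epsilon>', of C] f_m_le_1[OF fm] C(2) by blast+
  have mass: "emeasure \<mu> (space \<mu>) < \<infinity>"
    using le_less_trans[OF mass1 ennreal_one_less_top] by simp

  have "(\<integral>\<^sup>+t. ennreal 1 \<partial>\<mu>) = emeasure \<mu> (space \<mu>)" by simp
  then have one: "(\<integral>\<^sup>+t. ennreal 1 \<partial>\<mu>) < \<infinity>" using mass by (simp only:)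
  have fin: "emeasure \<mu> {a..b} < \<infinity>" for a b :: real
    using emeasure_space[of \<mu> "{a..b}"] mass by (rule le_less_trans)
  obtain F where F: "bounded_linear F" "\<And>x. has_bochner \<mu> (\<lambda>t. 1 *\<^sub>R Q t x) (F x)"
    "\<And>L x. bounded_linear L \<Longrightarrow> (\<And>s x. 0 < s \<Longrightarrow> L (Q s x) = Q s (L x)) \<Longrightarrow> L (F x) = F (L x)"
    "\<And>(L :: 'a \<Rightarrow> 'a) h x. bounded_linear L \<Longrightarrow> h \<in> borel_measurable \<mu> \<Longrightarrow> (\<And>t. 0 < t \<Longrightarrow> ennreal (norm (1 *\<^sub>R L (Q t x))) \<le> h t)
      \<Longrightarrow> ennreal (norm (L (F x))) \<le> (\<integral>\<^sup>+t. h t \<partial>\<mu>)"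
    using weighted_average[OF \<mu>_sets fin continuous_on_const _ _ one continuous_on_id] by auto
  obtain Y K where Y: "bounded_linear Y"
    "frac \<gamma> = 0 \<Longrightarrow> Y = (\<lambda>x. x)"
    "\<And>x. frac \<gamma> \<noteq> 0 \<Longrightarrow> \<exists>w. has_bochner lborel_pos (\<lambda>t. (t powr (frac \<gamma> - 1) / (1 + t)) *\<^sub>R Q (t / (1 + t)) x) w \<and>
      Y x = (sin (pi * frac \<gamma>) / pi) *\<^sub>R w"
    "\<And>L x. bounded_linear L \<Longrightarrow> (\<And>s x. 0 < s \<Longrightarrow> L (Q s x) = Q s (L x)) \<Longrightarrow> L (Y x) = Y (L x)"
    and K: "0 \<le> K"
    "\<And>\<tau> N x. \<tau> \<noteq> 0 \<Longrightarrow> \<bar>\<tau>\<bar> \<le> 1 \<Longrightarrow> 0 \<le> N \<Longrightarrow> (\<And>x. norm (R (\<i> * of_real \<tau>) x) \<le> N * norm x) \<Longrightarrow>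
      norm (R (\<i> * of_real \<tau>) ((Q 1 ^^ nat \<lfloor>\<gamma>\<rfloor>) (Y x))) \<le> K * (\<bar>\<tau>\<bar> powr \<gamma> * N + \<bar>\<tau>\<bar> powr e) * norm x"
    "\<And>s x. 0 < s \<Longrightarrow> norm (R (of_real s) ((Q 1 ^^ nat \<lfloor>\<gamma>\<rfloor>) (Y x))) \<le> K * s powr e * norm x"
    by (rule fractional_power_estimates[OF \<gamma>, folded e_def]) (rule that; blast)
  define W where "W x = (Q 1 ^^ nat \<lfloor>\<gamma>\<rfloor>) (Y x)" for x
  have W_lin: "bounded_linear W" unfolding W_def[abs_def]
    by (rule bounded_linear_compose[OF bounded_linear_iterate_Q1 Y(1)])
  have W_Q: "W (Q s x) = Q s (W x)" if "0 < s" for s x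
  proof -
    have "Q s (Y x) = Y (Q s x)" by (rule Y(4)[OF bounded_linear_Q[OF that]]) (rule Q_commute[OF that])
    then show ?thesis by (simp add: W_def iterate_Q1_commute[OF that, symmetric])
  qed

  obtain c d where c: "0 < c" and d: "0 < d" "\<And>s. s \<noteq> 0 \<Longrightarrow> \<bar>s\<bar> < d \<Longrightarrow> N s \<le> c / (\<bar>s\<bar> powr \<alpha> * l (1 / \<bar>s\<bar>))"
  proof -
    from landau_o.bigE[OF assms(12)] obtain c where c: "0 < c"
      and ev: "eventually (\<lambda>s. norm (enn2real (op_norm (op_inv (op_shift (\<i> * of_real s) A)))) \<le> c * norm (1 / (\<bar>s\<bar> powr \<alpha> * l (1 / \<bar>s\<bar>)))) (at 0)"
      by blast
    from ev obtain d where d: "0 < d" "\<And>s. s \<noteq> 0 \<Longrightarrow> \<bar>s\<bar> < d \<Longrightarrow>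
        norm (enn2real (op_norm (op_inv (op_shift (\<i> * of_real s) A)))) \<le> c * norm (1 / (\<bar>s\<bar> powr \<alpha> * l (1 / \<bar>s\<bar>)))"
      unfolding eventually_at by (auto simp: dist_real_def)
    show thesis
    proof (rule that[OF c d(1)])
      fix s :: real assume s: "s \<noteq> 0" "\<bar>s\<bar> < d"
      have "N s \<le> c * norm (1 / (\<bar>s\<bar> powr \<alpha> * l (1 / \<bar>s\<bar>)))" using d(2)[OF s] N_nn[OF s(1)] by (simp add: N_eq[OF s(1)])
      also have "norm (1 / (\<bar>s\<bar> powr \<alpha> * l (1 / \<bar>s\<bar>))) = 1 / (\<bar>s\<bar> powr \<alpha> * l (1 / \<bar>s\<bar>))"
        using l_pos[of "1 / \<bar>s\<bar>"] by simp
      finally show "N s \<le> c / (\<bar>s\<bar> powr \<alpha> * l (1 / \<bar>s\<bar>))" by simp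
    qed
  qed
  obtain E0 where far: "\<exists>T. \<forall>\<tau>. T \<le> \<bar>\<tau>\<bar> \<longrightarrow> \<tau> \<noteq> 0 \<longrightarrow> N \<tau> \<le> E0"
  proof -
    from landau_o.bigE[OF assms(6)] obtain c where
      ev: "eventually (\<lambda>s::real. norm (enn2real (op_norm (op_inv (op_shift (\<i> * of_real s) A)))) \<le> c * norm (1::real)) at_infinity"
      by blast
    then obtain T where T: "\<And>s::real. T \<le> \<bar>s\<bar> \<Longrightarrow> norm (enn2real (op_norm (op_inv (op_shift (\<i> * of_real s) A)))) \<le> c"
      unfolding eventually_at_infinity by auto
    have "N \<tau> \<le> c" if "T \<le> \<bar>\<tau>\<bar>" "\<tau> \<noteq> 0" for \<tau>
      using T[OF that(1)] N_nn[OF that(2)] by (simp add: N_eq[OF that(2)])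
    then show thesis using that by blast
  qed
  obtain C1 t0 where C1: "0 \<le> C1" and t0: "0 < t0" "\<And>t. 0 < t \<Longrightarrow> t \<le> t0 \<Longrightarrow> ?f t \<le> C1 * (t powr \<beta> * l (1 / t))"
    using f_m_le_regular[OF fm] by blast
  define \<delta> where "\<delta> = min 1 (min t0 (d / 2))"
  have \<delta>: "0 < \<delta>" "\<delta> \<le> 1" "\<delta> \<le> t0" "\<delta> < d" using t0 d by (auto simp: \<delta>_def)
  \<comment> \<open>\<open>\<tau>\<^sup>\<beta> \<ell>(1/\<tau>) \<cdot> \<tau>\<^sup>\<gamma> / (\<tau>\<^sup>\<alpha> \<ell>(1/\<tau>)) = 1\<close>\<close>
  have near: "?f \<bar>\<tau>\<bar> * (\<bar>\<tau>\<bar> powr \<gamma> * N \<tau>) \<le> C1 * c" if \<tau>: "\<tau> \<noteq> 0" "\<bar>\<tau>\<bar> \<le> \<delta>" for \<tau>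
  proof -
    let ?t = "\<bar>\<tau>\<bar>"
    have t: "0 < ?t" using \<tau> by simp
    have lp: "0 < l (1 / ?t)" using l_pos[of "1 / ?t"] by simp
    have "?f ?t * (?t powr \<gamma> * N \<tau>) \<le> C1 * (?t powr \<beta> * l (1 / ?t)) * (?t powr \<gamma> * (c / (?t powr \<alpha> * l (1 / ?t))))"
      using \<tau> \<delta> t lp C1 N_nn[OF \<tau>(1)] by (intro mult_mono t0(2) d(2) mult_left_mono) auto
    also have "\<dots> = C1 * c * (?t powr \<beta> * ?t powr \<gamma> / ?t powr \<alpha>)" using lp by simp
    also have "?t powr \<beta> * ?t powr \<gamma> = ?t powr \<alpha>" by (simp add: powr_add[symmetric] \<gamma>_def)
    finally show ?thesis using t by simp
  qed
  obtain E where E: "\<And>\<tau>. \<delta> \<le> \<bar>\<tau>\<bar> \<Longrightarrow> N \<tau> \<le> E"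
    using far imaginary_bounded_away[OF _ \<delta>(1)] unfolding N_def by metis

  have "\<exists>B. \<forall>z x. 0 < Re z \<longrightarrow> norm (R z (W (F x))) \<le> B * norm x"
  proof (rule half_plane_bound_of_average[OF \<mu>_sets mass f_eq f_m_nonneg[OF fm] C(2) C(1) e0 \<epsilon>(3) F(1) _ _ _ N_nn K(1) W_lin _ _ \<delta>(1,2) near E])
    show "W (F x) = F (W x)" for x by (rule F(3)[OF W_lin W_Q])
    show "ennreal (norm (L (F x))) \<le> (\<integral>\<^sup>+t. h t \<partial>\<mu>)"
      if "bounded_linear L" "h \<in> borel_measurable \<mu>" "\<And>t. 0 < t \<Longrightarrow> ennreal (norm (L (Q t x))) \<le> h t"
      for L :: "'a \<Rightarrow> 'a" and h x by (rule F(4)[OF that(1,2)]) (simp add: that(3))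
    show N: "norm (R (\<i> * of_real \<tau>) x) \<le> N \<tau> * norm x" if "\<tau> \<noteq> 0" for \<tau> x
      unfolding N_def by (rule onorm[OF lin[OF that]])
    show "norm (R (\<i> * of_real \<tau>) (W x)) \<le> K * (\<bar>\<tau>\<bar> powr \<gamma> * N \<tau> + \<bar>\<tau>\<bar> powr e) * norm x"
      if "\<tau> \<noteq> 0" "\<bar>\<tau>\<bar> \<le> 1" for \<tau> x
      unfolding W_def by (rule K(2)[OF that N_nn[OF that(1)] N[OF that(1)]])
    show "norm (R (of_real s) (W x)) \<le> K * s powr e * norm x" if "0 < s" for s x
      unfolding W_def by (rule K(3)[OF that])
  qed
  then obtain B where B: "\<And>z x. 0 < Re z \<Longrightarrow> norm (R z (W (F x))) \<le> B * norm x" by blast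

  have "cbf_op ?f A = cbf_op_of a b \<mu> A" unfolding cbf_op_def abmu by simp
  also have "\<dots> = graph_of F"
    unfolding a0 b0 using F(1,2) sets_eq_imp_space_eq[OF \<mu>_sets]
    by (intro cbf_op_of_graph) (simp_all add: space_restrict_space)
  finally have cbf: "cbf_op ?f A = graph_of F" .
  have "frac_power (graph_of (Q 1)) \<gamma> = graph_of W"
    unfolding W_def[abs_def] by (rule frac_power_graph[OF \<gamma> Y(2,3)])
  then have V: "V_op \<alpha> \<beta> l A = graph_of (\<lambda>x. W (F x))"
    by (simp add: V_op_def cbf op_quot_graph \<gamma>_def)
  have "op_norm (op_comp (op_inv (op_shift z A)) (V_op \<alpha> \<beta> l A)) \<le> ennreal (max B 0)" if z: "0 < Re z" for z
  proof -
    have z': "z \<noteq> 0" "0 \<le> Re z" using z by auto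
    have bl: "bounded_linear (\<lambda>x. R z (W (F x)))"
      by (intro bounded_linear_compose[OF linear[OF z']] bounded_linear_compose[OF W_lin F(1)])
    have "onorm (\<lambda>x. R z (W (F x))) \<le> max B 0"
    proof (rule onorm_bound)
      fix x
      show "norm (R z (W (F x))) \<le> max B 0 * norm x"
        using B[OF z, of x] mult_right_mono[of B "max B 0" "norm x"] by simp
    qed simp
    then show ?thesis unfolding V inverse_shift[OF z'] op_comp_graph op_norm_graph[OF bl] by (rule ennreal_leI)
  qed
  then have "(SUP z\<in>{z. 0 < Re z}. op_norm (op_comp (op_inv (op_shift z A)) (V_op \<alpha> \<beta> l A))) \<le> ennreal (max B 0)"
    by (intro SUP_least) auto
  also have "\<dots> < \<infinity>" by simp
  finally show ?thesis .
qed

end
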